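(* Let $(\boldsymbol{\Gamma},\mathsf{Y})$ be a graph of groups, where $\mathsf{Y}=(\mathsf{V},\mathsf{E})$, and let $\mathsf{v}_0\in\mathsf{V}$ be a base vertex. Suppose $\mathsf{E}\neq\varnothing$. For $d\geq 3$, consider discrete and faithful representations $\rho_{\mathsf v}:\Gamma_{\mathsf v}\to\mathrm{PGL}(d,\mathbb{R})$ for each $\mathsf v\in\mathsf V$, and elements $g_{\mathsf e}\in\mathrm{PGL}(d,\mathbb{R})$ for each oriented edge $\mathsf e\in\vec{\mathsf E}$, such that $g_{\mathsf e}=g_{\overline{\mathsf e}}^{-1}$ for all $\mathsf e\in\vec{\mathsf E}$, and $\rho_{\mathsf o(\mathsf e)}(\gamma^{\mathsf e})=g_{\mathsf e}\,\rho_{\mathsf t(\mathsf e)}(\gamma^{\overline{\mathsf e}})\,g_{\mathsf e}^{-1}$ for all $\mathsf e\in\vec{\mathsf E}$ and all $\gamma\in\Gamma_{|\mathsf e|}$. Let $\underline{\rho}:F(\boldsymbol{\Gamma},\mathsf Y)\to\mathrm{PGL}(d,\mathbb{R})$ be the associated representation, whose restriction to each $\Gamma_{\mathsf v}$ is $\rho_{\mathsf v}$ and which sends each $\mathsf e\in\vec{\mathsf E}$ to $g_{\mathsf e}$, and let $\rho:\pi_1(\boldsymbol{\Gamma},\mathsf Y,\mathsf v_0)\to\mathrm{PGL}(d,\mathbb{R})$ be its restriction. For each $\mathsf v\in\mathsf V$, let $\Omega_{\mathsf v}$ be a $\rho_{\mathsf v}(\Gamma_{\mathsf v})$-invariant properly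 convex open subset of $\mathbb{P}(\mathbb{R}^d)$. Suppose that for all oriented edges $\mathsf e,\mathsf e'\in\vec{\mathsf E}$ with $\mathsf o(\mathsf e)=\mathsf o(\mathsf e')=:\mathsf v$, and for each $\gamma\in\Gamma_{\mathsf v}$ such that either $\mathsf e\neq\mathsf e'$, or $\mathsf e=\mathsf e'$ and $\gamma\notin\iota_{\mathsf e}(\Gamma_{|\mathsf e|})$, the triple of properly convex open sets $$\big(g_{\mathsf e}\cdot\Omega_{\mathsf t(\mathsf e)},\ \Omega_{\mathsf v},\ \rho_{\mathsf v}(\gamma)g_{\mathsf e'}\cdot\Omega_{\mathsf t(\mathsf e')}\big)$$ is in occultation position. Then $\rho:\pi_1(\boldsymbol{\Gamma},\mathsf Y,\mathsf v_0)\to\mathrm{PGL}(d,\mathbb{R})$ is discrete and faithful. Moreover, for each oriented edge $\mathsf e\in\vec{\mathsf E}$, the set $\Omega_{\mathsf e}:=\langle\!\langle\Omega_{\mathsf o(\mathsf e)}\cup g_{\mathsf e}\cdot\Omega_{\mathsf t(\mathsf e)}\rangle\!\rangle$ is well defined and properly convex, and the $\rho(\pi_1(\boldsymbol{\Gamma},\mathsf Y,\mathsf v_0))$-invariant open set $$\Omega:=\bigcup_{[\mathsf c,\mu],\ \mathsf e}\underline{\rho}([\mathsf c,\mu])\cdot\Omega_{\mathsf e},$$ where the union ranges over all paths $[\mathsf c,\mu]$ in $F(\boldsymbol{\Gamma},\mathsf Y)$ starting at $\mathsf v_0$ (that is, over all representatives of the vertices $[\mathsf c,\mu]\,\Gamma_{\mathsf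 v}$ of the universal covering tree) and all $\mathsf e\in\vec{\mathsf E}$ whose origin $\mathsf o(\mathsf e)$ is the endpoint $\mathsf v$ of $[\mathsf c,\mu]$, is properly convex.
   Context: Graphs of groups. For a graph $\mathsf Y=(\mathsf V,\mathsf E)$, $\vec{\mathsf E}$ is the set of edges with a choice of orientation; for $\mathsf e\in\vec{\mathsf E}$, $\overline{\mathsf e}$ is the same edge with opposite orientation, $|\mathsf e|\in\mathsf E$ the unoriented edge, $\mathsf o(\mathsf e)$ and $\mathsf t(\mathsf e)$ its initial and terminal vertices. A graph of groups $(\boldsymbol{\Gamma},\mathsf Y)$ is a connected graph $\mathsf Y$ with a group $\Gamma_{\mathsf v}$ for each vertex $\mathsf v$, a group $\Gamma_{|\mathsf e|}$ for each unoriented edge, and an injective homomorphism $\iota_{\mathsf e}:\Gamma_{|\mathsf e|}\hookrightarrow\Gamma_{\mathsf o(\mathsf e)}$ for each $\mathsf e\in\vec{\mathsf E}$; write $\gamma^{\mathsf e}:=\iota_{\mathsf e}(\gamma)$. The group $F(\boldsymbol{\Gamma},\mathsf Y)$ is freely generated by the vertex groups $\Gamma_{\mathsf v}$ and the oriented edges $\vec{\mathsf E}$, modulo the relations $\mathsf e=\overline{\mathsf e}^{\,-1}$ for all $\mathsf e\in\vec{\mathsf E}$, and $\gamma^{\mathsf e}=\mathsf e\,\gamma^{\overline{\mathsf e}}\,\mathsf e^{-1}$ for all $\mathsf e\in\vec{\mathsf E}$, $\gamma\in\Gamma_{|\mathsf e|}$; each $\Gamma_{\mathsf v}$ injects into it.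 Given a path $\mathsf c=(\mathsf e_1,\dots,\mathsf e_n)$ in $\mathsf Y$ with successive vertices $\mathsf v_0,\dots,\mathsf v_n$ ($\mathsf v_0=\mathsf o(\mathsf e_1)$, $\mathsf v_i=\mathsf t(\mathsf e_i)$; $n=0$ allowed) and $\mu=(r_0,\dots,r_n)$ with $r_i\in\Gamma_{\mathsf v_i}$, the element $[\mathsf c,\mu]:=r_0\mathsf e_1r_1\mathsf e_2\cdots\mathsf e_nr_n\in F(\boldsymbol{\Gamma},\mathsf Y)$ is called a path in $F(\boldsymbol{\Gamma},\mathsf Y)$ starting at $\mathsf v_0$ and ending at $\mathsf v_n$. The fundamental group $\pi_1(\boldsymbol{\Gamma},\mathsf Y,\mathsf v_0)$ is the subgroup of $F(\boldsymbol{\Gamma},\mathsf Y)$ consisting of the paths that start and end at $\mathsf v_0$. The vertices of the universal covering tree of $(\boldsymbol{\Gamma},\mathsf Y)$ based at $\mathsf v_0$ are the cosets $[\mathsf c,\mu]\,\Gamma_{\mathsf v}$ in $F(\boldsymbol{\Gamma},\mathsf Y)$, where $\mathsf v\in\mathsf V$ and $[\mathsf c,\mu]$ is a path starting at $\mathsf v_0$ and ending at $\mathsf v$. Convexity. An open subset of $\mathbb{P}(\mathbb{R}^d)$ is properly convex if it is contained, convex and bounded in some affine chart. For a connected subset $X$ of $\mathbb{P}(\mathbb{R}^d)$ contained in an affine chart, $\langle\!\langle X\rangle\!\rangle$ is its convex hull in that chart (independent of the choice of affine chart containing $X$). For a properly convex open set $\Omega$, its dual is $\Omega^*:=\{H\in\mathbb{P}((\mathbb{R}^d)^*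 ): H\cap\overline{\Omega}=\varnothing\}$, where elements of the dual projective space are viewed as projective hyperplanes. A triple $(A,B,C)$ of properly convex open sets is in occultation position if: $A\not\subset B$ and $C\not\subset B$; $A\cap B\neq\varnothing$, $B\cap C\neq\varnothing$, but $A\cap C=\varnothing$; and $\overline{B^*}\subset A^*\cup C^*$. A representation is discrete and faithful if it is injective with discrete image.
   Formalization: The "Moreover" part is asserted only when the occultation hypothesis concerns at least one triple, which excludes just the case where Y is a single edge with two distinct endpoints and both edge maps are onto; there the part can fail, as Ω_o(e) and g_e·Ω_t(e) may be disjoint. *)

theory Defs
  imports
    "HOL-Algebra.Coset"
    "Graph_Theory.Arc_Walk"
    "Graph_Theory.Digraph_Component"
    "Graph_Theory.Bidirected_Digraph"
    "HOL-Analysis.Analysis"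
begin

section \<open>Graphs of groups\<close>

text \<open>
  Graphs may be infinite and may have loops and multiple edges. The arcs of the digraph
  \<open>base G\<close> are the oriented edges, \<open>tail\<close> and \<open>head\<close> their initial and terminal vertices, and
  \<open>erev G\<close> is the fixed-point free involution reversing the orientation.
  The unoriented edge underlying \<open>e\<close> is the set \<open>{e, erev G e}\<close>.
\<close>

record ('v, 'e, 'g, 'h) gog =
  base :: "('v, 'e) pre_digraph"
  erev :: "'e \<Rightarrow> 'e"
  vgrp :: "'v \<Rightarrow> 'g monoid"
  egrp :: "'e set \<Rightarrow> 'h monoid"
  emb  :: "'e \<Rightarrow> 'h \<Rightarrow> 'g"

definition uedge :: "('v, 'e, 'g, 'h) gog \<Rightarrow> 'e \<Rightarrow> 'e set" where
  "uedge G e = {e, erev G e}"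

locale graph_of_groups = bidirected_digraph "base G" "erev G"
  for G :: "('v, 'e, 'g, 'h) gog" +
  assumes connected_base: "Digraph_Component.connected (base G)"
    and vgrp_group: "v \<in> verts (base G) \<Longrightarrow> group (vgrp G v)"
    and egrp_group: "e \<in> arcs (base G) \<Longrightarrow> group (egrp G (uedge G e))"
    and emb_hom: "e \<in> arcs (base G) \<Longrightarrow>
          emb G e \<in> hom (egrp G (uedge G e)) (vgrp G (tail (base G) e))"
    and emb_inj: "e \<in> arcs (base G) \<Longrightarrow> inj_on (emb G e) (carrier (egrp G (uedge G e)))"

hide_const (open) Digraph_Component.connected

subsection \<open>The group \<open>F(\<Gamma>,Y)\<close>\<close>

text \<open>
  \<open>F(\<Gamma>,Y)\<close> is presented as a quotient of the monoid of words whose letters are the elements of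
  the vertex groups, the oriented edges and formal inverses of the oriented edges, by the
  congruence generated by the multiplication tables of the vertex groups, the free reductions of
  the edge letters, and the relations \<open>e = (erev e)\<inverse>\<close> and \<open>\<gamma>\<^sup>e = e \<gamma>\<^sup>e\<^sup>' e\<inverse>\<close> with \<open>e' = erev e\<close>.
\<close>

datatype ('v, 'e, 'g) letter = Vtx 'v 'g | Edg 'e | EdgInv 'e

definition letters :: "('v, 'e, 'g, 'h) gog \<Rightarrow> ('v, 'e, 'g) letter set" where
  "letters G = {Vtx v x | v x. v \<in> verts (base G) \<and> x \<in> carrier (vgrp G v)}
     \<union> Edg ` arcs (base G) \<union> EdgInv ` arcs (base G)"

definition gwords :: "('v, 'e, 'g, 'h) gog \<Rightarrow> ('v, 'e, 'g) letter list set" where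
  "gwords G = lists (letters G)"

inductive F_relator ::
  "('v, 'e, 'g, 'h) gog \<Rightarrow> ('v, 'e, 'g) letter list \<Rightarrow> ('v, 'e, 'g) letter list \<Rightarrow> bool"
  for G where
    vone: "v \<in> verts (base G) \<Longrightarrow> F_relator G [Vtx v \<one>\<^bsub>vgrp G v\<^esub>] []"
  | vmult: "\<lbrakk>v \<in> verts (base G); x \<in> carrier (vgrp G v); y \<in> carrier (vgrp G v)\<rbrakk> \<Longrightarrow>
       F_relator G [Vtx v x, Vtx v y] [Vtx v (x \<otimes>\<^bsub>vgrp G v\<^esub> y)]"
  | einv_right: "e \<in> arcs (base G) \<Longrightarrow> F_relator G [Edg e, EdgInv e] []"
  | einv_left: "e \<in> arcs (base G) \<Longrightarrow> F_relator G [EdgInv e, Edg e] []"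
  | erev: "e \<in> arcs (base G) \<Longrightarrow> F_relator G [Edg e] [EdgInv (erev G e)]"
  | econj: "\<lbrakk>e \<in> arcs (base G); \<gamma> \<in> carrier (egrp G (uedge G e))\<rbrakk> \<Longrightarrow>
       F_relator G [Vtx (tail (base G) e) (emb G e \<gamma>)]
         [Edg e, Vtx (head (base G) e) (emb G (erev G e) \<gamma>), EdgInv e]"

inductive F_step ::
  "('v, 'e, 'g, 'h) gog \<Rightarrow> ('v, 'e, 'g) letter list \<Rightarrow> ('v, 'e, 'g) letter list \<Rightarrow> bool"
  for G where
    "\<lbrakk>F_relator G l r; p \<in> gwords G; q \<in> gwords G\<rbrakk> \<Longrightarrow> F_step G (p @ l @ q) (p @ r @ q)"

definition F_cong ::
  "('v, 'e, 'g, 'h) gog \<Rightarrow> (('v, 'e, 'g) letter list \<times> ('v, 'e, 'g) letter list) set" where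
  "F_cong G = {(u, w). u \<in> gwords G \<and> w \<in> gwords G \<and> equivclp (F_step G) u w}"

definition F_class ::
  "('v, 'e, 'g, 'h) gog \<Rightarrow> ('v, 'e, 'g) letter list \<Rightarrow> ('v, 'e, 'g) letter list set" where
  "F_class G w = F_cong G `` {w}"

definition F_group :: "('v, 'e, 'g, 'h) gog \<Rightarrow> ('v, 'e, 'g) letter list set monoid" where
  "F_group G = \<lparr>carrier = gwords G // F_cong G,
     monoid.mult = (\<lambda>X Y. \<Union>x\<in>X. \<Union>y\<in>Y. F_class G (x @ y)),
     one = F_class G []\<rparr>"

context graph_of_groups begin

lemma F_relator_gwords: "F_relator G l r \<Longrightarrow> l \<in> gwords G \<and> r \<in> gwords G"
proof (induction rule: F_relator.induct)
  case (vone v) then show ?case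
    using vgrp_group[of v] by (auto simp: gwords_def letters_def group.is_monoid monoid.one_closed)
next
  case (vmult v x y) then show ?case
    using vgrp_group[of v] by (auto simp: gwords_def letters_def group.is_monoid monoid.m_closed)
next
  case (econj e \<gamma>)
  have "uedge G (erev G e) = uedge G e" by (auto simp: uedge_def)
  moreover have "emb G e \<gamma> \<in> carrier (vgrp G (tail (base G) e))"
    using emb_hom[of e] econj by (auto simp: hom_def)
  moreover have "emb G (erev G e) \<gamma> \<in> carrier (vgrp G (tail (base G) (erev G e)))"
    using emb_hom[of "erev G e"] econj calculation(1) by (auto simp: hom_def)
  ultimately show ?case using econj by (auto simp: gwords_def letters_def)
qed (auto simp: gwords_def letters_def)

lemma F_step_gwords: "F_step G u w \<Longrightarrow> u \<in> gwords G \<and> w \<in> gwords G"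
  by (erule F_step.cases) (use F_relator_gwords in \<open>auto simp: gwords_def\<close>)

lemma equiv_F_cong: "equiv (gwords G) (F_cong G)"
  by (rule equivI)
     (auto simp: F_cong_def refl_on_def sym_def trans_def equivclp_sym intro: equivclp_trans)

lemma F_step_append:
  assumes "F_step G u w" "p \<in> gwords G" "q \<in> gwords G"
  shows "F_step G (p @ u @ q) (p @ w @ q)"
  using assms(1)
proof cases
  case (1 l r p' q')
  then have "F_step G ((p @ p') @ l @ (q' @ q)) ((p @ p') @ r @ (q' @ q))"
    using assms by (intro F_step.intros) (auto simp: gwords_def)
  then show ?thesis using 1 by simp
qed

lemma F_equiv_append:
  assumes "equivclp (F_step G) u w" "p \<in> gwords G" "q \<in> gwords G"
  shows "equivclp (F_step G) (p @ u @ q) (p @ w @ q)"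
  using assms(1)
proof (induction rule: equivclp_induct)
  case base then show ?case by simp
next
  case (step y z)
  then show ?case using F_step_append[OF _ assms(2,3)]
    by (meson equivclp_into_equivclp r_into_equivclp equivclp_trans equivclp_sym)
qed

lemma F_cong_append:
  assumes "(u, u') \<in> F_cong G" "(w, w') \<in> F_cong G"
  shows "(u @ w, u' @ w') \<in> F_cong G"
proof -
  have w: "u \<in> gwords G" "u' \<in> gwords G" "w \<in> gwords G" "w' \<in> gwords G"
    using assms by (auto simp: F_cong_def)
  then have "equivclp (F_step G) (u @ w) (u' @ w)" "equivclp (F_step G) (u' @ w) (u' @ w')"
    using F_equiv_append[of u u' "[]" w] F_equiv_append[of w w' u' "[]"] assms
    by (auto simp: F_cong_def gwords_def)
  then show ?thesis using w by (auto simp: F_cong_def gwords_def intro: equivclp_trans)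
qed

lemma F_mult_class:
  assumes "u \<in> gwords G" "w \<in> gwords G"
  shows "F_class G u \<otimes>\<^bsub>F_group G\<^esub> F_class G w = F_class G (u @ w)"
proof -
  have eq: "F_class G (x @ y) = F_class G (u @ w)" if "x \<in> F_class G u" "y \<in> F_class G w" for x y
  proof -
    have "(u, x) \<in> F_cong G" "(w, y) \<in> F_cong G" using that unfolding F_class_def by blast+
    from equiv_class_eq[OF equiv_F_cong F_cong_append[OF this]] show ?thesis
      unfolding F_class_def by (rule sym)
  qed
  have mem: "u \<in> F_class G u" "w \<in> F_class G w"
    unfolding F_class_def by (rule equiv_class_self[OF equiv_F_cong] assms)+
  have "F_class G u \<otimes>\<^bsub>F_group G\<^esub> F_class G w =
      (\<Union>x\<in>F_class G u. \<Union>y\<in>F_class G w. F_class G (x @ y))"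
    unfolding F_group_def by (simp only: monoid.simps partial_object.simps)
  also have "\<dots> = (\<Union>x\<in>F_class G u. \<Union>y\<in>F_class G w. F_class G (u @ w))"
    by (intro SUP_cong refl eq)
  also have "\<dots> = F_class G (u @ w)"
    using mem by blast
  finally show ?thesis .
qed

lemma carrier_F: "carrier (F_group G) = F_class G ` gwords G"
  by (auto simp: F_group_def quotient_def F_class_def)

lemma letter_inverse:
  assumes "l \<in> letters G" shows "\<exists>l'\<in>letters G. F_class G [l', l] = F_class G []"
proof -
  have *: "F_class G u = F_class G w" if "F_step G u w" for u w
    using that F_step_gwords[OF that] equiv_class_eq[OF equiv_F_cong, of u w]
    by (auto simp: F_class_def F_cong_def)
  have **: "F_class G u = F_class G w" if "F_relator G u w" for u w
    using *[OF F_step.intros[OF that, of "[]" "[]"]] by (simp add: gwords_def)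
  show ?thesis
  proof (cases l)
    case (Vtx v x)
    then have v: "v \<in> verts (base G)" "x \<in> carrier (vgrp G v)" using assms by (auto simp: letters_def)
    interpret g: group "vgrp G v" using vgrp_group v by simp
    have "F_class G [Vtx v (inv\<^bsub>vgrp G v\<^esub> x), Vtx v x] = F_class G [Vtx v \<one>\<^bsub>vgrp G v\<^esub>]"
      using **[OF F_relator.vmult[of v G "inv\<^bsub>vgrp G v\<^esub> x" x]] v by simp
    also have "\<dots> = F_class G []" using ** F_relator.vone v by metis
    finally show ?thesis using Vtx v
      by (intro bexI[of _ "Vtx v (inv\<^bsub>vgrp G v\<^esub> x)"]) (auto simp: letters_def)
  next
    case (Edg e)
    then show ?thesis using assms ** F_relator.einv_left[of e G]
      by (intro bexI[of _ "EdgInv e"]) (auto simp: letters_def)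
  next
    case (EdgInv e)
    then show ?thesis using assms ** F_relator.einv_right[of e G]
      by (intro bexI[of _ "Edg e"]) (auto simp: letters_def)
  qed
qed

lemma group_F: "group (F_group G)"
proof (rule groupI)
  show one: "\<one>\<^bsub>F_group G\<^esub> \<in> carrier (F_group G)"
    unfolding carrier_F by (auto simp: F_group_def gwords_def)
  have one': "\<one>\<^bsub>F_group G\<^esub> = F_class G []" by (simp add: F_group_def)
  have nil: "[] \<in> gwords G" by (simp add: gwords_def)
  have app: "u @ w \<in> gwords G" if "u \<in> gwords G" "w \<in> gwords G" for u w
    using that by (simp add: gwords_def)
  fix x assume x: "x \<in> carrier (F_group G)"
  show "\<one>\<^bsub>F_group G\<^esub> \<otimes>\<^bsub>F_group G\<^esub> x = x"
    using x nil by (auto simp: carrier_F one' F_mult_class)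
  show "\<exists>y\<in>carrier (F_group G). y \<otimes>\<^bsub>F_group G\<^esub> x = \<one>\<^bsub>F_group G\<^esub>"
  proof -
    obtain w where w: "w \<in> gwords G" "x = F_class G w" using x by (auto simp: carrier_F)
    have "\<exists>u\<in>gwords G. F_class G (u @ w) = F_class G []" using w(1)
    proof (induction w)
      case Nil then show ?case using nil by force
    next
      case (Cons l w)
      then have l: "l \<in> letters G" "w \<in> gwords G" by (auto simp: gwords_def)
      obtain u where u: "u \<in> gwords G" "F_class G (u @ w) = F_class G []" using Cons l by blast
      obtain l' where l': "l' \<in> letters G" "F_class G [l', l] = F_class G []"
        using letter_inverse l by blast
      have lw: "[l', l] \<in> gwords G" "[l'] \<in> gwords G" using l l' by (auto simp: gwords_def)
      have "F_class G ((u @ [l']) @ l # w) = F_class G (u @ [l',l] @ w)" by simp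
      also have "\<dots> = F_class G u \<otimes>\<^bsub>F_group G\<^esub> F_class G ([l', l] @ w)"
        using F_mult_class u lw l app by metis
      also have "F_class G ([l', l] @ w) = F_class G [] \<otimes>\<^bsub>F_group G\<^esub> F_class G w"
        using F_mult_class lw l l' by metis
      also have "\<dots> = F_class G w" using F_mult_class nil l by simp
      also have "F_class G u \<otimes>\<^bsub>F_group G\<^esub> F_class G w = F_class G []" using F_mult_class u l by simp
      finally show ?case using app u lw by blast
    qed
    then show ?thesis using w by (auto simp: carrier_F one' F_mult_class)
  qed
  fix y assume y: "y \<in> carrier (F_group G)"
  show "x \<otimes>\<^bsub>F_group G\<^esub> y \<in> carrier (F_group G)"
    using x y app by (auto simp: carrier_F F_mult_class)
  fix z assume z: "z \<in> carrier (F_group G)"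
  show "x \<otimes>\<^bsub>F_group G\<^esub> y \<otimes>\<^bsub>F_group G\<^esub> z = x \<otimes>\<^bsub>F_group G\<^esub> (y \<otimes>\<^bsub>F_group G\<^esub> z)"
    using x y z app by (auto simp: carrier_F F_mult_class)
qed

lemma associated_rep_exists:
  assumes H: "group H"
    and \<rho>: "\<And>v. v \<in> verts (base G) \<Longrightarrow> \<rho> v \<in> hom (vgrp G v) H"
    and g: "\<And>e. e \<in> arcs (base G) \<Longrightarrow> g e \<in> carrier H"
    and inv: "\<And>e. e \<in> arcs (base G) \<Longrightarrow> g e = inv\<^bsub>H\<^esub> (g (erev G e))"
    and conj: "\<And>e \<gamma>. e \<in> arcs (base G) \<Longrightarrow> \<gamma> \<in> carrier (egrp G (uedge G e)) \<Longrightarrow>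
           \<rho> (tail (base G) e) (emb G e \<gamma>) =
             g e \<otimes>\<^bsub>H\<^esub> \<rho> (head (base G) e) (emb G (erev G e) \<gamma>) \<otimes>\<^bsub>H\<^esub> inv\<^bsub>H\<^esub> (g e)"
  shows "\<exists>R\<in>hom (F_group G) H.
     (\<forall>v\<in>verts (base G). \<forall>x\<in>carrier (vgrp G v). R (F_class G [Vtx v x]) = \<rho> v x) \<and>
     (\<forall>e\<in>arcs (base G). R (F_class G [Edg e]) = g e)"
proof -
  interpret H: group H by (rule H)
  have hc: "\<rho> v x \<in> carrier H" if "v \<in> verts (base G)" "x \<in> carrier (vgrp G v)" for v x
    using hom_in_carrier[OF \<rho>] that by blast
  define val where "val l = (case l of Vtx v x \<Rightarrow> \<rho> v x | Edg e \<Rightarrow> g e | EdgInv e \<Rightarrow> inv\<^bsub>H\<^esub> (g e))" for l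
  define ev where "ev w = foldr (\<lambda>l a. val l \<otimes>\<^bsub>H\<^esub> a) w \<one>\<^bsub>H\<^esub>" for w
  have val: "val l \<in> carrier H" if "l \<in> letters G" for l
    using that hc g by (auto simp: val_def letters_def)
  have ev: "ev w \<in> carrier H" if "w \<in> gwords G" for w
    using that unfolding ev_def gwords_def by (induction w) (auto simp: val)
  have ev_app: "ev (u @ w) = ev u \<otimes>\<^bsub>H\<^esub> ev w" if "u \<in> gwords G" "w \<in> gwords G" for u w
    using that(1)
  proof (induction u)
    case Nil then show ?case using ev[OF that(2)] by (simp add: ev_def)
  next
    case (Cons l u)
    then have "l \<in> letters G" "u \<in> gwords G" by (auto simp: gwords_def)
    then show ?case using Cons val ev that by (auto simp: ev_def H.m_assoc)
  qed
  have rel: "ev l = ev r" if "F_relator G l r" for l r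
    using that
  proof (induction rule: F_relator.induct)
    case (vone v)
    then show ?case using hom_one[OF \<rho> vgrp_group H] by (simp add: ev_def val_def)
  next
    case (vmult v x y)
    then show ?case using hom_mult[OF \<rho>[of v]] hc by (simp add: ev_def val_def)
  next
    case (erev e)
    then show ?case using inv[of e] by (simp add: ev_def val_def)
  next
    case (econj e \<gamma>)
    have "uedge G (erev G e) = uedge G e" by (auto simp: uedge_def)
    moreover have "emb G e \<gamma> \<in> carrier (vgrp G (tail (base G) e))"
      using emb_hom[of e] econj by (auto simp: hom_def)
    moreover have "emb G (erev G e) \<gamma> \<in> carrier (vgrp G (head (base G) e))"
      using emb_hom[of "erev G e"] econj calculation(1) by (auto simp: hom_def)
    ultimately have "\<rho> (head (base G) e) (emb G (erev G e) \<gamma>) \<in> carrier H"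
      "\<rho> (tail (base G) e) (emb G e \<gamma>) \<in> carrier H"
      using \<rho>[of "head (base G) e"] \<rho>[of "tail (base G) e"] econj by (auto simp: hom_def)
    then show ?case using conj[OF econj] g econj(1) by (simp add: ev_def val_def H.m_assoc)
  qed (use g in \<open>auto simp: ev_def val_def\<close>)
  have step: "ev u = ev w" if "F_step G u w" for u w
    using that
  proof cases
    case (1 l r p q)
    then show ?thesis using rel F_relator_gwords[OF 1(3)] by (simp add: ev_app gwords_def)
  qed
  have eqv: "ev u = ev w" if "equivclp (F_step G) u w" for u w
    using that by (induction rule: equivclp_induct) (auto dest: step)
  have app: "u @ w \<in> gwords G" if "u \<in> gwords G" "w \<in> gwords G" for u w
    using that by (simp add: gwords_def)
  define R where "R X = ev (SOME w. w \<in> X)" for X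
  have R: "R (F_class G w) = ev w" if "w \<in> gwords G" for w
  proof -
    have "w \<in> F_class G w" using that equiv_class_self[OF equiv_F_cong] by (auto simp: F_class_def)
    then have "(SOME u. u \<in> F_class G w) \<in> F_class G w" by (rule someI)
    then show ?thesis using eqv by (auto simp: R_def F_class_def F_cong_def)
  qed
  show ?thesis
  proof (intro bexI[of _ R] conjI ballI)
    fix v x assume "v \<in> verts (base G)" "x \<in> carrier (vgrp G v)"
    then show "R (F_class G [Vtx v x]) = \<rho> v x"
      using hc by (subst R) (auto simp: gwords_def letters_def ev_def val_def)
  next
    fix e assume "e \<in> arcs (base G)"
    then show "R (F_class G [Edg e]) = g e"
      using g by (subst R) (auto simp: gwords_def letters_def ev_def val_def)
  next
    show "R \<in> hom (F_group G) H"
      unfolding hom_def carrier_F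
      using R ev ev_app app by (auto simp: F_mult_class)
  qed
qed

end

subsection \<open>Paths and the fundamental group\<close>

text \<open>\<open>path_word G v\<^sub>0 [e\<^sub>1,\<dots>,e\<^sub>n] [r\<^sub>0,\<dots>,r\<^sub>n]\<close> is the word \<open>r\<^sub>0 e\<^sub>1 r\<^sub>1 \<dots> e\<^sub>n r\<^sub>n\<close>.\<close>

fun path_word ::
  "('v, 'e, 'g, 'h) gog \<Rightarrow> 'v \<Rightarrow> 'e list \<Rightarrow> 'g list \<Rightarrow> ('v, 'e, 'g) letter list" where
  "path_word G v (e # c) (r # \<mu>) = Vtx v r # Edg e # path_word G (head (base G) e) c \<mu>"
| "path_word G v [] (r # \<mu>) = [Vtx v r]"
| "path_word G v c [] = []"

definition F_paths :: "('v, 'e, 'g, 'h) gog \<Rightarrow> 'v \<Rightarrow> 'v \<Rightarrow> ('v, 'e, 'g) letter list set set" where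
  "F_paths G u v = {F_class G (path_word G u c \<mu>) | c \<mu>.
     pre_digraph.awalk (base G) u c v \<and>
     list_all2 (\<lambda>r w. r \<in> carrier (vgrp G w)) \<mu> (pre_digraph.awalk_verts (base G) u c)}"

definition pi1 :: "('v, 'e, 'g, 'h) gog \<Rightarrow> 'v \<Rightarrow> ('v, 'e, 'g) letter list set monoid" where
  "pi1 G v = (F_group G)\<lparr>carrier := F_paths G v v\<rparr>"

section \<open>Projective space and \<open>PGL(d,\<real>)\<close>\<close>

typedef (overloaded) 'a proj = "{L :: 'a::euclidean_space set. subspace L \<and> dim L = 1}"
  morphisms line_of Proj
proof -
  obtain b :: 'a where "b \<in> Basis"
    using nonempty_Basis by blast
  then have "dim (span {b}) = 1"
    by (simp add: dim_singleton nonzero_Basis)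
  then show ?thesis
    using subspace_span by blast
qed

definition proj_pt :: "'a::euclidean_space \<Rightarrow> 'a proj" where
  "proj_pt x = Proj (span {x})"

text \<open>The quotient topology from \<open>V - {0}\<close>.\<close>

instantiation proj :: (euclidean_space) topological_space
begin

definition open_proj :: "'a proj set \<Rightarrow> bool" where
  "open_proj U \<longleftrightarrow> openin (top_of_set (- {0})) {x. x \<noteq> 0 \<and> proj_pt x \<in> U}"

instance
proof
  show "open (UNIV :: 'a proj set)"
    by (simp add: open_proj_def Compl_eq)
next
  fix S T :: "'a proj set"
  assume "open S" "open T"
  moreover have "{x::'a. x \<noteq> 0 \<and> proj_pt x \<in> S \<inter> T} =
      {x. x \<noteq> 0 \<and> proj_pt x \<in> S} \<inter> {x. x \<noteq> 0 \<and> proj_pt x \<in> T}" by auto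
  ultimately show "open (S \<inter> T)"
    by (simp only: open_proj_def openin_Int)
next
  fix K :: "'a proj set set"
  assume K: "\<forall>S\<in>K. open S"
  have "{x::'a. x \<noteq> 0 \<and> proj_pt x \<in> \<Union>K} =
      (\<Union>S\<in>K. {x. x \<noteq> 0 \<and> proj_pt x \<in> S})" by auto
  then show "open (\<Union>K)"
    using K by (simp only: open_proj_def) (blast intro: openin_Union)
qed

end

lemma line_of_proj_pt: "x \<noteq> 0 \<Longrightarrow> line_of (proj_pt x) = span {x}"
  unfolding proj_pt_def by (subst Proj_inverse) (auto simp: dim_singleton)

lemma proj_cases: obtains x where "x \<noteq> 0" "p = proj_pt x"
proof -
  have "subspace (line_of p)" "dim (line_of p) = 1" using line_of[of p] by auto
  then obtain x where x: "x \<in> line_of p" "x \<noteq> 0"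
    by (metis dim_eq_0 insertI1 one_neq_zero subsetI singletonD subset_singletonD)
  have "span {x} = line_of p"
    using x \<open>dim (line_of p) = 1\<close> \<open>subspace (line_of p)\<close>
    by (intro subspace_dim_equal) (auto simp: dim_singleton span_minimal)
  then show ?thesis using x that by (metis line_of_inverse proj_pt_def)
qed

definition GL :: "(real^'n^'n) monoid" where
  "GL = \<lparr>carrier = {A. invertible A}, monoid.mult = (**), one = mat 1\<rparr>"

definition scalar_matrices :: "(real^'n^'n) set" where
  "scalar_matrices = {c *\<^sub>R mat 1 | c. c \<noteq> 0}"

definition PGL :: "(real^'n^'n) set monoid" where
  "PGL = GL Mod scalar_matrices"

text \<open>
  The quotient topology from \<open>GL\<close>: an element of \<open>PGL\<close> is a coset, so the preimage in \<open>GL\<close>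
  of a set \<open>U\<close> of cosets is \<open>\<Union>U\<close>.
\<close>

definition PGL_topology :: "(real^'n^'n) set topology" where
  "PGL_topology =
     topology (\<lambda>U. U \<subseteq> carrier PGL \<and> openin (top_of_set (carrier GL)) (\<Union>U))"

definition pgl_act :: "(real^'n^'n) set \<Rightarrow> (real^'n) proj \<Rightarrow> (real^'n) proj" where
  "pgl_act a p = Proj (\<Union>A\<in>a. (*v) A ` line_of p)"

lemma carrier_GL: "carrier GL = {A. invertible A}"
  and mult_GL: "A \<otimes>\<^bsub>GL\<^esub> B = A ** B"
  and one_GL: "\<one>\<^bsub>GL\<^esub> = mat 1"
  by (simp_all add: GL_def)

context
  notes carrier_GL [simp] mult_GL [simp] one_GL [simp]
begin

lemma group_GL: "group GL"
proof (rule groupI)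
  fix A :: "real^'n^'n" assume "A \<in> carrier GL"
  then obtain B where "A ** B = mat 1" "B ** A = mat 1" by (auto simp: invertible_def)
  then show "\<exists>B\<in>carrier GL. B \<otimes>\<^bsub>GL\<^esub> A = \<one>\<^bsub>GL\<^esub>"
    by (auto simp: invertible_def)
next
  show "\<one>\<^bsub>GL\<^esub> \<in> carrier GL" by (auto simp: invertible_def intro: exI[of _ "mat 1"])
qed (auto simp: invertible_mult matrix_mul_assoc)

lemma scalar_mult:
  "(c *\<^sub>R mat 1) ** A = c *\<^sub>R (A :: real^'n^'n)" "A ** (c *\<^sub>R mat 1) = c *\<^sub>R A"
  by (simp_all add: matrix_matrix_mult_def mat_def vec_eq_iff if_distrib if_distribR sum.delta
      cong: if_cong)

lemma normal_scalar_matrices: "scalar_matrices \<lhd> GL"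
proof -
  interpret group GL by (rule group_GL)
  have inv: "invertible (c *\<^sub>R mat 1 :: real^'n^'n)" if "c \<noteq> 0" for c
    unfolding invertible_def
    by (rule exI[of _ "inverse c *\<^sub>R mat 1"]) (use that in \<open>simp add: scalar_mult\<close>)
  have "subgroup (scalar_matrices :: (real^'n^'n) set) GL"
  proof (rule subgroupI)
    fix A :: "real^'n^'n" assume "A \<in> scalar_matrices"
    then obtain c where c: "c \<noteq> 0" "A = c *\<^sub>R mat 1" by (auto simp: scalar_matrices_def)
    have "inv\<^bsub>GL\<^esub> A = inverse c *\<^sub>R mat 1"
      by (rule inv_equality) (use c inv[of c] inv[of "inverse c"] in \<open>simp_all add: scalar_mult\<close>)
    then show "inv\<^bsub>GL\<^esub> A \<in> scalar_matrices" using c by (auto simp: scalar_matrices_def)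
  next
    fix A B :: "real^'n^'n" assume "A \<in> scalar_matrices" "B \<in> scalar_matrices"
    then show "A \<otimes>\<^bsub>GL\<^esub> B \<in> scalar_matrices"
      by (auto simp: scalar_matrices_def scalar_mult)
  qed (use inv in \<open>auto simp: scalar_matrices_def intro: exI[of _ 1]\<close>)
  moreover have "\<forall>A\<in>carrier GL. \<forall>h\<in>scalar_matrices. A \<otimes>\<^bsub>GL\<^esub> h \<otimes>\<^bsub>GL\<^esub> inv\<^bsub>GL\<^esub> A \<in> (scalar_matrices :: (real^'n^'n) set)"
  proof (intro ballI)
    fix A h :: "real^'n^'n" assume A: "A \<in> carrier GL" and h: "h \<in> scalar_matrices"
    then obtain c where c: "c \<noteq> 0" "h = c *\<^sub>R mat 1" by (auto simp: scalar_matrices_def)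
    have "A \<otimes>\<^bsub>GL\<^esub> h = h \<otimes>\<^bsub>GL\<^esub> A" by (simp add: c scalar_mult)
    then have "A \<otimes>\<^bsub>GL\<^esub> h \<otimes>\<^bsub>GL\<^esub> inv\<^bsub>GL\<^esub> A = h"
      using A c inv[of c] by (metis carrier_GL inv_solve_right' m_closed mem_Collect_eq)
    then show "A \<otimes>\<^bsub>GL\<^esub> h \<otimes>\<^bsub>GL\<^esub> inv\<^bsub>GL\<^esub> A \<in> scalar_matrices" using h by simp
  qed
  ultimately show ?thesis by (simp add: normal_inv_iff)
qed

end

lemma group_PGL: "group PGL"
  unfolding PGL_def by (rule normal.factorgroup_is_group[OF normal_scalar_matrices])

lemma carrier_PGL: "carrier PGL = rcosets\<^bsub>GL\<^esub> scalar_matrices"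
  by (simp add: PGL_def FactGroup_def)

lemma rcoset_scalar: "scalar_matrices #>\<^bsub>GL\<^esub> A = {c *\<^sub>R A | c. c \<noteq> 0}"
  by (auto simp: r_coset_def scalar_matrices_def scalar_mult mult_GL)

lemma openin_PGL_topology:
  fixes U :: "(real^'n^'n) set set"
  shows "openin PGL_topology U \<longleftrightarrow> U \<subseteq> carrier PGL \<and> openin (top_of_set (carrier GL)) (\<Union>U)"
proof -
  interpret normal "scalar_matrices :: (real^'n^'n) set" GL by (rule normal_scalar_matrices)
  let ?P = "\<lambda>U :: (real^'n^'n) set set.
      U \<subseteq> carrier PGL \<and> openin (top_of_set (carrier GL)) (\<Union>U)"
  have "?P (S \<inter> T)" if "?P S" "?P T" for S T
  proof -
    have disj: "a = b" if "a \<in> S" "b \<in> T" "A \<in> a" "A \<in> b" for a b A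
    proof -
      have "a \<in> rcosets\<^bsub>GL\<^esub> scalar_matrices" "b \<in> rcosets\<^bsub>GL\<^esub> scalar_matrices"
        using \<open>?P S\<close> \<open>?P T\<close> that carrier_PGL by blast+
      then show ?thesis
        using pairwiseD[OF rcos_disjoint[OF is_subgroup], of a b] that by (auto simp: disjnt_def)
    qed
    have "\<Union>(S \<inter> T) = \<Union>S \<inter> \<Union>T"
    proof
      show "\<Union>S \<inter> \<Union>T \<subseteq> \<Union>(S \<inter> T)"
      proof
        fix A assume "A \<in> \<Union>S \<inter> \<Union>T"
        then obtain a b where "a \<in> S" "b \<in> T" "A \<in> a" "A \<in> b" by blast
        with disj show "A \<in> \<Union>(S \<inter> T)" by blast
      qed
    qed blast
    moreover have "S \<inter> T \<subseteq> carrier PGL" using that by blast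
    ultimately show ?thesis using that by (simp add: openin_Int)
  qed
  moreover have "?P (\<Union>K)" if "\<forall>S\<in>K. ?P S" for K
  proof -
    have "openin (top_of_set (carrier GL)) (\<Union>(Union ` K))"
      by (rule openin_Union) (use that in auto)
    moreover have "\<Union>(\<Union>K) = \<Union>(Union ` K)" by blast
    moreover have "\<Union>K \<subseteq> carrier PGL" using that by blast
    ultimately show ?thesis by simp
  qed
  ultimately have "istopology ?P"
    unfolding istopology_def by blast
  then show ?thesis unfolding PGL_topology_def by (simp only: topology_inverse')
qed

lemma quotient_map_PGL:
  "quotient_map (top_of_set (carrier GL)) PGL_topology
     (\<lambda>A. scalar_matrices #>\<^bsub>GL\<^esub> (A :: real^'n^'n))"
proof -
  interpret normal "scalar_matrices :: (real^'n^'n) set" GL by (rule normal_scalar_matrices)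
  have un: "\<Union>(carrier PGL :: (real^'n^'n) set set) = carrier GL"
    unfolding carrier_PGL by (rule rcosets_part_G[OF is_subgroup])
  have "openin PGL_topology (carrier PGL :: (real^'n^'n) set set)"
    unfolding openin_PGL_topology un by simp
  moreover have "topspace PGL_topology \<subseteq> (carrier PGL :: (real^'n^'n) set set)"
    using openin_topspace[of PGL_topology] unfolding openin_PGL_topology by (rule conjunct1)
  ultimately have ts: "topspace PGL_topology = (carrier PGL :: (real^'n^'n) set set)"
    by (meson openin_subset subset_antisym)
  have pre: "{A \<in> carrier GL. scalar_matrices #>\<^bsub>GL\<^esub> A \<in> U} = \<Union>U"
    if U: "U \<subseteq> carrier PGL" for U :: "(real^'n^'n) set set"
  proof (rule Set.set_eqI)
    fix A :: "real^'n^'n"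
    have "scalar_matrices #>\<^bsub>GL\<^esub> A = a" "A \<in> carrier GL" if a: "a \<in> U" "A \<in> a" for a
    proof -
      obtain B where B: "B \<in> carrier GL" "a = scalar_matrices #>\<^bsub>GL\<^esub> B"
        using a(1) U unfolding carrier_PGL RCOSETS_def by blast
      show "scalar_matrices #>\<^bsub>GL\<^esub> A = a"
        using repr_independence[of A scalar_matrices B] a(2) B is_subgroup by simp
      show "A \<in> carrier GL" using un a U by blast
    qed
    moreover have "A \<in> scalar_matrices #>\<^bsub>GL\<^esub> A" if "A \<in> carrier GL"
      using rcos_self[OF that is_subgroup] .
    ultimately show "A \<in> {A \<in> carrier GL. scalar_matrices #>\<^bsub>GL\<^esub> A \<in> U} \<longleftrightarrow> A \<in> \<Union>U"
      by (metis (no_types, lifting) UnionE UnionI mem_Collect_eq)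
  qed
  have "(\<lambda>A. scalar_matrices #>\<^bsub>GL\<^esub> A) ` carrier GL = (carrier PGL :: (real^'n^'n) set set)"
    unfolding carrier_PGL RCOSETS_def by blast
  then show ?thesis
    using pre by (simp add: quotient_map_def ts openin_PGL_topology topspace_euclidean_subtopology)
qed

lemma pgl_act_proj_pt:
  assumes "invertible A" "x \<noteq> 0"
  shows "pgl_act (scalar_matrices #>\<^bsub>GL\<^esub> A) (proj_pt x) = proj_pt (A *v x)"
proof -
  have *: "(c *\<^sub>R A) *v (k *\<^sub>R x) = (c * k) *\<^sub>R (A *v x)" for c k
    by (simp add: scaleR_matrix_vector_assoc[symmetric] matrix_vector_mult_scaleR)
  have "(\<Union>B\<in>scalar_matrices #>\<^bsub>GL\<^esub> A. (*v) B ` span {x}) = span {A *v x}"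
  proof
    show "(\<Union>B\<in>scalar_matrices #>\<^bsub>GL\<^esub> A. (*v) B ` span {x}) \<subseteq> span {A *v x}"
      unfolding rcoset_scalar span_singleton using * by blast
  next
    show "span {A *v x} \<subseteq> (\<Union>B\<in>scalar_matrices #>\<^bsub>GL\<^esub> A. (*v) B ` span {x})"
    proof
      fix y assume "y \<in> span {A *v x}"
      then obtain k where "y = k *\<^sub>R (A *v x)" unfolding span_singleton by blast
      then have "y = A *v (k *\<^sub>R x)" by (simp add: matrix_vector_mult_scaleR)
      moreover have "A \<in> scalar_matrices #>\<^bsub>GL\<^esub> A"
        unfolding rcoset_scalar by (auto intro: exI[of _ 1])
      moreover have "k *\<^sub>R x \<in> span {x}" unfolding span_singleton by blast
      ultimately show "y \<in> (\<Union>B\<in>scalar_matrices #>\<^bsub>GL\<^esub> A. (*v) B ` span {x})" by blast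
    qed
  qed
  then show ?thesis
    unfolding pgl_act_def line_of_proj_pt[OF assms(2)] by (simp only: proj_pt_def)
qed

definition discrete_faithful ::
  "('g, 'b) monoid_scheme \<Rightarrow> ('g \<Rightarrow> (real^'n^'n) set) \<Rightarrow> bool" where
  "discrete_faithful H \<rho> \<longleftrightarrow> \<rho> \<in> hom H PGL \<and> inj_on \<rho> (carrier H) \<and>
     subtopology PGL_topology (\<rho> ` carrier H) = discrete_topology (\<rho> ` carrier H)"

section \<open>Convexity in projective space\<close>

text \<open>
  Linear forms on \<open>V\<close> are represented by vectors through the inner product, so that
  \<^typ>\<open>'a proj\<close> serves as the dual projective space as well.
\<close>

definition hyperplane :: "'a::euclidean_space proj \<Rightarrow> 'a proj set" where
  "hyperplane h = {p. \<forall>f\<in>line_of h. \<forall>x\<in>line_of p. f \<bullet> x = 0}"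

text \<open>
  For \<open>f \<noteq> 0\<close>, the affine chart \<open>affine_chart f\<close> is identified by \<open>affine_coord f\<close> with the
  affine hyperplane \<open>{x. f \<bullet> x = 1}\<close> of \<open>V\<close>.
\<close>

definition affine_chart :: "'a::euclidean_space \<Rightarrow> 'a proj set" where
  "affine_chart f = - hyperplane (proj_pt f)"

definition affine_coord :: "'a::euclidean_space \<Rightarrow> 'a proj \<Rightarrow> 'a" where
  "affine_coord f p = (THE x. x \<in> line_of p \<and> f \<bullet> x = 1)"

lemma hyperplane_proj_pt:
  assumes "f \<noteq> 0" "x \<noteq> 0"
  shows "proj_pt x \<in> hyperplane (proj_pt f) \<longleftrightarrow> f \<bullet> x = 0"
proof
  assume "proj_pt x \<in> hyperplane (proj_pt f)"
  moreover have "f \<in> span {f}" "x \<in> span {x}" by (simp_all add: span_base)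
  ultimately show "f \<bullet> x = 0"
    unfolding hyperplane_def mem_Collect_eq line_of_proj_pt[OF assms(1)] line_of_proj_pt[OF assms(2)]
    by blast
next
  assume "f \<bullet> x = 0"
  then show "proj_pt x \<in> hyperplane (proj_pt f)"
    unfolding hyperplane_def mem_Collect_eq line_of_proj_pt[OF assms(1)] line_of_proj_pt[OF assms(2)]
      span_singleton by (auto simp only: inner_scaleR_left inner_scaleR_right mult_zero_right)
qed

lemma affine_coord_proj_pt:
  assumes "x \<noteq> 0" "f \<bullet> x \<noteq> 0"
  shows "affine_coord f (proj_pt x) = inverse (f \<bullet> x) *\<^sub>R x"
  unfolding affine_coord_def line_of_proj_pt[OF assms(1)] span_singleton
proof (rule the_equality)
  fix y assume y: "y \<in> range (\<lambda>k. k *\<^sub>R x) \<and> f \<bullet> y = 1"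
  then obtain k where k: "y = k *\<^sub>R x" by blast
  with y have "k * (f \<bullet> x) = 1" by simp
  then have "k = inverse (f \<bullet> x)" using inverse_unique[of "f \<bullet> x" k] by (simp add: mult.commute)
  with k show "y = inverse (f \<bullet> x) *\<^sub>R x" by simp
qed (use assms in auto)

definition properly_convex :: "'a::euclidean_space proj set \<Rightarrow> bool" where
  "properly_convex X \<longleftrightarrow> open X \<and>
     (\<exists>f. f \<noteq> 0 \<and> X \<subseteq> affine_chart f \<and>
        convex (affine_coord f ` X) \<and> bounded (affine_coord f ` X))"

definition chart_hull :: "'a::euclidean_space \<Rightarrow> 'a proj set \<Rightarrow> 'a proj set" where
  "chart_hull f X = {p \<in> affine_chart f. affine_coord f p \<in> convex hull (affine_coord f ` X)}"

text \<open>The hull of \<open>X\<close> is meaningful only under \<open>proj_hull_well_defined X\<close>.\<close>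

definition proj_hull_well_defined :: "'a::euclidean_space proj set \<Rightarrow> bool" where
  "proj_hull_well_defined X \<longleftrightarrow> connected X \<and> (\<exists>f. f \<noteq> 0 \<and> X \<subseteq> affine_chart f) \<and>
     (\<forall>f f'. f \<noteq> 0 \<and> X \<subseteq> affine_chart f \<and> f' \<noteq> 0 \<and> X \<subseteq> affine_chart f' \<longrightarrow>
        chart_hull f X = chart_hull f' X)"

definition proj_hull :: "'a::euclidean_space proj set \<Rightarrow> 'a proj set" where
  "proj_hull X = chart_hull (SOME f. f \<noteq> 0 \<and> X \<subseteq> affine_chart f) X"

definition proj_dual :: "'a::euclidean_space proj set \<Rightarrow> 'a proj set" where
  "proj_dual X = {h. hyperplane h \<inter> closure X = {}}"

definition occultation_position ::
  "'a::euclidean_space proj set \<Rightarrow> 'a proj set \<Rightarrow> 'a proj set \<Rightarrow> bool" where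
  "occultation_position A B C \<longleftrightarrow>
     \<not> A \<subseteq> B \<and> \<not> C \<subseteq> B \<and>
     A \<inter> B \<noteq> {} \<and> B \<inter> C \<noteq> {} \<and> A \<inter> C = {} \<and>
     closure (proj_dual B) \<subseteq> proj_dual A \<union> proj_dual C"

text \<open>
  The pairs \<open>(e, 1)\<close> and \<open>(e', \<gamma>)\<close> represent distinct edges of the universal covering tree with
  the same origin. When \<open>G\<close> has an edge, there is such a pair unless the graph is a single edge
  with two distinct endpoints and both edge embeddings are onto (the tree is then a single edge).
\<close>

definition distinct_branches :: "('v, 'e, 'g, 'h) gog \<Rightarrow> 'e \<Rightarrow> 'e \<Rightarrow> 'g \<Rightarrow> bool" where
  "distinct_branches G e e' \<gamma> \<longleftrightarrow>
     e \<in> arcs (base G) \<and> e' \<in> arcs (base G) \<and> tail (base G) e = tail (base G) e' \<and>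
     \<gamma> \<in> carrier (vgrp G (tail (base G) e)) \<and>
     (e \<noteq> e' \<or> e = e' \<and> \<gamma> \<notin> emb G e ` carrier (egrp G (uedge G e)))"

definition edge_hull ::
  "('v, 'e, 'g, 'h) gog \<Rightarrow> ('e \<Rightarrow> (real^'n^'n) set) \<Rightarrow> ('v \<Rightarrow> (real^'n) proj set) \<Rightarrow>
     'e \<Rightarrow> (real^'n) proj set" where
  "edge_hull G g \<Omega> e =
     proj_hull (\<Omega> (tail (base G) e) \<union> pgl_act (g e) ` \<Omega> (head (base G) e))"

definition total_domain ::
  "('v, 'e, 'g, 'h) gog \<Rightarrow> 'v \<Rightarrow> (('v, 'e, 'g) letter list set \<Rightarrow> (real^'n^'n) set) \<Rightarrow>
     ('e \<Rightarrow> (real^'n^'n) set) \<Rightarrow> ('v \<Rightarrow> (real^'n) proj set) \<Rightarrow> (real^'n) proj set" where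
  "total_domain G v\<^sub>0 R g \<Omega> =
     (\<Union>v\<in>verts (base G). \<Union>x\<in>F_paths G v\<^sub>0 v. \<Union>e\<in>{e \<in> arcs (base G). tail (base G) e = v}.
        pgl_act (R x) ` edge_hull G g \<Omega> e)"

end

theory Submission
  imports Defs
begin

text \<open>
  A properly convex set lifts to an open convex cone in \<open>\<real>\<^sup>d\<close>, and occultation position of \<open>(A, B, C)\<close>
  then says that every nonzero linear form that is nonnegative on \<open>B\<close> is positive on the closure of \<open>A\<close>
  or on the closure of \<open>C\<close>, up to the origin. When \<open>d \<ge> 3\<close> this propagates along reduced paths of the
  universal covering tree: each interior domain of a path hides the two end domains from each other.
  By separation, every segment between the end domains crosses all domains in between. Hence the end
  domains are disjoint once the path has length at least \<open>2\<close>, which gives discreteness and faithfulness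
  by ping-pong, and the union of the edge hulls is convex. It is properly convex because at a vertex
  with two branches the linear forms that are nonnegative on all domains have nonempty interior.
\<close>

section \<open>Cones and dual cones\<close>

text \<open>A projective set has two lifts, opposite cones, and occultation of lifts makes sense
  only for matching signs. The sign is fixed by asking neighbouring lifts to meet, and a form strict
  on both makes this choice unique; such a form exists because neither outer set of an occulting
  triple lies in the middle one. Signs are thus determined successively along a chain, and over the
  whole tree by one form positive on all lifts. The hypothesis speaks of three consecutive domains
  only. Longer triples are reached by connectedness: \<open>strict_dual B\<close> is open and
  \<open>pos_dual B\<close> with the origin is closed, so a convex set of nonzero forms on which the
  two agree lies inside both or misses both. If it lay inside, a direction orthogonal to a point of
  \<open>B\<close>, available in dimension at least 3, would give a ray or a line that no dual of a
  proper cone can contain. On the group side, each path is brought to a reduced form by cancelling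
  backtracks, and a nonempty reduced closed path is recognised as nontrivial because it, or its
  square, moves the base domain off itself.\<close>

text \<open>
  Linear forms are vectors, acting through the inner product. For the projective set spanned by a
  proper cone \<open>K\<close>, \<open>strict_dual K\<close> lifts the dual: by compactness the uniform bound says that the
  form is positive on the closure of \<open>K\<close> minus the origin. The set \<open>pos_dual K\<close> lifts the closure of
  the dual, whence \<open>occults\<close> is the last clause of occultation position for lifts of matching signs.
\<close>

definition pos_dual :: "'a::euclidean_space set \<Rightarrow> 'a set" where
  "pos_dual K = {f. f \<noteq> 0 \<and> (\<forall>x\<in>K. 0 \<le> f \<bullet> x)}"

definition strict_dual :: "'a::euclidean_space set \<Rightarrow> 'a set" where
  "strict_dual K = {f. \<exists>\<epsilon>>0. \<forall>x\<in>K. \<epsilon> * norm x \<le> f \<bullet> x}"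

definition proper_cone :: "'a::euclidean_space set \<Rightarrow> bool" where
  "proper_cone K \<longleftrightarrow> open K \<and> K \<noteq> {} \<and> (\<forall>x\<in>K. \<forall>y\<in>K. x + y \<in> K) \<and>
     (\<forall>c>0. \<forall>x\<in>K. c *\<^sub>R x \<in> K) \<and> strict_dual K \<noteq> {}"

definition occults :: "'a::euclidean_space set \<Rightarrow> 'a set \<Rightarrow> 'a set \<Rightarrow> bool" where
  "occults A B C \<longleftrightarrow> pos_dual B \<subseteq> strict_dual A \<union> strict_dual C"

lemma occults_sym: "occults A B C \<longleftrightarrow> occults C B A"
  unfolding occults_def by blast

lemma proper_coneD:
  assumes "proper_cone K"
  shows "open K" "K \<noteq> {}" "\<And>x y. x \<in> K \<Longrightarrow> y \<in> K \<Longrightarrow> x + y \<in> K"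
    "\<And>c x. c > 0 \<Longrightarrow> x \<in> K \<Longrightarrow> c *\<^sub>R x \<in> K" "strict_dual K \<noteq> {}"
  using assms unfolding proper_cone_def by auto

lemma proper_cone_convex: "proper_cone K \<Longrightarrow> convex K"
  unfolding convex_alt
proof (intro ballI allI impI)
  fix x y and u :: real
  assume K: "proper_cone K" and xy: "x \<in> K" "y \<in> K" and u: "0 \<le> u \<and> u \<le> 1"
  note D = proper_coneD[OF K]
  show "(1 - u) *\<^sub>R x + u *\<^sub>R y \<in> K"
  proof (cases "u = 0 \<or> u = 1")
    case True then show ?thesis using xy by auto
  next
    case False then show ?thesis using u xy by (intro D) auto
  qed
qed

lemma open_coneE:
  fixes K :: "'a::real_normed_vector set"
  assumes "open K" "x \<in> K"
  obtains \<delta> where "\<delta> > 0" "x + \<delta> *\<^sub>R u \<in> K"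
proof -
  obtain e where e: "e > 0" "ball x e \<subseteq> K" using assms open_contains_ball by blast
  \<comment> \<open>The summand 1 keeps the denominator positive when \<open>u = 0\<close>.\<close>
  define d where "d = e / (2 * (norm u + 1))"
  have n: "norm u + 1 > 0" by (smt (verit) norm_ge_zero)
  have "d > 0" using e n by (simp add: d_def)
  moreover have "norm (d *\<^sub>R u) < e"
  proof -
    have "norm (d *\<^sub>R u) = d * norm u" using \<open>d > 0\<close> by simp
    also have "\<dots> \<le> d * (norm u + 1)" using \<open>d > 0\<close> by simp
    also have "\<dots> = e / 2" using n by (simp add: d_def field_simps)
    finally show ?thesis using e by simp
  qed
  then have "x + d *\<^sub>R u \<in> ball x e" by (simp add: dist_norm)
  ultimately show ?thesis using that e by blast
qed

text \<open>A small step from \<open>x\<close> in direction \<open>- f\<close> stays in the open set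
  and lowers the value by a positive multiple of \<open>f \<bullet> f\<close>, so the value at
  \<open>x\<close> cannot already be 0.\<close>

lemma pos_dual_pos:
  assumes "open K" "f \<in> pos_dual K" "x \<in> K" shows "f \<bullet> x > 0"
proof -
  obtain d where d: "d > 0" "x + d *\<^sub>R (- f) \<in> K" using open_coneE[OF assms(1,3)] .
  have "f \<noteq> 0" "0 \<le> f \<bullet> (x + d *\<^sub>R (- f))" using assms(2) d unfolding pos_dual_def by auto
  then have "0 \<le> f \<bullet> x - d * (f \<bullet> f)" by (simp add: inner_right_distrib inner_diff_right)
  moreover have "f \<bullet> f > 0" using \<open>f \<noteq> 0\<close> by simp
  ultimately show ?thesis using d by (smt (verit) mult_pos_pos)
qed

text \<open>An open set around 0 contains a small multiple of every vector, in particular of one on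
  which the form \<open>f\<close> is nonpositive; the uniform bound then fails there.\<close>

lemma zero_notin_cone: assumes "proper_cone K" shows "0 \<notin> K"
proof
  assume z: "0 \<in> K"
  obtain f e where f: "e > 0" "\<forall>x\<in>K. e * norm x \<le> f \<bullet> x"
    using assms unfolding proper_cone_def strict_dual_def by blast
  obtain b :: 'a where b: "b \<in> Basis" using nonempty_Basis by blast
  have 1: "e * norm x \<le> 0" if "norm x > 0" "f \<bullet> x \<le> 0" for x
  proof -
    obtain d where d: "d > 0" "0 + d *\<^sub>R x \<in> K" using open_coneE[OF proper_coneD(1)[OF assms] z] .
    then have "e * norm (d *\<^sub>R x) \<le> f \<bullet> (d *\<^sub>R x)" using f by auto
    also have "\<dots> \<le> 0" using d that by (simp add: mult_nonneg_nonpos)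
    finally show ?thesis using d f that by (simp add: mult_le_0_iff)
  qed
  have "f \<bullet> b \<le> 0 \<or> f \<bullet> (- b) \<le> 0" by auto
  then show False using 1[of b] 1[of "-b"] f b by (auto simp: mult_le_0_iff)
qed

lemma strict_dual_imp_pos_dual:
  assumes "proper_cone K" "f \<in> strict_dual K" shows "f \<in> pos_dual K"
proof -
  obtain e where e: "e > 0" "\<forall>x\<in>K. e * norm x \<le> f \<bullet> x" using assms(2) unfolding strict_dual_def by blast
  obtain x where x: "x \<in> K" using proper_coneD(2)[OF assms(1)] by blast
  then have "x \<noteq> 0" using zero_notin_cone[OF assms(1)] by blast
  then have "e * norm x > 0" using e by simp
  then have "f \<noteq> 0" using e x by (metis inner_zero_left linorder_not_less)
  moreover have "0 \<le> f \<bullet> x" if "x \<in> K" for x using e that by (smt (verit) mult_nonneg_nonneg norm_ge_zero)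
  ultimately show ?thesis unfolding pos_dual_def by blast
qed

text \<open>By Cauchy-Schwarz, forms at distance less than half the uniform constant keep the other
  half of it.\<close>

lemma open_strict_dual: "open (strict_dual K)"
  unfolding open_contains_ball
proof
  fix f assume "f \<in> strict_dual K"
  then obtain e where e: "e > 0" "\<forall>x\<in>K. e * norm x \<le> f \<bullet> x" unfolding strict_dual_def by blast
  have "g \<in> strict_dual K" if "g \<in> ball f (e/2)" for g
  proof -
    have "e/2 * norm x \<le> g \<bullet> x" if x: "x \<in> K" for x
    proof -
      have "\<bar>(f - g) \<bullet> x\<bar> \<le> norm (f - g) * norm x" by (rule Cauchy_Schwarz_ineq2)
      also have "\<dots> \<le> e/2 * norm x"
        using \<open>g \<in> ball f (e/2)\<close> by (intro mult_right_mono) (auto simp: dist_norm)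
      finally have "f \<bullet> x - g \<bullet> x \<le> e/2 * norm x" unfolding inner_diff_left by linarith
      moreover have "e * norm x \<le> f \<bullet> x" using e x by blast
      ultimately show ?thesis by (simp add: field_simps)
    qed
    then show ?thesis unfolding strict_dual_def using e by (auto intro!: exI[of _ "e/2"])
  qed
  then show "\<exists>e>0. ball f e \<subseteq> strict_dual K" using e by (intro exI[of _ "e/2"]) auto
qed

lemma strict_dual_closure:
  assumes "f \<in> strict_dual K" "a \<in> closure K" "a \<noteq> 0" shows "f \<bullet> a > 0"
proof -
  obtain e where e: "e > 0" "\<forall>x\<in>K. e * norm x \<le> f \<bullet> x" using assms(1) unfolding strict_dual_def by blast
  have "closed {x. e * norm x \<le> f \<bullet> x}" by (intro closed_Collect_le continuous_intros)
  then have "closure K \<subseteq> {x. e * norm x \<le> f \<bullet> x}" using e by (intro closure_minimal) auto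
  then have "e * norm a \<le> f \<bullet> a" using assms by blast
  moreover have "e * norm a > 0" using e assms by simp
  ultimately show ?thesis by linarith
qed

text \<open>On the compact set of unit vectors in \<open>closure K\<close> the form attains its
  minimum; a positive minimum would be a uniform constant.\<close>

lemma not_strict_dualE:
  assumes "proper_cone K" "f \<notin> strict_dual K"
  obtains a where "a \<in> closure K" "a \<noteq> 0" "f \<bullet> a \<le> 0"
proof -
  define S where "S = closure K \<inter> sphere 0 1"
  have cS: "compact S" unfolding S_def by (simp add: closed_Int_compact)
  obtain x where x: "x \<in> K" "x \<noteq> 0" using proper_coneD(2)[OF assms(1)] zero_notin_cone[OF assms(1)] by blast
  have nrm: "inverse (norm x) *\<^sub>R x \<in> S" if "x \<in> K" "x \<noteq> 0" for x
    using that proper_coneD(4)[OF assms(1)] closure_subset unfolding S_def by force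
  then have neS: "S \<noteq> {}" using x by blast
  have cont: "continuous_on S (\<lambda>x. f \<bullet> x)" by (intro continuous_intros)
  obtain a where a: "a \<in> S" "\<forall>y\<in>S. f \<bullet> a \<le> f \<bullet> y"
    using continuous_attains_inf[OF cS neS cont] by blast
  have "f \<bullet> a \<le> 0"
  proof (rule ccontr)
    assume "\<not> ?thesis"
    then have pos: "f \<bullet> a > 0" by simp
    have "(f \<bullet> a) * norm x \<le> f \<bullet> x" if "x \<in> K" for x
    proof (cases "x = 0")
      case False
      then have "f \<bullet> a \<le> f \<bullet> (inverse (norm x) *\<^sub>R x)" using a nrm that by blast
      then show ?thesis using False by (simp add: field_simps)
    qed simp
    then show False using assms(2) pos unfolding strict_dual_def by blast
  qed
  moreover have "a \<in> closure K" "a \<noteq> 0" using a(1) unfolding S_def by auto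
  ultimately show ?thesis using that by blast
qed

lemma pos_dual_add: assumes "open K" "K \<noteq> {}" "f \<in> pos_dual K" "g \<in> pos_dual K" shows "f + g \<in> pos_dual K"
proof -
  obtain x where x: "x \<in> K" using assms by blast
  \<comment> \<open>A positive value at one point of \<open>K\<close> guarantees that the sum is not
    the zero form.\<close>
  have "(f + g) \<bullet> x > 0" using pos_dual_pos[OF assms(1) _ x] assms by (simp add: inner_add_left add_pos_pos)
  then have "f + g \<noteq> 0" by auto
  then show ?thesis using assms unfolding pos_dual_def by (auto simp: inner_add_left)
qed

lemma pos_dual_scaleR: "c > 0 \<Longrightarrow> f \<in> pos_dual K \<Longrightarrow> c *\<^sub>R f \<in> pos_dual K"
  unfolding pos_dual_def by auto

lemma convex_pos_dual: assumes "proper_cone K" shows "convex (pos_dual K)"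
  unfolding convex_alt
proof (intro ballI allI impI)
  fix x y and u :: real
  assume xy: "x \<in> pos_dual K" "y \<in> pos_dual K" and u: "0 \<le> u \<and> u \<le> 1"
  show "(1 - u) *\<^sub>R x + u *\<^sub>R y \<in> pos_dual K"
  proof (cases "u = 0 \<or> u = 1")
    case True then show ?thesis using xy by auto
  next
    case False then show ?thesis
      using u xy proper_coneD[OF assms] by (intro pos_dual_add pos_dual_scaleR) auto
  qed
qed

text \<open>With the origin put back, the set is an intersection of closed half-spaces. This closed
  set is played against the open \<open>strict_dual\<close> in all connectedness arguments
  below.\<close>

lemma closed_pos_dual0: "closed (insert 0 (pos_dual K))"
proof -
  have "insert 0 (pos_dual K) = (\<Inter>x\<in>K. {f. 0 \<le> f \<bullet> x})"
    unfolding pos_dual_def by auto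
  then show ?thesis by (auto intro!: closed_INT closed_Collect_le continuous_intros)
qed

lemma strict_dual_add_pos_dual:
  assumes "f \<in> strict_dual K" "g \<in> pos_dual K" shows "g + f \<in> strict_dual K"
proof -
  obtain e where e: "e > 0" "\<forall>x\<in>K. e * norm x \<le> f \<bullet> x" using assms(1) unfolding strict_dual_def by blast
  then have "\<forall>x\<in>K. e * norm x \<le> (g + f) \<bullet> x" using assms(2) unfolding pos_dual_def by (auto simp: inner_add_left add_increasing)
  then show ?thesis using e unfolding strict_dual_def by blast
qed

lemma strict_dual_scaleR:
  assumes "c > 0" "f \<in> strict_dual K" shows "c *\<^sub>R f \<in> strict_dual K"
proof -
  obtain e where e: "e > 0" "\<forall>x\<in>K. e * norm x \<le> f \<bullet> x" using assms(2) unfolding strict_dual_def by blast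
  then have "\<forall>x\<in>K. (c * e) * norm x \<le> (c *\<^sub>R f) \<bullet> x" using assms by (auto simp: mult.assoc)
  then show ?thesis using e assms unfolding strict_dual_def by (auto intro!: exI[of _ "c * e"])
qed

text \<open>The dimension bound enters the development through this lemma: two vectors span at most
  a plane.\<close>

lemma exists_orthogonal_pair:
  fixes p q :: "'a::euclidean_space"
  assumes "DIM('a) \<ge> 3" obtains w where "w \<noteq> 0" "w \<bullet> p = 0" "w \<bullet> q = 0"
proof -
  have "dim (span {p, q}) \<le> card {p, q}" by (simp add: dim_le_card')
  also have "\<dots> \<le> 2" by (simp add: card_insert_if)
  finally have "dim (span {p, q}) < DIM('a)" using assms by simp
  then obtain w where "w \<noteq> 0" "\<And>y. y \<in> span {p, q} \<Longrightarrow> orthogonal w y"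
    using orthogonal_to_subspace_exists[of "{p,q}"] by (auto simp: dim_span)
  then show ?thesis using that[of w] by (auto simp: orthogonal_def span_base)
qed

text \<open>The traces of \<open>U\<close> and \<open>C\<close> on \<open>N\<close> coincide, so
  this trace is open and closed in a connected set. Used with \<open>U = strict_dual B\<close> and
  \<open>C = insert 0 (pos_dual B)\<close>.\<close>

lemma clopen_in_convex_imp:
  fixes N :: "'a::real_normed_vector set"
  assumes "convex N" "closed C" "open U" "N \<inter> C \<subseteq> U" "U \<subseteq> C" "N \<inter> U \<noteq> {}"
  shows "N \<subseteq> U"
proof (rule ccontr)
  assume "\<not> N \<subseteq> U"
  then have "N \<inter> - C \<noteq> {}" using assms by blast
  then show False
    using connectedD[OF convex_connected[OF assms(1)], of U "- C"] assms by (auto simp: open_Compl)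
qed

text \<open>
  The region cut out by the two half-spaces and \<open>h \<bullet> q > 0\<close> is connected and meets \<open>pos_dual B\<close> in a
  clopen set. In dimension at least \<open>3\<close> it contains a ray along which \<open>h \<bullet> q\<close> is constant; in
  dimension \<open>2\<close> it may be bounded in the chart \<open>h \<bullet> q = 1\<close>, and the statement fails.
\<close>

lemma not_in_halfspaces:
  fixes B :: "'a::euclidean_space set"
  assumes dim: "DIM('a) \<ge> 3" and B: "proper_cone B"
    and sub: "\<And>g. g \<in> pos_dual B \<Longrightarrow> g \<bullet> a \<le> 0 \<Longrightarrow> g \<bullet> c \<le> 0 \<Longrightarrow> g \<in> strict_dual B"
    and g: "g \<in> pos_dual B" "g \<bullet> a \<le> 0" "g \<bullet> c \<le> 0"
  shows False
proof -
  note D = proper_coneD[OF B]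
  obtain q where q: "q \<in> B" using D by blast
  obtain w0 where w0: "w0 \<noteq> 0" "w0 \<bullet> q = 0" "w0 \<bullet> a = 0" using exists_orthogonal_pair[OF dim] .
  \<comment> \<open>Both signs of \<open>w0\<close> vanish at \<open>q\<close> and \<open>a\<close>;
    the sign is chosen so that adding multiples of \<open>w\<close> does not raise the value at
    \<open>c\<close>.\<close>
  obtain w where w: "w \<noteq> 0" "w \<bullet> q = 0" "w \<bullet> a = 0" "w \<bullet> c \<le> 0"
    by (cases "w0 \<bullet> c \<le> 0") (use w0 that[of w0] that[of "-w0"] in auto)
  define N where "N = {h. h \<bullet> a \<le> 0} \<inter> {h. h \<bullet> c \<le> 0} \<inter> {h. h \<bullet> q > 0}"
  have cN: "convex N" unfolding N_def
    using convex_halfspace_le[of a 0] convex_halfspace_le[of c 0] convex_halfspace_gt[of 0 q]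
    by (intro convex_Int) (simp_all add: inner_commute)
  \<comment> \<open>The origin is not in \<open>N\<close>, so there the closed set and the open set
    coincide, and the single common point \<open>g\<close> forces all of \<open>N\<close> into
    \<open>strict_dual B\<close>.\<close>
  have "g \<in> N \<inter> strict_dual B"
    using g sub pos_dual_pos[OF D(1) g(1) q] unfolding N_def by auto
  moreover have "N \<inter> insert 0 (pos_dual B) \<subseteq> strict_dual B" using sub unfolding N_def by auto
  ultimately have sN: "N \<subseteq> strict_dual B"
    using strict_dual_imp_pos_dual[OF B]
    by (intro clopen_in_convex_imp[OF cN closed_pos_dual0 open_strict_dual]) auto
  have ray: "g + t *\<^sub>R w \<in> pos_dual B" if "t \<ge> 0" for t
  proof -
    have "g + t *\<^sub>R w \<in> N" using g w that pos_dual_pos[OF D(1) g(1) q] unfolding N_def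
      by (auto simp: inner_add_left mult_nonneg_nonpos add_nonpos_nonpos)
    then show ?thesis using sN strict_dual_imp_pos_dual[OF B] by blast
  qed
  have "0 \<le> w \<bullet> x" if x: "x \<in> B" for x
  proof (rule ccontr)
    assume "\<not> ?thesis"
    then have n: "w \<bullet> x < 0" by simp
    \<comment> \<open>Far enough along the ray the value at \<open>x\<close> would be negative; this
      \<open>t\<close> makes it exactly -1.\<close>
    define t where "t = (1 + g \<bullet> x) / (- (w \<bullet> x))"
    have gx: "g \<bullet> x > 0" using pos_dual_pos[OF D(1) g(1) x] .
    then have "t \<ge> 0" using n unfolding t_def by (intro divide_nonneg_nonneg) auto
    then have "0 \<le> (g + t *\<^sub>R w) \<bullet> x" using ray x unfolding pos_dual_def by blast
    moreover have "t * (w \<bullet> x) = - (1 + g \<bullet> x)" using n by (simp add: t_def)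
    ultimately show False by (simp add: inner_add_left)
  qed
  then have "w \<in> pos_dual B" using w unfolding pos_dual_def by auto
  then show False using pos_dual_pos[OF D(1) _ q] w by fastforce
qed

text \<open>Induction on \<open>b - a\<close>. If \<open>g\<close> is strict on neither end, there
  are \<open>\<alpha>\<close> and \<open>\<beta>\<close> in the end closures where \<open>g\<close>
  is nonpositive. Any form of \<open>pos_dual (K i)\<close> nonpositive at these two points is, by
  the local hypothesis, strict on a neighbour of \<open>K i\<close>; a shorter triple transfers this
  to \<open>K i\<close> itself. Forms cut out by two half-spaces cannot all be strict, by
  \<open>not_in_halfspaces\<close>.\<close>

theorem occults_chain:
  fixes K :: "nat \<Rightarrow> 'a::euclidean_space set"
  assumes dim: "DIM('a) \<ge> 3" and K: "\<And>i. i \<le> n \<Longrightarrow> proper_cone (K i)"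
    and occ: "\<And>i. i + 2 \<le> n \<Longrightarrow> occults (K i) (K (i + 1)) (K (i + 2))"
  shows "a < i \<Longrightarrow> i < b \<Longrightarrow> b \<le> n \<Longrightarrow> occults (K a) (K i) (K b)"
proof (induction "b - a" arbitrary: a b i rule: less_induct)
  case less
  have Ks: "proper_cone (K a)" "proper_cone (K i)" "proper_cone (K b)" using K less by auto
  show ?case unfolding occults_def
  proof (rule ccontr)
    assume "\<not> pos_dual (K i) \<subseteq> strict_dual (K a) \<union> strict_dual (K b)"
    then obtain g where g: "g \<in> pos_dual (K i)" "g \<notin> strict_dual (K a)" "g \<notin> strict_dual (K b)" by blast
    obtain \<alpha> where \<alpha>: "\<alpha> \<in> closure (K a)" "\<alpha> \<noteq> 0" "g \<bullet> \<alpha> \<le> 0" using not_strict_dualE[OF Ks(1) g(2)] .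
    obtain \<beta> where \<beta>: "\<beta> \<in> closure (K b)" "\<beta> \<noteq> 0" "g \<bullet> \<beta> \<le> 0" using not_strict_dualE[OF Ks(3) g(3)] .
    have "h \<in> strict_dual (K i)" if h: "h \<in> pos_dual (K i)" "h \<bullet> \<alpha> \<le> 0" "h \<bullet> \<beta> \<le> 0" for h
    proof -
      have na: "h \<notin> strict_dual (K a)" using strict_dual_closure[of h "K a" \<alpha>] \<alpha> h by auto
      have nb: "h \<notin> strict_dual (K b)" using strict_dual_closure[of h "K b" \<beta>] \<beta> h by auto
      have "occults (K (i - 1)) (K i) (K (i + 1))" using occ[of "i - 1"] less by (cases i) auto
      then consider "h \<in> strict_dual (K (i - 1))" | "h \<in> strict_dual (K (i + 1))"
        using h(1) unfolding occults_def by blast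
      then show ?thesis
      proof cases
        case 1
        \<comment> \<open>Since \<open>h\<close> is not strict on \<open>K a\<close>, the shorter
          triple \<open>a < i - 1 < i\<close> leaves only strictness on \<open>K i\<close>. The
          right neighbour is treated symmetrically.\<close>
        then have "a \<noteq> i - 1" using na by auto
        then have "occults (K a) (K (i - 1)) (K i)" using less by (intro less(1)) auto
        moreover have "h \<in> pos_dual (K (i - 1))" using 1 K less by (intro strict_dual_imp_pos_dual) auto
        ultimately show ?thesis using na unfolding occults_def by blast
      next
        case 2
        then have "b \<noteq> i + 1" using nb by auto
        then have "occults (K i) (K (i + 1)) (K b)" using less by (intro less(1)) auto
        moreover have "h \<in> pos_dual (K (i + 1))" using 2 K less by (intro strict_dual_imp_pos_dual) auto
        ultimately show ?thesis using nb unfolding occults_def by blast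
      qed
    qed
    then show False using not_in_halfspaces[OF dim Ks(2)] g(1) \<alpha>(3) \<beta>(3) by blast
  qed
qed

text \<open>If the cone generated by \<open>p\<close> and \<open>q\<close> missed \<open>B\<close>,
  a separating hyperplane would give a form nonnegative on \<open>B\<close> and nonpositive at both
  points. This turns statements on forms into statements on segments: some point between
  \<open>p\<close> and \<open>q\<close> lies over \<open>B\<close>.\<close>

lemma meets_cone:
  fixes B :: "'a::euclidean_space set"
  assumes B: "proper_cone B" and pq: "\<And>f. f \<in> pos_dual B \<Longrightarrow> f \<bullet> p > 0 \<or> f \<bullet> q > 0"
  obtains s t where "s \<ge> 0" "t \<ge> 0" "s *\<^sub>R p + t *\<^sub>R q \<in> B"
proof (rule ccontr)
  assume no: "\<not> thesis"
  note D = proper_coneD[OF B]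
  define S where "S = {s *\<^sub>R p + t *\<^sub>R q | s t. s \<ge> 0 \<and> t \<ge> 0}"
  have "convex S"
    unfolding convex_def
  proof (intro ballI allI impI)
    fix x y and u v :: real
    assume "x \<in> S" "y \<in> S" and uv: "0 \<le> u" "0 \<le> v" "u + v = 1"
    then obtain s t s' t' where x: "x = s *\<^sub>R p + t *\<^sub>R q" "y = s' *\<^sub>R p + t' *\<^sub>R q" "s \<ge> 0" "t \<ge> 0" "s' \<ge> 0" "t' \<ge> 0"
      unfolding S_def by blast
    have "u *\<^sub>R x + v *\<^sub>R y = (u * s + v * s') *\<^sub>R p + (u * t + v * t') *\<^sub>R q"
      unfolding x by (simp add: algebra_simps)
    then show "u *\<^sub>R x + v *\<^sub>R y \<in> S" unfolding S_def using x uv by (blast intro: add_nonneg_nonneg mult_nonneg_nonneg)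
  qed
  moreover have "S \<inter> B = {}" using no that unfolding S_def by blast
  moreover have S0: "0 \<in> S" unfolding S_def by (auto intro!: exI[of _ 0])
  ultimately obtain f b where f: "f \<noteq> 0" "\<forall>x\<in>S. f \<bullet> x \<le> b" "\<forall>x\<in>B. f \<bullet> x \<ge> b"
    using separating_hyperplane_sets[of S B] proper_cone_convex[OF B] D(2) by blast
  have "b \<ge> 0" using f(2) S0 by auto
  then have fB: "f \<in> pos_dual B" using f unfolding pos_dual_def by force
  have sc: "f \<bullet> x \<le> 0" if "x \<in> {p, q}" for x
  proof (rule ccontr)
    assume n: "\<not> ?thesis"
    \<comment> \<open>Rescaling \<open>x\<close> to the value \<open>b + 1\<close> contradicts the
      bound \<open>b\<close> on \<open>S\<close>; a form bounded above on a cone is nonpositive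
      there.\<close>
    have "((b + 1) / (f \<bullet> x)) *\<^sub>R x \<in> S"
    proof -
      have "(b + 1) / (f \<bullet> x) \<ge> 0" using n \<open>b \<ge> 0\<close> by simp
      then show ?thesis unfolding S_def using that by force
    qed
    then have "f \<bullet> (((b + 1) / (f \<bullet> x)) *\<^sub>R x) \<le> b" using f by blast
    then show False using n by simp
  qed
  show False using pq[OF fB] sc[of p] sc[of q] by auto
qed

text \<open>For proper cones that meet, this Minkowski sum contains both of them and is therefore
  the convex hull of their union, that is, the lift of an edge hull.\<close>

definition cone_sum :: "'a::euclidean_space set \<Rightarrow> 'a set \<Rightarrow> 'a set" where
  "cone_sum A B = {a + b | a b. a \<in> A \<and> b \<in> B}"

text \<open>With \<open>q\<close> a common point and \<open>d\<close> small,
  \<open>x = (x - d q) + d q\<close> splits \<open>x\<close> between the two cones.\<close>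

lemma subset_cone_sum:
  assumes "proper_cone A" "proper_cone B" "A \<inter> B \<noteq> {}"
  shows "A \<subseteq> cone_sum A B" "B \<subseteq> cone_sum A B"
proof -
  have 1: "\<exists>y q. y \<in> A \<and> q \<in> B \<and> x = y + q"
    if AB: "proper_cone A" "proper_cone B" "A \<inter> B \<noteq> {}" and x: "x \<in> A" for A B :: "'a set" and x
  proof -
    obtain q where q: "q \<in> A" "q \<in> B" using AB by blast
    obtain d where d: "d > 0" "x + d *\<^sub>R (- q) \<in> A" using open_coneE[OF proper_coneD(1)[OF AB(1)] x] .
    have "d *\<^sub>R q \<in> B" using d q proper_coneD(4)[OF AB(2)] by blast
    moreover have "x = (x + d *\<^sub>R (- q)) + d *\<^sub>R q" by simp
    ultimately show ?thesis using d by blast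
  qed
  show "A \<subseteq> cone_sum A B" using 1[OF assms] unfolding cone_sum_def by blast
  show "B \<subseteq> cone_sum A B"
    using 1[OF assms(2,1)] assms(3) unfolding cone_sum_def by (auto simp: Int_commute) (metis add.commute)
qed

lemma cone_sum_add:
  assumes "proper_cone A" "proper_cone B" "x \<in> cone_sum A B" "y \<in> cone_sum A B"
  shows "x + y \<in> cone_sum A B"
proof -
  obtain a b a' b' where "x = a + b" "y = a' + b'" "a \<in> A" "b \<in> B" "a' \<in> A" "b' \<in> B"
    using assms unfolding cone_sum_def by blast
  moreover have "a + b + (a' + b') = (a + a') + (b + b')" by (simp add: algebra_simps)
  ultimately show ?thesis unfolding cone_sum_def
    using proper_coneD(3)[OF assms(1)] proper_coneD(3)[OF assms(2)] by blast
qed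

lemma cone_sum_scaleR:
  assumes "proper_cone A" "proper_cone B" "x \<in> cone_sum A B" "c > 0"
  shows "c *\<^sub>R x \<in> cone_sum A B"
proof -
  obtain a b where "x = a + b" "a \<in> A" "b \<in> B" using assms unfolding cone_sum_def by blast
  then show ?thesis unfolding cone_sum_def
    using proper_coneD(4)[OF assms(1) assms(4)] proper_coneD(4)[OF assms(2) assms(4)] by (auto simp: scaleR_add_right)
qed

text \<open>This is convexity of the union of the successive hulls, by induction on the last cone.
  The essential case is a point \<open>p\<close> of the old union and a point \<open>c\<close> of
  the new cone: a form nonnegative on \<open>K n\<close> is either strict on
  \<open>K (n + 1)\<close>, hence positive at \<open>c\<close>, or by far occultation positive on
  all earlier cones, hence at \<open>p\<close>. So the segment from \<open>p\<close> to
  \<open>c\<close> crosses \<open>K n\<close>, which splits \<open>p + c\<close> into admissible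
  pieces.\<close>

theorem chain_hull_add:
  fixes K :: "nat \<Rightarrow> 'a::euclidean_space set"
  assumes dim: "DIM('a) \<ge> 3" and K: "\<And>i. i \<le> n \<Longrightarrow> proper_cone (K i)"
    and adj: "\<And>i. i < n \<Longrightarrow> K i \<inter> K (i + 1) \<noteq> {}"
    and occ: "\<And>i. i + 2 \<le> n \<Longrightarrow> occults (K i) (K (i + 1)) (K (i + 2))"
    and xy: "x \<in> (\<Union>i<n. cone_sum (K i) (K (i + 1)))" "y \<in> (\<Union>i<n. cone_sum (K i) (K (i + 1)))"
  shows "x + y \<in> (\<Union>i<n. cone_sum (K i) (K (i + 1)))"
  using K adj occ xy
proof (induction n arbitrary: x y)
  case 0 then show ?case by simp
next
  case (Suc n)
  let ?W = "\<Union>i<n. cone_sum (K i) (K (i + 1))" and ?V = "\<Union>i<Suc n. cone_sum (K i) (K (i + 1))"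
  have V: "?V = ?W \<union> cone_sum (K n) (K (n + 1))" by (auto simp: less_Suc_eq)
  have Kn: "proper_cone (K n)" "proper_cone (K (n + 1))" using Suc.prems(1) by auto
  note D = proper_coneD[OF Kn(1)]
  show ?case
  proof (cases "n = 0")
    case True
    then show ?thesis using Suc.prems cone_sum_add[OF Kn] by auto
  next
    case False
    have addW: "u + v \<in> ?W" if "u \<in> ?W" "v \<in> ?W" for u v
      using Suc.prems(1-3) that by (intro Suc.IH) auto
    have scW: "c *\<^sub>R u \<in> ?W" if "u \<in> ?W" "c > 0" for u c
    proof -
      from that obtain i where "i < n" "u \<in> cone_sum (K i) (K (i + 1))" by blast
      then show ?thesis
        using cone_sum_scaleR[of "K i" "K (i+1)" u c] Suc.prems(1)[of i] Suc.prems(1)[of "i + 1"] \<open>c > 0\<close> by auto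
    qed
    have KnW: "K n \<subseteq> ?W"
    proof -
      have "K n \<subseteq> cone_sum (K (n - 1)) (K (n - 1 + 1))"
        using subset_cone_sum(2)[of "K (n - 1)" "K n"] Suc.prems(1)[of "n - 1"] Suc.prems(2)[of "n - 1"] Kn False by auto
      moreover have "n - 1 \<in> {..<n}" using False by simp
      ultimately show ?thesis by blast
    qed
    have KnZ: "K n \<subseteq> cone_sum (K n) (K (n + 1))" "K (n + 1) \<subseteq> cone_sum (K n) (K (n + 1))"
      using subset_cone_sum[OF Kn] Suc.prems(2)[of n] by auto
    have key: "p + c \<in> ?V" if p: "p \<in> ?W" and c: "c \<in> K (n + 1)" for p c
    proof -
      have "f \<bullet> p > 0 \<or> f \<bullet> c > 0" if f: "f \<in> pos_dual (K n)" for f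
      proof (cases "f \<in> strict_dual (K (n + 1))")
        case True
        then show ?thesis using pos_dual_pos[OF proper_coneD(1)[OF Kn(2)] strict_dual_imp_pos_dual[OF Kn(2)] c] by blast
      next
        case nf: False
        have pos: "f \<bullet> u > 0" if u: "u \<in> K i" and i: "i \<le> n" for i u
        proof -
          have pc: "proper_cone (K i)" using Suc.prems(1) i by simp
          have "f \<in> pos_dual (K i)"
          proof (cases "i = n")
            case True
            then show ?thesis using f by simp
          next
            case False
            have "occults (K i) (K n) (K (n + 1))"
              by (rule occults_chain[where n = "Suc n", OF dim Suc.prems(1) Suc.prems(3)]) (use i False in simp_all)
            then have "f \<in> strict_dual (K i)" using nf f unfolding occults_def by blast
            then show ?thesis by (rule strict_dual_imp_pos_dual[OF pc])
          qed
          then show ?thesis by (rule pos_dual_pos[OF proper_coneD(1)[OF pc] _ u])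
        qed
        obtain i u v where "i < n" "u \<in> K i" "v \<in> K (i + 1)" "p = u + v" using p unfolding cone_sum_def by blast
        moreover from this have "f \<bullet> u > 0" "f \<bullet> v > 0" by (auto intro!: pos)
        ultimately have "f \<bullet> p > 0" by (simp add: inner_add_right)
        then show ?thesis by blast
      qed
      then obtain s t where st: "s \<ge> 0" "t \<ge> 0" "s *\<^sub>R p + t *\<^sub>R c \<in> K n" using meets_cone[OF Kn(1)] by blast
      let ?m = "s *\<^sub>R p + t *\<^sub>R c"
      have st0: "s \<noteq> 0 \<or> t \<noteq> 0" using st zero_notin_cone[OF Kn(1)] by auto
      \<comment> \<open>After division by the larger coefficient, \<open>?m\<close> absorbs the
        corresponding summand completely, and a nonnegative multiple of the other summand
        remains.\<close>
      consider "s < t" | "t < s" | "s = t" by linarith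
      then show ?thesis
      proof cases
        case 1
        have e: "p + c = (1 - s / t) *\<^sub>R p + (1 / t) *\<^sub>R ?m"
          using 1 st by (simp add: scaleR_add_right scaleR_left_diff_distrib)
        have "(1 / t) *\<^sub>R ?m \<in> ?W" using 1 st by (intro subsetD[OF KnW] D(4)) simp_all
        moreover have "(1 - s / t) *\<^sub>R p \<in> ?W" using 1 st by (intro scW[OF p]) simp
        ultimately have "p + c \<in> ?W" unfolding e by (intro addW)
        then show ?thesis unfolding V by (rule UnI1)
      next
        case 2
        have e: "p + c = (1 / s) *\<^sub>R ?m + (1 - t / s) *\<^sub>R c"
          using 2 st by (simp add: scaleR_add_right scaleR_left_diff_distrib)
        have "(1 / s) *\<^sub>R ?m \<in> K n" using 2 st by (intro D(4)) simp_all
        moreover have "(1 - t / s) *\<^sub>R c \<in> K (n + 1)" using 2 st c by (intro proper_coneD(4)[OF Kn(2)]) simp_all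
        ultimately have "p + c \<in> cone_sum (K n) (K (n + 1))" unfolding e cone_sum_def by blast
        then show ?thesis unfolding V by (rule UnI2)
      next
        case 3
        then have e: "p + c = (1 / s) *\<^sub>R ?m" using st st0 by (simp add: scaleR_add_right)
        have "(1 / s) *\<^sub>R ?m \<in> K n" using 3 st st0 by (intro D(4)) simp_all
        then have "p + c \<in> ?W" unfolding e using KnW by (rule_tac subsetD)
        then show ?thesis unfolding V by (rule UnI1)
      qed
    qed
    \<comment> \<open>The part of \<open>q\<close> in \<open>K n\<close> is absorbed into
      \<open>?W\<close> by the induction hypothesis, which leaves the case
      \<open>key\<close>.\<close>
    have mixed: "p + q \<in> ?V" if p: "p \<in> ?W" and q: "q \<in> cone_sum (K n) (K (n + 1))" for p q
    proof -
      obtain b c where bc: "b \<in> K n" "c \<in> K (n + 1)" "q = b + c" using q unfolding cone_sum_def by blast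
      have "(p + b) + c \<in> ?V" by (rule key[OF addW[OF p subsetD[OF KnW bc(1)]] bc(2)])
      then show ?thesis unfolding bc(3) add.assoc .
    qed
    have xV: "x \<in> ?W \<or> x \<in> cone_sum (K n) (K (n + 1))" using Suc.prems(4) unfolding V Un_iff .
    have yV: "y \<in> ?W \<or> y \<in> cone_sum (K n) (K (n + 1))" using Suc.prems(5) unfolding V Un_iff .
    from xV show ?thesis
    proof
      assume x: "x \<in> ?W"
      from yV show ?thesis
      proof
        assume "y \<in> ?W"
        then show ?thesis unfolding V by (intro UnI1 addW[OF x])
      next
        assume "y \<in> cone_sum (K n) (K (n + 1))"
        then show ?thesis by (rule mixed[OF x])
      qed
    next
      assume x: "x \<in> cone_sum (K n) (K (n + 1))"
      from yV show ?thesis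
      proof
        assume "y \<in> ?W"
        then show ?thesis unfolding add.commute[of x y] by (rule mixed[OF _ x])
      next
        assume "y \<in> cone_sum (K n) (K (n + 1))"
        then show ?thesis unfolding V by (intro UnI2 cone_sum_add[OF Kn x])
      qed
    qed
  qed
qed

section \<open>Forms common to all branches at a cone\<close>

text \<open>An open set not contained in the convex open \<open>B\<close> is not contained in
  \<open>closure B\<close> either, as \<open>B\<close> is the interior of its closure. Separating
  such a point \<open>a\<close> from \<open>closure B\<close> gives a form of
  \<open>pos_dual B\<close> negative at \<open>a\<close>, and a small strict perturbation keeps the
  sign.\<close>

lemma exists_strict_dual_neg:
  assumes A: "proper_cone A" and B: "proper_cone B" and nsub: "\<not> A \<subseteq> B"
  obtains a where "a \<in> A" "a \<notin> closure B" "open {g \<in> strict_dual B. g \<bullet> a < 0}" "{g \<in> strict_dual B. g \<bullet> a < 0} \<noteq> {}"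
proof -
  have "\<not> A \<subseteq> closure B"
  proof
    assume "A \<subseteq> closure B"
    then have "A \<subseteq> interior (closure B)" using proper_coneD(1)[OF A] by (simp add: interior_maximal)
    also have "\<dots> = B" using convex_interior_closure[OF proper_cone_convex[OF B]] interior_open[OF proper_coneD(1)[OF B]] by simp
    finally show False using nsub by blast
  qed
  then obtain a where a: "a \<in> A" "a \<notin> closure B" by blast
  have "convex (closure B)" using proper_cone_convex[OF B] by (rule convex_closure)
  then obtain f b where f: "f \<bullet> a < b" "\<forall>x\<in>closure B. f \<bullet> x > b"
    using separating_hyperplane_closed_point[of "closure B" a] a by auto
  have z: "0 \<in> closure B"
  proof -
    obtain q where q: "q \<in> B" using proper_coneD(2)[OF B] by blast
    have "(\<lambda>n. (1 / real (Suc n)) *\<^sub>R q) \<longlonglongrightarrow> 0 *\<^sub>R q" by (intro tendsto_intros lim_1_over_n[THEN LIMSEQ_Suc])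
    moreover have "(1 / real (Suc n)) *\<^sub>R q \<in> B" for n using q by (intro proper_coneD(4)[OF B]) auto
    ultimately show ?thesis unfolding closure_sequential by force
  qed
  then have b: "b < 0" using f by force
  have "0 \<le> f \<bullet> x" if x: "x \<in> B" for x
  proof (rule ccontr)
    assume n: "\<not> ?thesis"
    \<comment> \<open>A point of \<open>B\<close> with negative value could be rescaled to the value
      \<open>b\<close>, which the strict separation forbids.\<close>
    have "(b / (f \<bullet> x)) *\<^sub>R x \<in> B" using n b x by (intro proper_coneD(4)[OF B]) (auto simp: divide_neg_neg)
    then have "f \<bullet> ((b / (f \<bullet> x)) *\<^sub>R x) > b" using f(2) closure_subset[of B] by blast
    then show False using n by simp
  qed
  moreover have "f \<noteq> 0" using f(1) b by auto
  ultimately have fd: "f \<in> pos_dual B" unfolding pos_dual_def by blast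
  obtain h where h: "h \<in> strict_dual B" using proper_coneD(5)[OF B] by blast
  \<comment> \<open>Chosen so that \<open>e * (h \<bullet> a)\<close> uses up at most half of the
    negative value of \<open>f\<close> at \<open>a\<close>.\<close>
  define e where "e = - (f \<bullet> a) / (2 * (\<bar>h \<bullet> a\<bar> + 1))"
  have fa: "f \<bullet> a < 0" using f b by linarith
  then have e: "e > 0" unfolding e_def by (intro divide_pos_pos) auto
  have "e * (h \<bullet> a) \<le> e * (\<bar>h \<bullet> a\<bar> + 1)" using e by (intro mult_left_mono) auto
  also have "\<dots> = - (f \<bullet> a) / 2" unfolding e_def by (simp add: field_simps)
  finally have "(f + e *\<^sub>R h) \<bullet> a < 0" using fa by (simp add: inner_add_left)
  moreover have "f + e *\<^sub>R h \<in> strict_dual B" using strict_dual_add_pos_dual[OF strict_dual_scaleR[OF e h] fd] .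
  moreover have "open {g \<in> strict_dual B. g \<bullet> a < 0}"
  proof -
    have "{g \<in> strict_dual B. g \<bullet> a < 0} = strict_dual B \<inter> {g. a \<bullet> g < 0}" by (auto simp: inner_commute)
    then show ?thesis using open_Int[OF open_strict_dual open_halfspace_lt] by metis
  qed
  ultimately show ?thesis using that[OF a] by blast
qed

lemma open_avoids_hyperplane:
  fixes v :: "'a::euclidean_space"
  assumes "open U" "g \<in> U" "v \<noteq> 0" obtains g' where "g' \<in> U" "v \<bullet> g' \<noteq> 0"
proof -
  obtain d where d: "d > 0" "g + d *\<^sub>R v \<in> U" using open_coneE[OF assms(1,2)] .
  have "v \<bullet> (g + d *\<^sub>R v) \<noteq> v \<bullet> g" using d assms(3) by (simp add: inner_add_right)
  then show ?thesis using that[of g] that[of "g + d *\<^sub>R v"] d assms by (cases "v \<bullet> g = 0") auto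
qed

lemma convex_dual_halfspace:
  "proper_cone B \<Longrightarrow> convex (pos_dual B \<inter> {g. 0 < v \<bullet> g})"
  by (intro convex_Int convex_pos_dual convex_halfspace_gt)

text \<open>In a small half-ball \<open>N\<close> around \<open>g\<close> on the positive side of
  the hyperplane, membership in \<open>pos_dual B\<close> already implies strictness, so
  \<open>N\<close> lies wholly in \<open>strict_dual B\<close>. Its closure contains the flat disc
  through \<open>g\<close>, which therefore consists of forms nonnegative on
  \<open>B\<close>.\<close>

lemma dual_slice_neighbourhood:
  fixes B K :: "'a::euclidean_space set"
  assumes B: "proper_cone B" and v: "v \<noteq> 0"
    and g: "g \<in> pos_dual B" "v \<bullet> g = 0" "g \<in> strict_dual K"
    and q: "q \<in> pos_dual B" "v \<bullet> q > 0"
    and sub: "\<And>h. h \<in> pos_dual B \<Longrightarrow> v \<bullet> h > 0 \<Longrightarrow> h \<in> strict_dual K \<Longrightarrow> h \<in> strict_dual B"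
  shows "\<exists>N. open N \<and> g \<in> N \<and> N \<inter> {h. v \<bullet> h = 0} \<subseteq> insert 0 (pos_dual B)"
proof -
  note D = proper_coneD[OF B]
  obtain r where r: "r > 0" "ball g r \<subseteq> strict_dual K"
    using open_strict_dual[of K] g(3) open_contains_ball by blast
  define N where "N = ball g r \<inter> {h. 0 < v \<bullet> h}"
  have cN: "convex N" unfolding N_def by (intro convex_Int convex_ball convex_halfspace_gt)
  have "0 \<notin> N" unfolding N_def by simp
  then have sub': "N \<inter> insert 0 (pos_dual B) \<subseteq> strict_dual B"
    using r sub unfolding N_def by blast
  \<comment> \<open>Moving from \<open>g\<close> slightly towards \<open>q\<close> enters the
    half-ball without leaving \<open>pos_dual B\<close>, so the clopen trace is nonempty.\<close>
  obtain d where d: "d > 0" "g + d *\<^sub>R q \<in> ball g r"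
    using open_coneE[OF open_ball centre_in_ball[THEN iffD2, OF r(1)]] .
  have "g + d *\<^sub>R q \<in> pos_dual B" using g q d by (intro pos_dual_add D pos_dual_scaleR)
  moreover have "g + d *\<^sub>R q \<in> N" unfolding N_def using d g q by (simp add: inner_add_right)
  ultimately have "N \<inter> strict_dual B \<noteq> {}" using sub' by blast
  moreover have sp: "strict_dual B \<subseteq> insert 0 (pos_dual B)" using strict_dual_imp_pos_dual[OF B] by blast
  ultimately have Nsub: "N \<subseteq> strict_dual B"
    using sub' by (intro clopen_in_convex_imp[OF cN closed_pos_dual0 open_strict_dual])
  have clN: "closure N \<subseteq> insert 0 (pos_dual B)"
    using Nsub sp by (intro closure_minimal closed_pos_dual0) blast
  have "h \<in> insert 0 (pos_dual B)" if h: "h \<in> ball g r" "v \<bullet> h = 0" for h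
  proof -
    have "h \<in> closure N"
      unfolding closure_approachable
    proof (intro allI impI)
      fix e :: real assume "e > 0"
      then have "h \<in> ball g r \<inter> ball h e" using h by simp
      then obtain d where d: "d > 0" "h + d *\<^sub>R v \<in> ball g r \<inter> ball h e"
        using open_coneE[OF open_Int[OF open_ball open_ball]] by metis
      have "h + d *\<^sub>R v \<in> N" unfolding N_def using d h v by (simp add: inner_add_right)
      then show "\<exists>y\<in>N. dist y h < e" using d(2) by (intro bexI) (simp_all add: dist_commute)
    qed
    then show ?thesis using clN by blast
  qed
  then have "ball g r \<inter> {h. v \<bullet> h = 0} \<subseteq> insert 0 (pos_dual B)" by blast
  then show ?thesis using r(1) open_ball centre_in_ball by blast
qed

text \<open>Inside the hyperplane take a line through \<open>g0\<close> in a direction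
  \<open>w\<close> that vanishes at a point \<open>q\<close> of \<open>B\<close>. Its parameters in
  the dual form a clopen set of reals, hence the whole line is nonnegative on \<open>B\<close>. Then
  \<open>w\<close> vanishes on the open set \<open>B\<close>, which is absurd.\<close>

lemma dual_slice_not_open:
  fixes B :: "'a::euclidean_space set"
  assumes dim: "DIM('a) \<ge> 3" and B: "proper_cone B" and g0: "g0 \<in> pos_dual B" "v \<bullet> g0 = 0"
    and nbhd: "\<And>g. g \<in> pos_dual B \<Longrightarrow> v \<bullet> g = 0 \<Longrightarrow>
      \<exists>N. open N \<and> g \<in> N \<and> N \<inter> {h. v \<bullet> h = 0} \<subseteq> insert 0 (pos_dual B)"
  shows False
proof -
  note D = proper_coneD[OF B]
  obtain q where q: "q \<in> B" using D by blast
  obtain w where w: "w \<noteq> 0" "w \<bullet> v = 0" "w \<bullet> q = 0" using exists_orthogonal_pair[OF dim] .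
  define l where "l t = g0 + t *\<^sub>R w" for t
  define T where "T = l -` insert 0 (pos_dual B)"
  have nz: "l t \<noteq> 0" for t
  proof
    assume "l t = 0"
    then have "l t \<bullet> q = 0" by simp
    then show False using pos_dual_pos[OF D(1) g0(1) q] w unfolding l_def by (simp add: inner_add_left)
  qed
  have vl: "v \<bullet> l t = 0" for t using g0 w unfolding l_def by (simp add: inner_add_right inner_commute)
  have cont: "isCont l t" for t unfolding l_def by (intro continuous_intros)
  have "closed T" unfolding T_def by (rule continuous_closed_vimage[OF closed_pos_dual0 cont])
  moreover have "open T"
    unfolding open_contains_ball
  proof
    fix t assume "t \<in> T"
    then have "l t \<in> pos_dual B" using nz[of t] unfolding T_def by simp
    then obtain N where N: "open N" "l t \<in> N" "N \<inter> {h. v \<bullet> h = 0} \<subseteq> insert 0 (pos_dual B)"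
      using nbhd vl by blast
    have "open (l -` N)" by (rule continuous_open_vimage[OF N(1) cont])
    then obtain e where e: "e > 0" "ball t e \<subseteq> l -` N" using N(2) open_contains_ball by blast
    then have "ball t e \<subseteq> T" using N(3) vl unfolding T_def by blast
    then show "\<exists>e>0. ball t e \<subseteq> T" using e by blast
  qed
  moreover have "0 \<in> T" using g0 unfolding T_def l_def by simp
  ultimately have "T = UNIV" using clopen by blast
  then have ray: "l t \<in> pos_dual B" for t using nz[of t] unfolding T_def by auto
  have "w \<bullet> x = 0" if x: "x \<in> B" for x
  proof (rule ccontr)
    assume n: "w \<bullet> x \<noteq> 0"
    \<comment> \<open>At this parameter the value at \<open>x\<close> is -1.\<close>
    have "l (- (1 + g0 \<bullet> x) / (w \<bullet> x)) \<bullet> x \<ge> 0" using ray x unfolding pos_dual_def by blast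
    then show False using n unfolding l_def by (simp add: inner_add_left)
  qed
  moreover obtain d where d: "d > 0" "q + d *\<^sub>R w \<in> B" using open_coneE[OF D(1) q] .
  ultimately have "w \<bullet> (q + d *\<^sub>R w) = 0" by blast
  then show False using w d by (simp add: inner_add_right)
qed

text \<open>
  Here \<open>br j\<close> is the first cone of a branch growing out of \<open>B\<close> and \<open>la j\<close> some cone of that branch.
  Suppose the common forms lie in a hyperplane \<open>v \<bullet> g = 0\<close>. A form of \<open>pos_dual B\<close> off the hyperplane is
  negative somewhere on exactly one branch, and by connectedness this branch depends only on the
  side, so the two given branches occupy one side each. A form \<open>g\<close> of \<open>pos_dual B\<close> in the hyperplane
  is strict on one of them, and the forms of \<open>pos_dual B\<close> near \<open>g\<close> on the corresponding side cannot
  touch the boundary of \<open>pos_dual B\<close>. Hence \<open>pos_dual B\<close> is open in the hyperplane near \<open>g\<close>, which is absurd.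
\<close>

theorem branches_common_dual_interior:
  fixes B :: "'a::euclidean_space set" and br la :: "'j \<Rightarrow> 'a set"
  assumes dim: "DIM('a) \<ge> 3" and B: "proper_cone B"
    and la: "\<And>j. j \<in> J \<Longrightarrow> proper_cone (la j)" and br: "\<And>j. j \<in> J \<Longrightarrow> proper_cone (br j)"
    and diff: "\<And>j j'. j \<in> J \<Longrightarrow> j' \<in> J \<Longrightarrow> br j \<noteq> br j' \<Longrightarrow> occults (la j) B (la j')"
    and same: "\<And>j. j \<in> J \<Longrightarrow> la j = br j \<or> occults B (br j) (la j)"
    and j1: "j1 \<in> J" "la j1 = br j1" "\<not> br j1 \<subseteq> B"
    and j2: "j2 \<in> J" "la j2 = br j2" "\<not> br j2 \<subseteq> B"
    and neq: "br j1 \<noteq> br j2"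
  obtains f \<epsilon> where "\<epsilon> > 0" "\<And>x. x \<in> B \<Longrightarrow> \<epsilon> * norm x \<le> f \<bullet> x"
    "\<And>j x. j \<in> J \<Longrightarrow> x \<in> la j \<Longrightarrow> \<epsilon> * norm x \<le> f \<bullet> x"
proof -
  note D = proper_coneD[OF B]
  define X where "X = B \<union> (\<Union>j\<in>J. la j)"
  define D0 where "D0 = {g. \<forall>x\<in>X. 0 \<le> g \<bullet> x}"
  have "interior D0 \<noteq> {}"
  proof
    assume int: "interior D0 = {}"
    have "D0 = (\<Inter>x\<in>X. {g. x \<bullet> g \<ge> 0})" unfolding D0_def by (auto simp: inner_commute)
    then have "convex D0" by (simp add: convex_INT convex_halfspace_ge)
    from empty_interior_subset_hyperplane[OF this int]
    obtain v b where v: "v \<noteq> 0" "D0 \<subseteq> {x. v \<bullet> x = b}" by blast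
    have "0 \<in> D0" unfolding D0_def by simp
    then have b: "b = 0" using v by auto
    define neg where "neg j = (\<Union>c\<in>la j. {g. c \<bullet> g < 0})" for j
    \<comment> \<open>Branches are grouped by their first cone, because \<open>diff\<close> compares
      only branches with different first cones. \<open>Bad K\<close> and \<open>Bad' K\<close> then
      cannot share a form of \<open>pos_dual B\<close>.\<close>
    define Bad where "Bad K = (\<Union>j\<in>{j\<in>J. br j = K}. neg j)" for K
    define Bad' where "Bad' K = (\<Union>j\<in>{j\<in>J. br j \<noteq> K}. neg j)" for K
    have openneg: "open (neg j)" for j unfolding neg_def by (intro open_UN ballI open_halfspace_lt)
    then have openBad: "open (Bad K)" "open (Bad' K)" for K
      unfolding Bad_def Bad'_def by (intro open_UN ballI; assumption)+
    have not_strict: "g \<notin> strict_dual (la j)" if j: "j \<in> J" and g: "g \<in> neg j" for g j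
    proof
      assume "g \<in> strict_dual (la j)"
      then have "g \<in> pos_dual (la j)" by (rule strict_dual_imp_pos_dual[OF la[OF j]])
      then show False using g unfolding neg_def pos_dual_def by (force simp: inner_commute)
    qed
    have uniq: False if "g \<in> pos_dual B" "j \<in> J" "j' \<in> J" "br j \<noteq> br j'" "g \<notin> strict_dual (la j)" "g \<notin> strict_dual (la j')" for g j j'
      using diff[OF that(2-4)] that unfolding occults_def by blast
    have bad: "g \<in> Bad K \<union> Bad' K" if g: "g \<in> pos_dual B" "v \<bullet> g \<noteq> 0" for g K
    proof -
      have "g \<notin> D0" using v b g by auto
      then obtain x where x: "x \<in> X" "g \<bullet> x < 0" unfolding D0_def by force
      moreover have "x \<notin> B" using g x unfolding pos_dual_def by force
      ultimately obtain j where "j \<in> J" "x \<in> la j" unfolding X_def by blast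
      then have "j \<in> J" "g \<in> neg j" unfolding neg_def using x by (auto simp: inner_commute)
      then show ?thesis unfolding Bad_def Bad'_def by blast
    qed
    have disj: "g \<notin> Bad' K" if g: "g \<in> pos_dual B" "g \<in> Bad K" for g K
      using uniq[OF g(1)] not_strict g unfolding Bad_def Bad'_def by blast
    \<comment> \<open>The factor \<open>s\<close> lets one statement serve both sides of the
      hyperplane: each side is convex, hence connected, and covered by the disjoint traces of two
      open sets.\<close>
    have whole: "pos_dual B \<inter> {g. 0 < u \<bullet> g} \<subseteq> Bad K"
      if u: "u = s *\<^sub>R v" and g: "g \<in> pos_dual B" "u \<bullet> g > 0" "g \<in> Bad K" for u s K g
    proof (rule ccontr)
      let ?P = "pos_dual B \<inter> {g. 0 < u \<bullet> g}"
      assume "\<not> ?P \<subseteq> Bad K"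
      have cov: "?P \<subseteq> Bad K \<union> Bad' K"
      proof
        fix h assume h: "h \<in> ?P"
        then have "v \<bullet> h \<noteq> 0" unfolding u by auto
        then show "h \<in> Bad K \<union> Bad' K" using bad h by blast
      qed
      then have "Bad' K \<inter> ?P \<noteq> {}" using \<open>\<not> ?P \<subseteq> Bad K\<close> by blast
      moreover have "Bad K \<inter> Bad' K \<inter> ?P = {}" using disj by blast
      moreover have "Bad K \<inter> ?P \<noteq> {}" using g by blast
      ultimately show False
        using connectedD[OF convex_connected[OF convex_dual_halfspace[OF B, of u]] openBad(1)[of K] openBad(2)[of K] _ cov]
        by simp
    qed
    have witness: "\<exists>g\<in>pos_dual B. v \<bullet> g \<noteq> 0 \<and> g \<in> Bad (br j)"
      if j: "j \<in> J" "la j = br j" "\<not> br j \<subseteq> B" for j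
    proof -
      obtain a where a: "a \<in> br j" "open {g \<in> strict_dual B. g \<bullet> a < 0}" "{g \<in> strict_dual B. g \<bullet> a < 0} \<noteq> {}"
        by (rule exists_strict_dual_neg[OF br[OF j(1)] B j(3)])
      then obtain g where g: "g \<in> strict_dual B" "g \<bullet> a < 0" "v \<bullet> g \<noteq> 0"
        using open_avoids_hyperplane[OF a(2) _ v(1)] by blast
      then have "g \<in> neg j" unfolding neg_def using j a by (auto simp: inner_commute)
      then have "g \<in> Bad (br j)" unfolding Bad_def using j by blast
      then show ?thesis using g strict_dual_imp_pos_dual[OF B] by blast
    qed
    obtain g1 where g1: "g1 \<in> pos_dual B" "v \<bullet> g1 \<noteq> 0" "g1 \<in> Bad (br j1)" using witness[OF j1] by blast
    obtain g2 where g2: "g2 \<in> pos_dual B" "v \<bullet> g2 \<noteq> 0" "g2 \<in> Bad (br j2)" using witness[OF j2] by blast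
    \<comment> \<open>Scaling \<open>v\<close> by its value at \<open>g1\<close> puts
      \<open>g1\<close> on the positive side of \<open>u1\<close>, with value \<open>s\<close>
      squared; \<open>u2\<close> is the opposite normal, with \<open>g2\<close> on its positive
      side.\<close>
    define s where "s = v \<bullet> g1"
    define u1 where "u1 = s *\<^sub>R v"
    define u2 where "u2 = (- s) *\<^sub>R v"
    have s: "s \<noteq> 0" using g1 s_def by simp
    have "u1 \<bullet> g1 = s\<^sup>2" unfolding u1_def by (simp add: s_def power2_eq_square)
    then have u1: "u1 \<bullet> g1 > 0" "u1 \<noteq> 0" using s by auto
    have P1: "pos_dual B \<inter> {g. 0 < u1 \<bullet> g} \<subseteq> Bad (br j1)" by (rule whole[OF u1_def g1(1) u1(1) g1(3)])
    have "g2 \<notin> Bad (br j1)"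
    proof
      assume "g2 \<in> Bad (br j1)"
      then have "g2 \<notin> Bad' (br j1)" using disj g2 by blast
      then show False using g2(3) neq unfolding Bad_def Bad'_def by auto
    qed
    then have "\<not> u1 \<bullet> g2 > 0" using P1 g2 by blast
    then have u2: "u2 \<bullet> g2 > 0" "u2 \<noteq> 0"
    proof -
      have "u1 \<bullet> g2 \<noteq> 0" using g2 s unfolding u1_def by simp
      then have "u1 \<bullet> g2 < 0" using \<open>\<not> u1 \<bullet> g2 > 0\<close> by linarith
      then show "u2 \<bullet> g2 > 0" unfolding u1_def u2_def by simp
      show "u2 \<noteq> 0" using s v unfolding u2_def by simp
    qed
    have P2: "pos_dual B \<inter> {g. 0 < u2 \<bullet> g} \<subseteq> Bad (br j2)" by (rule whole[OF u2_def g2(1) u2(1) g2(3)])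
    \<comment> \<open>The branch that is bad for \<open>h\<close> starts with the cone
      \<open>br j\<close>, on which \<open>h\<close> is strict. The badness therefore occurs further
      out, and occultation of \<open>B\<close> and \<open>la i\<close> by \<open>br j\<close> forces
      strictness on \<open>B\<close>.\<close>
    have escape: "h \<in> strict_dual B"
      if j: "j \<in> J" and P: "pos_dual B \<inter> {g. 0 < u \<bullet> g} \<subseteq> Bad (br j)"
        and h: "h \<in> pos_dual B" "u \<bullet> h > 0" "h \<in> strict_dual (br j)" for u h j
    proof -
      have "h \<in> Bad (br j)" using P h by blast
      then obtain i where i: "i \<in> J" "br i = br j" "h \<in> neg i" unfolding Bad_def by blast
      have n: "h \<notin> strict_dual (la i)" by (rule not_strict[OF i(1,3)])
      then have "la i \<noteq> br i" using h i(2) by auto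
      then have "occults B (br j) (la i)" using same[OF i(1)] i(2) by simp
      then show ?thesis using n strict_dual_imp_pos_dual[OF br[OF j] h(3)] unfolding occults_def by blast
    qed
    \<comment> \<open>The weights cancel the values of \<open>g1\<close> and \<open>g2\<close> under
      \<open>v\<close>, so that \<open>g0\<close> lies in the hyperplane.\<close>
    define g0 where "g0 = (u2 \<bullet> g2) *\<^sub>R g1 + (u1 \<bullet> g1) *\<^sub>R g2"
    have g0: "g0 \<in> pos_dual B" unfolding g0_def using g1 g2 u1 u2 by (intro pos_dual_add D pos_dual_scaleR)
    have g0v: "v \<bullet> g0 = 0" unfolding g0_def u1_def u2_def by (simp add: inner_add_right inner_diff_right s_def)
    show False
    proof (rule dual_slice_not_open[OF dim B g0 g0v])
      fix g assume g: "g \<in> pos_dual B" "v \<bullet> g = 0"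
      have vu: "u1 \<bullet> h = 0 \<longleftrightarrow> v \<bullet> h = 0" "u2 \<bullet> h = 0 \<longleftrightarrow> v \<bullet> h = 0" for h using s unfolding u1_def u2_def by auto
      consider "g \<in> strict_dual (br j1)" | "g \<in> strict_dual (br j2)"
        using diff[OF j1(1) j2(1) neq] g unfolding occults_def j1(2) j2(2) by blast
      then show "\<exists>N. open N \<and> g \<in> N \<and> N \<inter> {h. v \<bullet> h = 0} \<subseteq> insert 0 (pos_dual B)"
      proof cases
        case 1
        have "u1 \<bullet> g = 0" using vu g by simp
        from dual_slice_neighbourhood[OF B u1(2) g(1) this 1 g1(1) u1(1) escape[OF j1(1) P1]]
        show ?thesis unfolding vu .
      next
        case 2
        have "u2 \<bullet> g = 0" using vu g by simp
        from dual_slice_neighbourhood[OF B u2(2) g(1) this 2 g2(1) u2(1) escape[OF j2(1) P2]]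
        show ?thesis unfolding vu .
      qed
    qed
  qed
  then obtain f r where r: "r > 0" "cball f r \<subseteq> D0"
    unfolding ex_in_conv[symmetric] mem_interior_cball by blast
  have est: "r * norm x \<le> f \<bullet> x" if x: "x \<in> X" for x
  proof (cases "x = 0")
    case False
    \<comment> \<open>This point of the ball around \<open>f\<close> is the worst one for
      \<open>x\<close>. The radius thus becomes a constant uniform over all branches, even
      infinitely many.\<close>
    have "f - (r / norm x) *\<^sub>R x \<in> cball f r" using False r by (simp add: dist_norm)
    then have "0 \<le> (f - (r / norm x) *\<^sub>R x) \<bullet> x" using r x unfolding D0_def by blast
    then have "(r / norm x) * (x \<bullet> x) \<le> f \<bullet> x" by (simp add: inner_diff_left)
    moreover have "(r / norm x) * (x \<bullet> x) = r * norm x" using False by (simp add: dot_square_norm power2_eq_square)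
    ultimately show ?thesis by simp
  qed simp
  show ?thesis
  proof (rule that[OF r(1)])
    show "r * norm x \<le> f \<bullet> x" if "x \<in> B" for x using est that unfolding X_def by blast
    show "r * norm x \<le> f \<bullet> x" if "j \<in> J" "x \<in> la j" for j x using est that unfolding X_def by blast
  qed
qed

section \<open>Lifting projective sets to cones\<close>

lemma proj_pt_scaleR: assumes "c \<noteq> 0" shows "proj_pt (c *\<^sub>R x) = proj_pt x"
proof -
  have "span {c *\<^sub>R x} = span {x}"
  proof (intro subset_antisym)
    show "span {c *\<^sub>R x} \<subseteq> span {x}" by (intro span_minimal) (auto intro: span_mul span_base)
    have "inverse c *\<^sub>R (c *\<^sub>R x) \<in> span {c *\<^sub>R x}" by (intro span_mul span_base) simp
    then show "span {x} \<subseteq> span {c *\<^sub>R x}" using assms by (intro span_minimal) auto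
  qed
  then show ?thesis unfolding proj_pt_def by simp
qed

lemma proj_pt_uminus: "proj_pt (- x) = proj_pt x"
  using proj_pt_scaleR[of "-1" x] by simp

lemma proj_pt_eqE:
  assumes "proj_pt x = proj_pt y" "x \<noteq> 0" "y \<noteq> 0" obtains c where "c \<noteq> 0" "y = c *\<^sub>R x"
proof -
  have "span {x} = span {y}" using assms line_of_proj_pt by metis
  then have "y \<in> span {x}" by (simp add: span_base)
  then obtain c where "y = c *\<^sub>R x" unfolding span_singleton by blast
  then show ?thesis using that assms(3) by fastforce
qed

lemma proj_pt_in_cone_iff:
  assumes K: "proper_cone K" and x: "x \<noteq> 0"
  shows "proj_pt x \<in> proj_pt ` K \<longleftrightarrow> x \<in> K \<or> - x \<in> K"
proof
  assume "proj_pt x \<in> proj_pt ` K"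
  then obtain k where k: "k \<in> K" "proj_pt k = proj_pt x" by auto
  then obtain c where c: "c \<noteq> 0" "x = c *\<^sub>R k" using proj_pt_eqE[OF k(2)] x zero_notin_cone[OF K] by blast
  show "x \<in> K \<or> - x \<in> K"
  proof (cases "c > 0")
    case True
    then show ?thesis using proper_coneD(4)[OF K _ k(1)] c by simp
  next
    case False
    then have "(- c) *\<^sub>R k \<in> K" using c by (intro proper_coneD(4)[OF K _ k(1)]) simp
    then show ?thesis using c by simp
  qed
next
  assume "x \<in> K \<or> - x \<in> K"
  then show "proj_pt x \<in> proj_pt ` K" using proj_pt_uminus by (metis imageI)
qed

lemma open_proj_iff: "open U \<longleftrightarrow> open {x. x \<noteq> 0 \<and> proj_pt x \<in> U}"
proof -
  have "{x. x \<noteq> 0 \<and> proj_pt x \<in> U} \<subseteq> - {0}" by auto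
  then show ?thesis unfolding open_proj_def using openin_open_eq[of "- {0 :: 'a}"] by (simp add: open_Compl closed_singleton)
qed

lemma continuous_proj_pt: "continuous_on (- {0}) proj_pt"
  unfolding continuous_on_open_invariant
proof (intro allI impI)
  fix B :: "'a proj set" assume "open B"
  then have "open {x. x \<noteq> 0 \<and> proj_pt x \<in> B}" unfolding open_proj_iff .
  then show "\<exists>A. open A \<and> A \<inter> - {0} = proj_pt -` B \<inter> - {0}" by (intro exI[of _ "{x. x \<noteq> 0 \<and> proj_pt x \<in> B}"]) auto
qed

lemma proper_cone_uminus: assumes "proper_cone K" shows "proper_cone (uminus ` K)"
proof -
  note D = proper_coneD[OF assms]
  obtain f e where f: "e > 0" "\<forall>x\<in>K. e * norm x \<le> f \<bullet> x" using D(5) unfolding strict_dual_def by blast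
  then have "- f \<in> strict_dual (uminus ` K)" unfolding strict_dual_def by auto
  moreover have "open (uminus ` K)" using D(1) by (rule open_negations)
  moreover have "x + y \<in> uminus ` K" if "x \<in> uminus ` K" "y \<in> uminus ` K" for x y
  proof -
    have "(- x) + (- y) \<in> K" using that D(3) by auto
    then have "- (x + y) \<in> K" by simp
    then show ?thesis by (metis image_eqI minus_minus)
  qed
  moreover have "c *\<^sub>R x \<in> uminus ` K" if "x \<in> uminus ` K" "c > 0" for x c
    using that D(4) by (auto simp: image_iff)
  ultimately show ?thesis unfolding proper_cone_def using D(2) by blast
qed

lemma proj_pt_uminus_image: "proj_pt ` uminus ` K = proj_pt ` K"
  by (simp add: image_image proj_pt_uminus)

lemma cone_disjoint_uminus: assumes "proper_cone K" "x \<in> K" shows "- x \<notin> K"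
  using proper_coneD(3)[OF assms(1,2), of "-x"] zero_notin_cone[OF assms(1)] by auto

text \<open>Each cone is connected and covered by the disjoint open sets formed by the other cone
  and its negative, so it lies in one of them; comparing both inclusions gives equality.\<close>

lemma cone_lift_unique:
  assumes K: "proper_cone K" and L: "proper_cone L" and eq: "proj_pt ` K = proj_pt ` L"
  shows "L = K \<or> L = uminus ` K"
proof -
  have half: "P \<subseteq> Q \<or> P \<subseteq> uminus ` Q" if P: "proper_cone P" and Q: "proper_cone Q" and e: "proj_pt ` P = proj_pt ` Q" for P Q :: "'a set"
  proof -
    have cov: "P \<subseteq> Q \<union> uminus ` Q"
    proof
      fix x assume x: "x \<in> P"
      then have "x \<noteq> 0" "proj_pt x \<in> proj_pt ` Q" using zero_notin_cone[OF P] e by auto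
      then have "x \<in> Q \<or> - x \<in> Q" using proj_pt_in_cone_iff[OF Q] by blast
      then show "x \<in> Q \<union> uminus ` Q" by (metis UnI1 UnI2 image_eqI minus_minus)
    qed
    moreover have "Q \<inter> uminus ` Q \<inter> P = {}" using cone_disjoint_uminus[OF Q] by auto
    ultimately have "Q \<inter> P = {} \<or> uminus ` Q \<inter> P = {}"
      using connectedD[OF convex_connected[OF proper_cone_convex[OF P]] proper_coneD(1)[OF Q] proper_coneD(1)[OF proper_cone_uminus[OF Q]]]
      by blast
    then show ?thesis using cov by blast
  qed
  obtain x where x: "x \<in> L" using proper_coneD(2)[OF L] by blast
  have nL: "\<not> L \<subseteq> uminus ` L" using cone_disjoint_uminus[OF L x] x by auto
  have neg: "uminus ` A \<subseteq> uminus ` B \<longleftrightarrow> A \<subseteq> B" "uminus ` uminus ` A = A" for A B :: "'a set"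
    by (simp_all add: inj_image_subset_iff image_image)
  show ?thesis
    using half[OF L K eq[symmetric]] half[OF K L eq] nL neg by (metis order_trans subset_antisym)
qed

lemma chart_iff: assumes "f \<noteq> 0" "x \<noteq> 0" shows "proj_pt x \<in> affine_chart f \<longleftrightarrow> f \<bullet> x \<noteq> 0"
  using hyperplane_proj_pt[OF assms] unfolding affine_chart_def by auto

text \<open>The lift is the half of the full preimage of \<open>A\<close> where the chart form is
  positive, that is, the cone over the affine slice. Convexity of the slice gives closure under
  addition, boundedness gives a strict form.\<close>

lemma properly_convex_cone:
  assumes "properly_convex A" "A \<noteq> {}" obtains K where "proper_cone K" "A = proj_pt ` K"
proof -
  obtain f where f: "f \<noteq> 0" "A \<subseteq> affine_chart f" "convex (affine_coord f ` A)" "bounded (affine_coord f ` A)" and oA: "open A"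
    using assms unfolding properly_convex_def by blast
  define S where "S = affine_coord f ` A"
  define K where "K = {x. f \<bullet> x > 0 \<and> proj_pt x \<in> A}"
  have fA: "f \<bullet> x \<noteq> 0" if "x \<noteq> 0" "proj_pt x \<in> A" for x using chart_iff[OF f(1) that(1)] f(2) that by blast
  have KS: "x \<in> K \<longleftrightarrow> f \<bullet> x > 0 \<and> inverse (f \<bullet> x) *\<^sub>R x \<in> S" for x
  proof (cases "f \<bullet> x > 0")
    case True
    then have x0: "x \<noteq> 0" by auto
    have "proj_pt x \<in> A \<longleftrightarrow> inverse (f \<bullet> x) *\<^sub>R x \<in> S"
    proof
      assume "proj_pt x \<in> A"
      then show "inverse (f \<bullet> x) *\<^sub>R x \<in> S" unfolding S_def using affine_coord_proj_pt[OF x0, of f] True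
        by (metis image_eqI less_irrefl)
    next
      assume "inverse (f \<bullet> x) *\<^sub>R x \<in> S"
      then obtain p where p: "p \<in> A" "affine_coord f p = inverse (f \<bullet> x) *\<^sub>R x" unfolding S_def by auto
      obtain y where y: "y \<noteq> 0" "p = proj_pt y" by (rule proj_cases)
      have fy: "f \<bullet> y \<noteq> 0" using fA y p by blast
      have "inverse (f \<bullet> y) *\<^sub>R y = inverse (f \<bullet> x) *\<^sub>R x" using affine_coord_proj_pt[OF y(1) fy] p y by simp
      then have "proj_pt (inverse (f \<bullet> y) *\<^sub>R y) = proj_pt (inverse (f \<bullet> x) *\<^sub>R x)" by simp
      then show "proj_pt x \<in> A" using fy True p y by (simp add: proj_pt_scaleR)
    qed
    then show ?thesis unfolding K_def using True by blast
  qed (simp add: K_def)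
  have img: "A = proj_pt ` K"
  proof
    show "proj_pt ` K \<subseteq> A" unfolding K_def by auto
    show "A \<subseteq> proj_pt ` K"
    proof
      fix p assume p: "p \<in> A"
      obtain y where y: "y \<noteq> 0" "p = proj_pt y" by (rule proj_cases)
      have "f \<bullet> y \<noteq> 0" using fA y p by blast
      then consider "f \<bullet> y > 0" | "f \<bullet> (- y) > 0" by fastforce
      then show "p \<in> proj_pt ` K"
      proof cases
        case 1 then show ?thesis using y p unfolding K_def by blast
      next
        case 2
        then have "- y \<in> K" using y p unfolding K_def by (simp add: proj_pt_uminus)
        then show ?thesis using y by (metis imageI proj_pt_uminus)
      qed
    qed
  qed
  have "open K"
  proof -
    have "K = {x. x \<noteq> 0 \<and> proj_pt x \<in> A} \<inter> {x. f \<bullet> x > 0}" unfolding K_def by auto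
    then show ?thesis using oA[unfolded open_proj_iff] open_halfspace_gt open_Int by metis
  qed
  moreover have "x + y \<in> K" if x: "x \<in> K" and y: "y \<in> K" for x y
  proof -
    define a b where "a = f \<bullet> x" and "b = f \<bullet> y"
    have ab: "a > 0" "b > 0" "inverse a *\<^sub>R x \<in> S" "inverse b *\<^sub>R y \<in> S" using x y unfolding KS a_def b_def by auto
    \<comment> \<open>The normalisation of \<open>x + y\<close> is the convex combination of the
      normalised points weighted by the values \<open>a\<close> and \<open>b\<close>.\<close>
    have "(a / (a + b)) *\<^sub>R (inverse a *\<^sub>R x) + (b / (a + b)) *\<^sub>R (inverse b *\<^sub>R y) \<in> S"
      using f(3) ab unfolding S_def[symmetric] by (intro convexD) (auto simp: add_divide_distrib[symmetric])
    moreover have "(a / (a + b)) *\<^sub>R (inverse a *\<^sub>R x) + (b / (a + b)) *\<^sub>R (inverse b *\<^sub>R y) = inverse (a + b) *\<^sub>R (x + y)"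
    proof -
      have "a / (a + b) * inverse a = inverse (a + b)" "b / (a + b) * inverse b = inverse (a + b)"
        using ab by (simp_all add: divide_inverse)
      then show ?thesis by (simp only: scaleR_scaleR scaleR_add_right)
    qed
    ultimately show ?thesis unfolding KS using ab by (simp add: inner_add_right a_def b_def)
  qed
  moreover have "c *\<^sub>R x \<in> K" if "c > 0" "x \<in> K" for c x
    using that unfolding K_def by (simp add: proj_pt_scaleR)
  moreover have "strict_dual K \<noteq> {}"
  proof -
    obtain M where M: "M > 0" "\<forall>s\<in>S. norm s \<le> M" using f(4) unfolding S_def[symmetric] bounded_pos by blast
    have "(1 / M) * norm x \<le> f \<bullet> x" if "x \<in> K" for x
    proof -
      have "f \<bullet> x > 0" "norm (inverse (f \<bullet> x) *\<^sub>R x) \<le> M" using that M unfolding KS by auto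
      then show ?thesis using M by (simp add: field_simps)
    qed
    then have "f \<in> strict_dual K" unfolding strict_dual_def using M by (auto intro!: exI[of _ "1 / M"])
    then show ?thesis by blast
  qed
  moreover have "K \<noteq> {}" using img assms(2) by auto
  ultimately have "proper_cone K" unfolding proper_cone_def by blast
  then show ?thesis using that img by blast
qed

lemma affine_coord_cone:
  assumes K: "\<And>c x. c > 0 \<Longrightarrow> x \<in> K \<Longrightarrow> c *\<^sub>R x \<in> K" and f: "\<And>x. x \<in> K \<Longrightarrow> f \<bullet> x > 0"
  shows "affine_coord f ` proj_pt ` K = {x \<in> K. f \<bullet> x = 1}"
proof
  show "affine_coord f ` proj_pt ` K \<subseteq> {x \<in> K. f \<bullet> x = 1}"
  proof
    fix y assume "y \<in> affine_coord f ` proj_pt ` K"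
    then obtain x where x: "x \<in> K" "y = affine_coord f (proj_pt x)" by blast
    have fx: "f \<bullet> x > 0" using f x by blast
    then have "x \<noteq> 0" by auto
    then have "y = inverse (f \<bullet> x) *\<^sub>R x" using affine_coord_proj_pt[of x f] fx x by simp
    then show "y \<in> {x \<in> K. f \<bullet> x = 1}" using K x fx by simp
  qed
  show "{x \<in> K. f \<bullet> x = 1} \<subseteq> affine_coord f ` proj_pt ` K"
  proof
    fix x assume x: "x \<in> {x \<in> K. f \<bullet> x = 1}"
    then have "x \<noteq> 0" by auto
    then have "affine_coord f (proj_pt x) = x" using affine_coord_proj_pt[of x f] x by simp
    then show "x \<in> affine_coord f ` proj_pt ` K" using x by (metis (no_types, lifting) imageI mem_Collect_eq)
  qed
qed

text \<open>Converse of \<open>properly_convex_cone\<close>: a strict form with constant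
  \<open>e\<close> is a chart in which the slice has norm at most \<open>1 / e\<close>.\<close>

lemma properly_convex_proj_cone:
  assumes K: "proper_cone K" shows "properly_convex (proj_pt ` K)"
proof -
  note D = proper_coneD[OF K]
  obtain f where f: "f \<in> strict_dual K" using D(5) by blast
  obtain e where e: "e > 0" "\<forall>x\<in>K. e * norm x \<le> f \<bullet> x" using f unfolding strict_dual_def by blast
  have f0: "f \<noteq> 0" using strict_dual_imp_pos_dual[OF K f] unfolding pos_dual_def by blast
  have pos: "f \<bullet> x > 0" if "x \<in> K" for x by (rule pos_dual_pos[OF D(1) strict_dual_imp_pos_dual[OF K f] that])
  have "open (proj_pt ` K)"
  proof -
    have "{x. x \<noteq> 0 \<and> proj_pt x \<in> proj_pt ` K} = K \<union> uminus ` K"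
    proof (intro Set.set_eqI iffI)
      fix x assume "x \<in> {x. x \<noteq> 0 \<and> proj_pt x \<in> proj_pt ` K}"
      then have "x \<in> K \<or> - x \<in> K" using proj_pt_in_cone_iff[OF K] by blast
      then show "x \<in> K \<union> uminus ` K" by (metis UnI1 UnI2 image_eqI minus_minus)
    next
      fix x assume "x \<in> K \<union> uminus ` K"
      then have "x \<in> K \<or> - x \<in> K" by auto
      moreover from this have "x \<noteq> 0" using zero_notin_cone[OF K] by auto
      ultimately show "x \<in> {x. x \<noteq> 0 \<and> proj_pt x \<in> proj_pt ` K}" using proj_pt_in_cone_iff[OF K] by blast
    qed
    then show ?thesis unfolding open_proj_iff by (simp only: open_Un[OF D(1) open_negations[OF D(1)]])
  qed
  moreover have "proj_pt ` K \<subseteq> affine_chart f"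
  proof
    fix p assume "p \<in> proj_pt ` K"
    then obtain x where x: "x \<in> K" "p = proj_pt x" by blast
    have "f \<bullet> x \<noteq> 0" using pos[OF x(1)] by simp
    moreover from this have "x \<noteq> 0" by auto
    ultimately show "p \<in> affine_chart f" using chart_iff[OF f0] x by simp
  qed
  moreover have S: "affine_coord f ` proj_pt ` K = {x \<in> K. f \<bullet> x = 1}" by (rule affine_coord_cone[OF D(4) pos])
  moreover have "convex {x \<in> K. f \<bullet> x = 1}"
    using convex_Int[OF proper_cone_convex[OF K] convex_hyperplane[of f 1]] by (simp add: Int_def)
  moreover have "bounded {x \<in> K. f \<bullet> x = 1}"
    unfolding bounded_iff using e by (intro exI[of _ "1 / e"]) (auto simp: field_simps)
  ultimately show ?thesis unfolding properly_convex_def using f0 by metis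
qed

lemma proper_cone_sum:
  assumes K: "proper_cone K" and L: "proper_cone L" and f: "f \<in> strict_dual K" "f \<in> strict_dual L"
  shows "proper_cone (cone_sum K L)" "f \<in> strict_dual (cone_sum K L)"
proof -
  obtain d e where d: "d > 0" "\<forall>x\<in>K. d * norm x \<le> f \<bullet> x" and e: "e > 0" "\<forall>x\<in>L. e * norm x \<le> f \<bullet> x"
    using f unfolding strict_dual_def by blast
  have "min d e * norm x \<le> f \<bullet> x" if x: "x \<in> cone_sum K L" for x
  proof -
    obtain a b where ab: "a \<in> K" "b \<in> L" "x = a + b" using x unfolding cone_sum_def by blast
    have "min d e * norm x \<le> min d e * (norm a + norm b)" unfolding ab(3) using d e by (intro mult_left_mono norm_triangle_ineq) auto
    also have "\<dots> \<le> d * norm a + e * norm b" by (simp add: distrib_left add_mono mult_right_mono)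
    also have "\<dots> \<le> f \<bullet> x" using d e ab by (auto simp: inner_add_right add_mono)
    finally show ?thesis .
  qed
  then show sd: "f \<in> strict_dual (cone_sum K L)" unfolding strict_dual_def using d e by (auto intro!: exI[of _ "min d e"])
  have "cone_sum K L = (\<Union>x\<in>K. \<Union>y\<in>L. {x + y})" unfolding cone_sum_def by auto
  then have "open (cone_sum K L)" using open_sums[of K L] proper_coneD(1)[OF K] by simp
  moreover have "cone_sum K L \<noteq> {}" using proper_coneD(2)[OF K] proper_coneD(2)[OF L] unfolding cone_sum_def by blast
  ultimately show "proper_cone (cone_sum K L)" unfolding proper_cone_def
    using cone_sum_add[OF K L] cone_sum_scaleR[OF K L] sd by blast
qed

lemma cone_sum_uminus: "cone_sum (uminus ` K) (uminus ` L) = uminus ` cone_sum K L"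
proof (intro subset_antisym subsetI)
  fix x assume "x \<in> cone_sum (uminus ` K) (uminus ` L)"
  then obtain a b where "a \<in> K" "b \<in> L" "x = - a + - b" unfolding cone_sum_def by auto
  then have "a + b \<in> cone_sum K L" "x = - (a + b)" unfolding cone_sum_def by auto
  then show "x \<in> uminus ` cone_sum K L" by blast
next
  fix x assume "x \<in> uminus ` cone_sum K L"
  then obtain a b where "a \<in> K" "b \<in> L" "x = - (a + b)" unfolding cone_sum_def by blast
  then have "- a \<in> uminus ` K" "- b \<in> uminus ` L" "x = - a + - b" by auto
  then show "x \<in> cone_sum (uminus ` K) (uminus ` L)" unfolding cone_sum_def by blast
qed

lemma chart_hull_cones:
  assumes K: "proper_cone K" and L: "proper_cone L" and KL: "K \<inter> L \<noteq> {}"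
    and h: "\<And>x. x \<in> K \<Longrightarrow> h \<bullet> x > 0" "\<And>x. x \<in> L \<Longrightarrow> h \<bullet> x > 0"
  shows "chart_hull h (proj_pt ` K \<union> proj_pt ` L) = proj_pt ` cone_sum K L"
proof -
  let ?C = "cone_sum K L"
  have h0: "h \<noteq> 0" using h proper_coneD(2)[OF K] by force
  have hC: "h \<bullet> x > 0" if "x \<in> ?C" for x using that h unfolding cone_sum_def by (auto simp: inner_add_right add_pos_pos)
  define T where "T = {x \<in> K. h \<bullet> x = 1} \<union> {x \<in> L. h \<bullet> x = 1}"
  have img: "affine_coord h ` (proj_pt ` K \<union> proj_pt ` L) = T"
    unfolding image_Un T_def using affine_coord_cone[of K h] affine_coord_cone[of L h] h proper_coneD(4)[OF K] proper_coneD(4)[OF L] by simp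
  have cC: "convex ?C" unfolding convex_alt
  proof (intro ballI allI impI)
    fix x y and u :: real
    assume xy: "x \<in> ?C" "y \<in> ?C" and u: "0 \<le> u \<and> u \<le> 1"
    show "(1 - u) *\<^sub>R x + u *\<^sub>R y \<in> ?C"
    proof (cases "u = 0 \<or> u = 1")
      case True then show ?thesis using xy by auto
    next
      case False then show ?thesis
        using u xy by (intro cone_sum_add[OF K L] cone_sum_scaleR[OF K L]) auto
    qed
  qed
  have hull: "convex hull T = {x \<in> ?C. h \<bullet> x = 1}"
  proof
    have "convex {x \<in> ?C. h \<bullet> x = 1}" using convex_Int[OF cC convex_hyperplane[of h 1]] by (simp add: Int_def)
    moreover have "T \<subseteq> {x \<in> ?C. h \<bullet> x = 1}" unfolding T_def using subset_cone_sum[OF K L KL] by blast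
    ultimately show "convex hull T \<subseteq> {x \<in> ?C. h \<bullet> x = 1}" by (rule hull_minimal[rotated])
    show "{x \<in> ?C. h \<bullet> x = 1} \<subseteq> convex hull T"
    proof
      fix x assume "x \<in> {x \<in> ?C. h \<bullet> x = 1}"
      then obtain a b where ab: "a \<in> K" "b \<in> L" "x = a + b" "h \<bullet> a + h \<bullet> b = 1"
        unfolding cone_sum_def by (auto simp: inner_add_right)
      have p: "h \<bullet> a > 0" "h \<bullet> b > 0" using h ab by auto
      have "inverse (h \<bullet> a) *\<^sub>R a \<in> T" "inverse (h \<bullet> b) *\<^sub>R b \<in> T" unfolding T_def
        using proper_coneD(4)[OF K _ ab(1)] proper_coneD(4)[OF L _ ab(2)] p by auto
      \<comment> \<open>The point \<open>a + b\<close> of the slice is a convex combination of the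
        normalised \<open>a\<close> and \<open>b\<close>, with weights their values under
        \<open>h\<close>.\<close>
      then have "(h \<bullet> a) *\<^sub>R (inverse (h \<bullet> a) *\<^sub>R a) + (h \<bullet> b) *\<^sub>R (inverse (h \<bullet> b) *\<^sub>R b) \<in> convex hull T"
        using p ab(4) by (intro convexD[OF convex_convex_hull] hull_inc) auto
      then show "x \<in> convex hull T" using p ab by simp
    qed
  qed
  show ?thesis
  proof (intro Set.set_eqI iffI)
    fix p assume "p \<in> chart_hull h (proj_pt ` K \<union> proj_pt ` L)"
    then have p: "p \<in> affine_chart h" "affine_coord h p \<in> {x \<in> ?C. h \<bullet> x = 1}" unfolding chart_hull_def img hull by auto
    obtain x where x: "x \<noteq> 0" "p = proj_pt x" by (rule proj_cases)
    have "h \<bullet> x \<noteq> 0" using chart_iff[OF h0 x(1)] p x by simp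
    then have "affine_coord h p = inverse (h \<bullet> x) *\<^sub>R x" "proj_pt (inverse (h \<bullet> x) *\<^sub>R x) = p"
      using affine_coord_proj_pt[OF x(1)] x by (simp_all add: proj_pt_scaleR)
    then show "p \<in> proj_pt ` ?C" using p by (metis (no_types, lifting) imageI mem_Collect_eq)
  next
    fix p assume "p \<in> proj_pt ` ?C"
    then obtain x where x: "x \<in> ?C" "p = proj_pt x" by blast
    have hx: "h \<bullet> x > 0" using hC x by blast
    then have x0: "x \<noteq> 0" by auto
    have "affine_coord h p = inverse (h \<bullet> x) *\<^sub>R x" using affine_coord_proj_pt[OF x0] hx x by simp
    then have "affine_coord h p \<in> {x \<in> ?C. h \<bullet> x = 1}" using cone_sum_scaleR[OF K L x(1)] hx by simp
    moreover have "p \<in> affine_chart h" using chart_iff[OF h0 x0] hx x by simp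
    ultimately show "p \<in> chart_hull h (proj_pt ` K \<union> proj_pt ` L)" unfolding chart_hull_def img hull by blast
  qed
qed

lemma nonvanishing_on_cone:
  assumes K: "proper_cone K" and h: "\<And>x. x \<in> K \<Longrightarrow> h \<bullet> x \<noteq> 0"
  shows "(\<forall>x\<in>K. h \<bullet> x > 0) \<or> (\<forall>x\<in>K. h \<bullet> x < 0)"
proof -
  have "{x. h \<bullet> x > 0} \<inter> K = {} \<or> {x. h \<bullet> x < 0} \<inter> K = {}"
  proof (rule connectedD[OF convex_connected[OF proper_cone_convex[OF K]]])
    show "K \<subseteq> {x. h \<bullet> x > 0} \<union> {x. h \<bullet> x < 0}" using h by (force simp: linorder_neq_iff)
  qed (auto intro: open_halfspace_gt open_halfspace_lt)
  then show ?thesis using h by (force simp: linorder_neq_iff)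
qed

text \<open>A chart form of any chart containing both sets has constant sign on each cone, and the
  same sign on both because they meet. Replacing both cones by their negatives if necessary, every
  chart yields the same sum, so the hull does not depend on the chart.\<close>

lemma proj_hull_cones:
  assumes K: "proper_cone K" and L: "proper_cone L" and KL: "K \<inter> L \<noteq> {}"
    and f: "f \<in> strict_dual K" "f \<in> strict_dual L"
  shows "proj_hull_well_defined (proj_pt ` K \<union> proj_pt ` L)"
    "proj_hull (proj_pt ` K \<union> proj_pt ` L) = proj_pt ` cone_sum K L"
proof -
  let ?X = "proj_pt ` K \<union> proj_pt ` L"
  have eq: "chart_hull h ?X = proj_pt ` cone_sum K L" if h: "h \<noteq> 0" "?X \<subseteq> affine_chart h" for h
  proof -
    have nz: "h \<bullet> x \<noteq> 0" if x: "x \<in> K \<union> L" for x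
    proof -
      have "x \<noteq> 0" using x zero_notin_cone[OF K] zero_notin_cone[OF L] by blast
      then show ?thesis using chart_iff[OF h(1)] h(2) x by blast
    qed
    obtain q where q: "q \<in> K" "q \<in> L" using KL by blast
    have "(\<forall>x\<in>K \<union> L. h \<bullet> x > 0) \<or> (\<forall>x\<in>K \<union> L. h \<bullet> x < 0)"
      using nonvanishing_on_cone[OF K, of h] nonvanishing_on_cone[OF L, of h] nz q
      by (metis UnE UnI1 UnI2 order_less_asym')
    then show ?thesis
    proof
      assume "\<forall>x\<in>K \<union> L. h \<bullet> x > 0"
      then show ?thesis by (intro chart_hull_cones[OF K L KL]) auto
    next
      assume n: "\<forall>x\<in>K \<union> L. h \<bullet> x < 0"
      have "uminus ` K \<inter> uminus ` L \<noteq> {}" using q by blast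
      then have "chart_hull h (proj_pt ` uminus ` K \<union> proj_pt ` uminus ` L) = proj_pt ` cone_sum (uminus ` K) (uminus ` L)"
        using n by (intro chart_hull_cones proper_cone_uminus K L) auto
      then show ?thesis unfolding cone_sum_uminus proj_pt_uminus_image .
    qed
  qed
  have f0: "f \<noteq> 0" using strict_dual_imp_pos_dual[OF K f(1)] unfolding pos_dual_def by blast
  have fp: "f \<bullet> x > 0" if "x \<in> K \<union> L" for x
    using pos_dual_pos[OF proper_coneD(1)[OF K] strict_dual_imp_pos_dual[OF K f(1)]]
      pos_dual_pos[OF proper_coneD(1)[OF L] strict_dual_imp_pos_dual[OF L f(2)]] that by blast
  have ex: "?X \<subseteq> affine_chart f"
  proof
    fix p assume "p \<in> ?X"
    then obtain x where x: "x \<in> K \<union> L" "p = proj_pt x" by blast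
    have "f \<bullet> x \<noteq> 0" using fp[OF x(1)] by simp
    moreover from this have "x \<noteq> 0" by auto
    ultimately show "p \<in> affine_chart f" using chart_iff[OF f0] x by simp
  qed
  have con: "connected (proj_pt ` C)" if C: "proper_cone C" for C :: "'a set"
  proof (rule connected_continuous_image)
    show "continuous_on C proj_pt" using continuous_proj_pt by (rule continuous_on_subset) (use zero_notin_cone[OF C] in auto)
    show "connected C" by (rule convex_connected[OF proper_cone_convex[OF C]])
  qed
  have "connected ?X" using con[OF K] con[OF L] KL by (intro connected_Un) auto
  then show "proj_hull_well_defined ?X" unfolding proj_hull_well_defined_def using eq ex f0 by auto
  have "(SOME f. f \<noteq> 0 \<and> ?X \<subseteq> affine_chart f) \<noteq> 0 \<and> ?X \<subseteq> affine_chart (SOME f. f \<noteq> 0 \<and> ?X \<subseteq> affine_chart f)"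
    using someI[of "\<lambda>f. f \<noteq> 0 \<and> ?X \<subseteq> affine_chart f" f] ex f0 by blast
  then show "proj_hull ?X = proj_pt ` cone_sum K L" unfolding proj_hull_def using eq by blast
qed

section \<open>Occultation in projective space\<close>

lemma not_in_closure_projE:
  assumes "proj_pt x \<notin> closure A" "x \<noteq> 0"
  obtains V where "open V" "x \<in> V" "\<And>y. y \<in> V \<Longrightarrow> y \<noteq> 0 \<and> proj_pt y \<notin> A"
proof -
  have "open (- closure A)" by (intro open_Compl closed_closure)
  then have "open {y. y \<noteq> 0 \<and> proj_pt y \<in> - closure A}" unfolding open_proj_iff .
  moreover have "x \<in> {y. y \<noteq> 0 \<and> proj_pt y \<in> - closure A}" using assms by simp
  moreover have "A \<subseteq> closure A" by (rule closure_subset)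
  ultimately show ?thesis using that by blast
qed

text \<open>A hyperplane missing the closure corresponds to a form without nonzero zeros on
  \<open>closure K\<close>; connectedness fixes its sign, compactness makes the positivity uniform.
  The sign remains free, as a hyperplane determines its form only up to scalars.\<close>

lemma proj_dual_cone_iff:
  assumes K: "proper_cone K" and f: "f \<noteq> 0"
  shows "proj_pt f \<in> proj_dual (proj_pt ` K) \<longleftrightarrow> f \<in> strict_dual K \<or> - f \<in> strict_dual K"
proof
  assume d: "proj_pt f \<in> proj_dual (proj_pt ` K)"
  have nz: "f \<bullet> x \<noteq> 0" if x: "x \<in> closure K" "x \<noteq> 0" for x
  proof -
    have "proj_pt x \<in> closure (proj_pt ` K)"
    proof (rule ccontr)
      assume "\<not> ?thesis"
      then obtain V where V: "open V" "x \<in> V" "\<And>y. y \<in> V \<Longrightarrow> y \<noteq> 0 \<and> proj_pt y \<notin> proj_pt ` K"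
        using not_in_closure_projE[OF _ x(2)] by metis
      then have "V \<inter> K = {}" by blast
      then have "V \<inter> closure K = {}" using open_Int_closure_eq_empty[OF V(1)] by blast
      then show False using x V by blast
    qed
    then have "proj_pt x \<notin> hyperplane (proj_pt f)" using d unfolding proj_dual_def by blast
    then show ?thesis using hyperplane_proj_pt[OF f x(2)] by blast
  qed
  have str: "h \<in> strict_dual K" if h: "\<And>x. x \<in> K \<Longrightarrow> h \<bullet> x > 0" and n: "\<And>x. x \<in> closure K \<Longrightarrow> x \<noteq> 0 \<Longrightarrow> h \<bullet> x \<noteq> 0" for h
  proof (rule ccontr)
    assume "h \<notin> strict_dual K"
    then obtain a where a: "a \<in> closure K" "a \<noteq> 0" "h \<bullet> a \<le> 0" by (rule not_strict_dualE[OF K])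
    have "closure K \<subseteq> {x. h \<bullet> x \<ge> 0}" using h by (intro closure_minimal closed_halfspace_ge) (auto simp: order_less_imp_le)
    then have "h \<bullet> a = 0" using a by auto
    then show False using n a by blast
  qed
  have "f \<bullet> x \<noteq> 0" if "x \<in> K" for x using nz that closure_subset[of K] zero_notin_cone[OF K] by blast
  from nonvanishing_on_cone[OF K this] show "f \<in> strict_dual K \<or> - f \<in> strict_dual K"
  proof
    assume "\<forall>x\<in>K. f \<bullet> x > 0"
    then show ?thesis using str[of f] nz by blast
  next
    assume "\<forall>x\<in>K. f \<bullet> x < 0"
    then have "- f \<in> strict_dual K" using nz by (intro str) auto
    then show ?thesis ..
  qed
next
  assume a: "f \<in> strict_dual K \<or> - f \<in> strict_dual K"
  obtain e where e: "e > 0" "\<forall>x\<in>K. e * norm x \<le> \<bar>f \<bullet> x\<bar>"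
  proof -
    from a consider e where "e > 0" "\<forall>x\<in>K. e * norm x \<le> f \<bullet> x" | e where "e > 0" "\<forall>x\<in>K. e * norm x \<le> (- f) \<bullet> x"
      unfolding strict_dual_def by blast
    then show ?thesis
      by cases (use that in \<open>fastforce\<close>)+
  qed
  show "proj_pt f \<in> proj_dual (proj_pt ` K)" unfolding proj_dual_def
  proof (intro CollectI equals0I)
    fix p assume p: "p \<in> hyperplane (proj_pt f) \<inter> closure (proj_pt ` K)"
    obtain x where x: "x \<noteq> 0" "p = proj_pt x" by (rule proj_cases)
    have fx: "f \<bullet> x = 0" using p hyperplane_proj_pt[OF f x(1)] x by blast
    \<comment> \<open>\<open>W\<close> is an open, scaling-invariant neighbourhood of the nonzero
      zeros of \<open>f\<close>, disjoint from \<open>K\<close> by the uniform bound; its image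
      separates \<open>p\<close> from the closure.\<close>
    define W where "W = {y. \<bar>f \<bullet> y\<bar> < e * norm y}"
    have Wsc: "c *\<^sub>R y \<in> W \<longleftrightarrow> y \<in> W" if "c \<noteq> 0" for c y
    proof -
      have "\<bar>f \<bullet> (c *\<^sub>R y)\<bar> = \<bar>c\<bar> * \<bar>f \<bullet> y\<bar>" "e * norm (c *\<^sub>R y) = \<bar>c\<bar> * (e * norm y)" by (simp_all add: abs_mult)
      then show ?thesis unfolding W_def using that by simp
    qed
    have W0: "0 \<notin> W" unfolding W_def by simp
    have "{y. y \<noteq> 0 \<and> proj_pt y \<in> proj_pt ` W} = W"
    proof (intro Set.set_eqI iffI)
      fix y assume "y \<in> {y. y \<noteq> 0 \<and> proj_pt y \<in> proj_pt ` W}"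
      then obtain w where w: "w \<in> W" "proj_pt w = proj_pt y" "y \<noteq> 0" by auto
      then obtain c where "c \<noteq> 0" "y = c *\<^sub>R w" using proj_pt_eqE[OF w(2) _ w(3)] W0 by metis
      then show "y \<in> W" using Wsc w by simp
    qed (use W0 in auto)
    moreover have "open W" unfolding W_def by (intro open_Collect_less continuous_intros)
    ultimately have oW: "open (proj_pt ` W)" unfolding open_proj_iff by simp
    have "proj_pt ` W \<inter> proj_pt ` K = {}"
    proof (rule equals0I)
      fix r assume "r \<in> proj_pt ` W \<inter> proj_pt ` K"
      then obtain w k where wk: "w \<in> W" "k \<in> K" "proj_pt w = proj_pt k" by force
      then obtain c where "c \<noteq> 0" "k = c *\<^sub>R w" using proj_pt_eqE[OF wk(3)] W0 zero_notin_cone[OF K] by metis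
      then have "k \<in> W" using Wsc wk by simp
      then show False using e wk unfolding W_def by force
    qed
    then have "proj_pt ` W \<inter> closure (proj_pt ` K) = {}" using open_Int_closure_eq_empty[OF oW] by blast
    moreover have "x \<in> W" unfolding W_def using fx x e by simp
    ultimately show False using p x by blast
  qed
qed

text \<open>Adding a small multiple of a strict form moves \<open>f\<close> into the dual
  itself.\<close>

lemma pos_dual_in_closure:
  assumes K: "proper_cone K" and f: "f \<in> pos_dual K"
  shows "proj_pt f \<in> closure (proj_dual (proj_pt ` K))"
proof (rule ccontr)
  assume n: "\<not> ?thesis"
  have f0: "f \<noteq> 0" using f unfolding pos_dual_def by blast
  obtain V where V: "open V" "f \<in> V" "\<And>y. y \<in> V \<Longrightarrow> y \<noteq> 0 \<and> proj_pt y \<notin> proj_dual (proj_pt ` K)"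
    using not_in_closure_projE[OF n f0] by metis
  obtain h where h: "h \<in> strict_dual K" using proper_coneD(5)[OF K] by blast
  obtain d where d: "d > 0" "f + d *\<^sub>R h \<in> V" using open_coneE[OF V(1,2)] .
  have "f + d *\<^sub>R h \<in> strict_dual K" using strict_dual_add_pos_dual[OF strict_dual_scaleR[OF d(1) h] f] .
  then show False using V(3)[OF d(2)] proj_dual_cone_iff[OF K] by blast
qed

text \<open>Occultation position restated through lifts of matching signs. Quantifying over the
  lifts keeps the notion projective, hence invariant under \<open>PGL\<close>.\<close>

definition proj_occults :: "'a::euclidean_space proj set \<Rightarrow> 'a proj set \<Rightarrow> 'a proj set \<Rightarrow> bool" where
  "proj_occults A B C \<longleftrightarrow> (\<exists>K L M. proper_cone K \<and> proper_cone L \<and> proper_cone M \<and>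
     A = proj_pt ` K \<and> B = proj_pt ` L \<and> C = proj_pt ` M \<and> K \<inter> L \<noteq> {} \<and> L \<inter> M \<noteq> {} \<and>
     occults K L M \<and> \<not> K \<subseteq> L \<and> \<not> M \<subseteq> L \<and> A \<inter> C = {})"

text \<open>The common strict form means that both closures lie in one affine chart; it is what
  makes the hull of the union well defined.\<close>

definition proj_adjacent :: "'a::euclidean_space proj set \<Rightarrow> 'a proj set \<Rightarrow> bool" where
  "proj_adjacent A B \<longleftrightarrow> (\<exists>K L. proper_cone K \<and> proper_cone L \<and> A = proj_pt ` K \<and> B = proj_pt ` L \<and>
     K \<inter> L \<noteq> {} \<and> strict_dual K \<inter> strict_dual L \<noteq> {})"

lemma proj_adjacent_sym: "proj_adjacent A B \<Longrightarrow> proj_adjacent B A"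
  unfolding proj_adjacent_def by (metis Int_commute)

lemma proj_occults_sym: "proj_occults A B C \<Longrightarrow> proj_occults C B A"
  unfolding proj_occults_def by (metis Int_commute occults_sym)

lemma meeting_cone:
  assumes K: "proper_cone K" and L: "proper_cone L" and KL: "proj_pt ` K \<inter> proj_pt ` L \<noteq> {}"
  obtains K' where "proper_cone K'" "proj_pt ` K' = proj_pt ` K" "K' \<inter> L \<noteq> {}"
proof -
  obtain p where p: "p \<in> proj_pt ` K" "p \<in> proj_pt ` L" using KL by blast
  from p(2) obtain l where l: "l \<in> L" "p = proj_pt l" by (rule imageE)
  have l: "l \<in> L" "proj_pt l \<in> proj_pt ` K" using l p by simp_all
  then have "l \<in> K \<or> - l \<in> K" using proj_pt_in_cone_iff[OF K, of l] zero_notin_cone[OF L] by metis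
  then have "l \<in> K \<or> l \<in> uminus ` K" by (metis image_eqI minus_minus)
  then show ?thesis
  proof
    assume "l \<in> K" then show ?thesis using that[OF K refl] l by blast
  next
    assume "l \<in> uminus ` K"
    then show ?thesis using that[OF proper_cone_uminus[OF K] proj_pt_uminus_image] l by blast
  qed
qed

text \<open>The outer lifts are chosen to meet the lift \<open>L\<close> of \<open>B\<close>. A form
  nonnegative on \<open>L\<close> is positive at the meeting point, so when it is strict on an outer
  lift up to sign, the sign is the right one.\<close>

lemma occultation_position_occults:
  assumes occ: "occultation_position A B C"
    and pc: "properly_convex A" "properly_convex B" "properly_convex C"
  shows "proj_occults A B C"
proof -
  have o: "\<not> A \<subseteq> B" "\<not> C \<subseteq> B" "A \<inter> B \<noteq> {}" "B \<inter> C \<noteq> {}" "A \<inter> C = {}"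
    "closure (proj_dual B) \<subseteq> proj_dual A \<union> proj_dual C"
    using occ unfolding occultation_position_def by auto
  obtain K0 where K0: "proper_cone K0" "A = proj_pt ` K0" using properly_convex_cone[OF pc(1)] o by blast
  obtain L where L: "proper_cone L" "B = proj_pt ` L" using properly_convex_cone[OF pc(2)] o by blast
  obtain M0 where M0: "proper_cone M0" "C = proj_pt ` M0" using properly_convex_cone[OF pc(3)] o by blast
  obtain K where K: "proper_cone K" "A = proj_pt ` K" "K \<inter> L \<noteq> {}"
    using meeting_cone[OF K0(1) L(1)] o K0 L by metis
  obtain M where M: "proper_cone M" "C = proj_pt ` M" "M \<inter> L \<noteq> {}"
    using meeting_cone[OF M0(1) L(1)] o M0 L by (metis Int_commute)
  have sgn: "f \<in> strict_dual P" if f: "f \<in> pos_dual L" and d: "proj_pt f \<in> proj_dual (proj_pt ` P)"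
      and P: "proper_cone P" "P \<inter> L \<noteq> {}" for f P
  proof -
    have f0: "f \<noteq> 0" using f unfolding pos_dual_def by blast
    have "- f \<notin> strict_dual P"
    proof
      assume "- f \<in> strict_dual P"
      then have n: "- f \<in> pos_dual P" by (rule strict_dual_imp_pos_dual[OF P(1)])
      obtain x where x: "x \<in> P" "x \<in> L" using P(2) by blast
      show False using pos_dual_pos[OF proper_coneD(1)[OF P(1)] n x(1)] pos_dual_pos[OF proper_coneD(1)[OF L(1)] f x(2)] by simp
    qed
    then show ?thesis using d proj_dual_cone_iff[OF P(1) f0] by blast
  qed
  have "occults K L M" unfolding occults_def
  proof
    fix f assume f: "f \<in> pos_dual L"
    have "proj_pt f \<in> proj_dual A \<union> proj_dual C" using pos_dual_in_closure[OF L(1) f] o(6) L(2) by blast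
    then show "f \<in> strict_dual K \<union> strict_dual M" using sgn[OF f _ K(1,3)] sgn[OF f _ M(1,3)] K(2) M(2) by blast
  qed
  moreover have "\<not> K \<subseteq> L" "\<not> M \<subseteq> L" using o K L M by blast+
  ultimately show ?thesis unfolding proj_occults_def using K L M o(5) by blast
qed

text \<open>As \<open>M\<close> is not contained in \<open>L\<close>, some form strict on
  \<open>L\<close> is negative at a point of \<open>M\<close>. It is not strict on \<open>M\<close>,
  so occultation makes it strict on \<open>K\<close>: it is common to \<open>K\<close> and
  \<open>L\<close>.\<close>

lemma proj_occults_adjacent: assumes "proj_occults A B C" shows "proj_adjacent A B" "proj_adjacent B C"
proof -
  have 1: "proj_adjacent A B" if "proj_occults A B C" for A B C :: "'a proj set"
  proof -
    from that obtain K L M where K: "proper_cone K" "proper_cone L" "proper_cone M" "A = proj_pt ` K" "B = proj_pt ` L"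
      "K \<inter> L \<noteq> {}" "occults K L M" "\<not> M \<subseteq> L" unfolding proj_occults_def by blast
    obtain c where c: "c \<in> M" "{g \<in> strict_dual L. g \<bullet> c < 0} \<noteq> {}" by (rule exists_strict_dual_neg[OF K(3,2,8)])
    then obtain g where g: "g \<in> strict_dual L" "g \<bullet> c < 0" by blast
    have "g \<notin> strict_dual M"
      using pos_dual_pos[OF proper_coneD(1)[OF K(3)] strict_dual_imp_pos_dual[OF K(3)] c(1)] g(2) by force
    then have "g \<in> strict_dual K" using K(7) strict_dual_imp_pos_dual[OF K(2) g(1)] unfolding occults_def by blast
    then show ?thesis unfolding proj_adjacent_def using K g by blast
  qed
  show "proj_adjacent A B" by (rule 1[OF assms])
  show "proj_adjacent B C" by (rule proj_adjacent_sym[OF 1[OF proj_occults_sym[OF assms]]])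
qed

section \<open>Independence of the chosen lifts\<close>

lemma dual_uminus: "strict_dual (uminus ` K) = uminus ` strict_dual K" "pos_dual (uminus ` K) = uminus ` pos_dual K"
proof -
  have "f \<in> strict_dual (uminus ` K) \<longleftrightarrow> - f \<in> strict_dual K" "f \<in> pos_dual (uminus ` K) \<longleftrightarrow> - f \<in> pos_dual K" for f
    unfolding strict_dual_def pos_dual_def by auto
  then show "strict_dual (uminus ` K) = uminus ` strict_dual K" "pos_dual (uminus ` K) = uminus ` pos_dual K"
    by (auto simp: image_iff) (metis minus_minus)+
qed

lemma occults_uminus: "occults (uminus ` K) (uminus ` L) (uminus ` M) \<longleftrightarrow> occults K L M"
  unfolding occults_def dual_uminus image_Un[symmetric] by (simp add: inj_image_subset_iff)

text \<open>A form strict on \<open>K\<close> and \<open>L\<close> is positive on \<open>L\<close>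
  and negative on \<open>- K\<close>, so the opposite lift cannot meet \<open>L\<close>.\<close>

lemma meeting_cone_unique:
  assumes K: "proper_cone K" "proper_cone K'" "proj_pt ` K = proj_pt ` K'" "K \<inter> L \<noteq> {}" "K' \<inter> L \<noteq> {}"
    and L: "proper_cone L" and d: "strict_dual K \<inter> strict_dual L \<noteq> {}"
  shows "K' = K"
proof (rule ccontr)
  assume "K' \<noteq> K"
  then have e: "K' = uminus ` K" using cone_lift_unique[OF K(1-3)] by blast
  obtain f where f: "f \<in> strict_dual K" "f \<in> strict_dual L" using d by blast
  obtain x where x: "x \<in> K'" "x \<in> L" using K by blast
  have "- x \<in> K" using x e by auto
  then have "f \<bullet> (- x) > 0" using pos_dual_pos[OF proper_coneD(1)[OF K(1)] strict_dual_imp_pos_dual[OF K(1) f(1)]] by blast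
  moreover have "f \<bullet> x > 0" using pos_dual_pos[OF proper_coneD(1)[OF L(1)] strict_dual_imp_pos_dual[OF L(1) f(2)] x(2)] .
  ultimately show False by simp
qed

lemma proj_adjacent_cones:
  assumes "proj_adjacent (proj_pt ` K) (proj_pt ` L)" and K: "proper_cone K" and L: "proper_cone L" and KL: "K \<inter> L \<noteq> {}"
  shows "strict_dual K \<inter> strict_dual L \<noteq> {}"
proof -
  obtain K' L' where k: "proper_cone K'" "proper_cone L'" "proj_pt ` K' = proj_pt ` K" "proj_pt ` L' = proj_pt ` L"
    "K' \<inter> L' \<noteq> {}" "strict_dual K' \<inter> strict_dual L' \<noteq> {}"
    using assms(1) unfolding proj_adjacent_def by metis
  show ?thesis
  proof (cases "L = L'")
    case True
    then have "K = K'" using meeting_cone_unique[OF k(1) K k(3,5) _ k(2,6)] KL by blast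
    then show ?thesis using True k by simp
  next
    case False
    then have e: "L = uminus ` L'" using cone_lift_unique[OF k(2) L k(4)] by blast
    have "uminus ` K \<inter> L' \<noteq> {}" using KL e by fastforce
    then have "uminus ` K = K'"
      using meeting_cone_unique[OF k(1) proper_cone_uminus[OF K] _ k(5) _ k(2,6)] k(3) proj_pt_uminus_image by metis
    then have "uminus ` uminus ` K = uminus ` K'" by simp
    then have e': "K = uminus ` K'" by (simp only: image_image minus_minus image_ident)
    obtain f where f: "f \<in> strict_dual K'" "f \<in> strict_dual L'" using k(6) by blast
    have "- f \<in> strict_dual K" unfolding e' dual_uminus using f(1) by (rule imageI)
    moreover have "- f \<in> strict_dual L" unfolding e dual_uminus using f(2) by (rule imageI)
    ultimately show ?thesis by blast
  qed
qed

text \<open>The lifts hidden in \<open>proj_occults\<close> agree with the given ones up to one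
  common sign: the sign of the middle cone decides those of its neighbours, which meet it.\<close>

lemma proj_occults_cones:
  assumes occ: "proj_occults (proj_pt ` K) (proj_pt ` L) (proj_pt ` M)"
    and K: "proper_cone K" and L: "proper_cone L" and M: "proper_cone M" and KL: "K \<inter> L \<noteq> {}" "L \<inter> M \<noteq> {}"
  shows "occults K L M" "\<not> K \<subseteq> L" "\<not> M \<subseteq> L"
proof -
  obtain K' L' M' where k: "proper_cone K'" "proper_cone L'" "proper_cone M'" "proj_pt ` K = proj_pt ` K'"
    "proj_pt ` L = proj_pt ` L'" "proj_pt ` M = proj_pt ` M'" "K' \<inter> L' \<noteq> {}" "L' \<inter> M' \<noteq> {}"
    "occults K' L' M'" "\<not> K' \<subseteq> L'" "\<not> M' \<subseteq> L'"
    using occ unfolding proj_occults_def by metis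
  have dKL: "strict_dual K \<inter> strict_dual L \<noteq> {}" "strict_dual M \<inter> strict_dual L \<noteq> {}"
    using proj_adjacent_cones[OF proj_occults_adjacent(1)[OF occ] K L KL(1)]
      proj_adjacent_cones[OF proj_occults_adjacent(2)[OF occ] L M KL(2)] by blast+
  note uniq = meeting_cone_unique[OF K _ _ KL(1) _ L dKL(1)] meeting_cone_unique[OF M _ _ _ _ L dKL(2)]
  have meet: "M \<inter> L \<noteq> {}" "M' \<inter> L' \<noteq> {}" using KL k by blast+
  have "(K' = K \<and> L' = L \<and> M' = M) \<or> (K' = uminus ` K \<and> L' = uminus ` L \<and> M' = uminus ` M)"
  proof (cases "L' = L")
    case True
    then have "K' = K" using uniq(1)[OF k(1,4)] k(7) by blast
    moreover have "M' = M" using uniq(2)[OF k(3,6) meet(1)] meet(2) True by blast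
    ultimately show ?thesis using True by blast
  next
    case False
    then have e: "L' = uminus ` L" using cone_lift_unique[OF L k(2,5)] by blast
    have i: "uminus ` K' \<inter> L \<noteq> {}" "uminus ` M' \<inter> L \<noteq> {}" using k(7) meet(2) e by fastforce+
    have "uminus ` K' = K"
      using uniq(1)[OF proper_cone_uminus[OF k(1)] _ i(1)] k(4) proj_pt_uminus_image by metis
    moreover have "uminus ` M' = M"
      using uniq(2)[OF proper_cone_uminus[OF k(3)] _ meet(1) i(2)] k(6) proj_pt_uminus_image by metis
    moreover have "A = uminus ` B" if "uminus ` A = B" for A B :: "'a set"
      using arg_cong[OF that, of "image uminus"] by (simp only: image_image minus_minus image_ident)
    ultimately show ?thesis using e by blast
  qed
  then show "occults K L M" "\<not> K \<subseteq> L" "\<not> M \<subseteq> L"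
    using k(9-11) occults_uminus[of K L M] by (auto simp: inj_image_subset_iff)
qed

section \<open>The projective linear group\<close>

abbreviation (input) pgl :: "real^'n^'n \<Rightarrow> (real^'n^'n) set" where
  "pgl M \<equiv> scalar_matrices #>\<^bsub>GL\<^esub> M"

lemma PGL_rep:
  assumes "a \<in> carrier PGL" obtains M where "invertible M" "a = pgl M"
  using assms unfolding carrier_PGL RCOSETS_def carrier_GL by blast

lemma coset_in_PGL: "invertible M \<Longrightarrow> pgl M \<in> carrier PGL"
  unfolding carrier_PGL RCOSETS_def carrier_GL by blast

lemma PGL_mult_cosets:
  assumes "invertible M" "invertible N"
  shows "(pgl M) \<otimes>\<^bsub>PGL\<^esub> (pgl N) = pgl (M ** N)"
  using normal.rcos_sum[OF normal_scalar_matrices, of M N] assms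
  by (simp add: PGL_def FactGroup_def carrier_GL mult_GL)

lemma PGL_one: "\<one>\<^bsub>PGL\<^esub> = pgl (mat 1)"
proof -
  interpret normal scalar_matrices GL by (rule normal_scalar_matrices)
  show ?thesis using coset_mult_one[OF subset, symmetric] by (simp add: PGL_def FactGroup_def one_GL)
qed

lemma pgl_act_mult:
  assumes "a \<in> carrier PGL" "b \<in> carrier PGL"
  shows "pgl_act (a \<otimes>\<^bsub>PGL\<^esub> b) p = pgl_act a (pgl_act b p)"
proof -
  obtain M where M: "invertible M" "a = pgl M" using PGL_rep[OF assms(1)] .
  obtain N where N: "invertible N" "b = pgl N" using PGL_rep[OF assms(2)] .
  obtain x where x: "x \<noteq> 0" "p = proj_pt x" by (rule proj_cases)
  have "N *v x \<noteq> 0"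
    using N(1) x(1) matrix_left_invertible_ker[of N] unfolding invertible_def by blast
  then show ?thesis unfolding M(2) N(2) x(2) PGL_mult_cosets[OF M(1) N(1)]
    using pgl_act_proj_pt[OF invertible_mult[OF M(1) N(1)] x(1)] pgl_act_proj_pt[OF N(1) x(1)] pgl_act_proj_pt[OF M(1), of "N *v x"]
    by (simp add: matrix_vector_mul_assoc)
qed

lemma pgl_act_one: "pgl_act \<one>\<^bsub>PGL\<^esub> p = p"
proof -
  obtain x where x: "x \<noteq> 0" "p = proj_pt x" by (rule proj_cases)
  have "invertible (mat 1 :: real^'a^'a)" by (auto simp: invertible_def intro: exI[of _ "mat 1"])
  from pgl_act_proj_pt[OF this x(1)] show ?thesis unfolding PGL_one x(2) by simp
qed

lemma pgl_act_image_mult: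
  "a \<in> carrier PGL \<Longrightarrow> b \<in> carrier PGL \<Longrightarrow> pgl_act (a \<otimes>\<^bsub>PGL\<^esub> b) ` X = pgl_act a ` pgl_act b ` X"
  unfolding image_image using pgl_act_mult by (intro image_cong) auto

lemma pgl_act_inv_left: "a \<in> carrier PGL \<Longrightarrow> pgl_act (inv\<^bsub>PGL\<^esub> a) (pgl_act a p) = p"
  using pgl_act_mult[of "inv\<^bsub>PGL\<^esub> a" a p] group.l_inv[OF group_PGL] group.inv_closed[OF group_PGL] pgl_act_one by metis

lemma inj_pgl_act: "a \<in> carrier PGL \<Longrightarrow> inj (pgl_act a)"
  using pgl_act_inv_left by (metis injI)

lemma pgl_act_cone:
  assumes "invertible M" "0 \<notin> K"
  shows "pgl_act (pgl M) ` proj_pt ` K = proj_pt ` (*v) M ` K"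
  unfolding image_image
proof (rule image_cong[OF refl])
  fix x assume "x \<in> K"
  then have "x \<noteq> 0" using assms(2) by blast
  then show "pgl_act (pgl M) (proj_pt x) = proj_pt (M *v x)" by (rule pgl_act_proj_pt[OF assms(1)])
qed

lemma invertible_obtain_inv:
  assumes "invertible M" obtains N where "\<And>x. N *v (M *v x) = x" "\<And>x. M *v (N *v x) = (x :: real^'n)"
  using assms unfolding invertible_def by (metis matrix_vector_mul_assoc matrix_vector_mul_lid)

lemma mat_bounded: obtains B where "B > 0" "\<And>x. norm ((M :: real^'n^'m) *v x) \<le> B * norm x"
  using linear_bounded_pos[OF matrix_vector_mul_linear[of M]] by blast

text \<open>Forms are pulled back by \<open>M\<close>; the uniform constant changes by operator
  bounds of \<open>M\<close> and of its inverse.\<close>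

lemma strict_dual_mat_image:
  fixes M :: "real^'n^'n"
  assumes M: "invertible M" shows "f \<in> strict_dual ((*v) M ` K) \<longleftrightarrow> f v* M \<in> strict_dual K"
proof -
  obtain N where N: "\<And>x. N *v (M *v x) = x" "\<And>x. M *v (N *v x) = x" using invertible_obtain_inv[OF M] by metis
  obtain B where B: "B > 0" "\<And>x. norm (M *v x) \<le> B * norm x" using mat_bounded[of M] by metis
  obtain B' where B': "B' > 0" "\<And>x. norm (N *v x) \<le> B' * norm x" using mat_bounded[of N] by metis
  have "norm x \<le> B' * norm (M *v x)" for x using B'(2)[of "M *v x"] N by simp
  show ?thesis
  proof
    assume "f \<in> strict_dual ((*v) M ` K)"
    then obtain e where e: "e > 0" "\<forall>x\<in>K. e * norm (M *v x) \<le> f \<bullet> (M *v x)" unfolding strict_dual_def by auto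
    have "(e / B') * norm x \<le> (f v* M) \<bullet> x" if "x \<in> K" for x
    proof -
      have "(e / B') * norm x \<le> (e / B') * (B' * norm (M *v x))"
        using e B' \<open>norm x \<le> B' * norm (M *v x)\<close> by (intro mult_left_mono) auto
      also have "\<dots> = e * norm (M *v x)" using B' by simp
      also have "\<dots> \<le> (f v* M) \<bullet> x" unfolding dot_lmul_matrix using e that by blast
      finally show ?thesis .
    qed
    then show "f v* M \<in> strict_dual K" unfolding strict_dual_def using e B' by (auto intro!: exI[of _ "e / B'"])
  next
    assume "f v* M \<in> strict_dual K"
    then obtain e where e: "e > 0" "\<forall>x\<in>K. e * norm x \<le> f \<bullet> (M *v x)"
      unfolding strict_dual_def mem_Collect_eq dot_lmul_matrix by blast
    have "(e / B) * norm (M *v x) \<le> f \<bullet> (M *v x)" if "x \<in> K" for x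
    proof -
      have "(e / B) * norm (M *v x) \<le> (e / B) * (B * norm x)" using e B by (intro mult_left_mono) auto
      also have "\<dots> = e * norm x" using B by simp
      also have "\<dots> \<le> f \<bullet> (M *v x)" using e that by blast
      finally show ?thesis .
    qed
    then show "f \<in> strict_dual ((*v) M ` K)" unfolding strict_dual_def using e B by (auto intro!: exI[of _ "e / B"])
  qed
qed

lemma vec_mat_cancel:
  fixes M N :: "real^'n^'n"
  assumes "\<And>x. N *v (M *v x) = x" shows "(g v* N) v* M = g"
proof -
  have "((g v* N) v* M) \<bullet> x = g \<bullet> x" for x unfolding dot_lmul_matrix assms ..
  then show ?thesis by (metis vector_eq_rdot)
qed

lemma pos_dual_mat_image:
  fixes M :: "real^'n^'n"
  assumes M: "invertible M" shows "f \<in> pos_dual ((*v) M ` K) \<longleftrightarrow> f v* M \<in> pos_dual K"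
proof -
  obtain N where N: "\<And>x. N *v (M *v x) = x" "\<And>x. M *v (N *v x) = x" using invertible_obtain_inv[OF M] by metis
  have "f v* M = 0 \<longleftrightarrow> f = 0" using vec_mat_cancel[OF N(2)] by (metis vector_matrix_mult_0)
  then show ?thesis unfolding pos_dual_def by (auto simp: dot_lmul_matrix)
qed

lemma proper_cone_mat_image:
  fixes M :: "real^'n^'n"
  assumes M: "invertible M" and K: "proper_cone K" shows "proper_cone ((*v) M ` K)"
proof -
  note D = proper_coneD[OF K]
  obtain N where N: "\<And>x. N *v (M *v x) = x" "\<And>x. M *v (N *v x) = x" using invertible_obtain_inv[OF M] by metis
  obtain g where g: "g \<in> strict_dual K" using D(5) by blast
  have "g v* N \<in> strict_dual ((*v) M ` K)" unfolding strict_dual_mat_image[OF M] vec_mat_cancel[OF N(1)] by (rule g)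
  moreover have "open ((*v) M ` K)" using N(2) by (intro open_surjective_linear_image D(1) matrix_vector_mul_linear) (metis surjI)
  moreover have "x + y \<in> (*v) M ` K" if "x \<in> (*v) M ` K" "y \<in> (*v) M ` K" for x y
    using that D(3) by (auto simp: matrix_vector_right_distrib[symmetric])
  moreover have "c *\<^sub>R x \<in> (*v) M ` K" if "x \<in> (*v) M ` K" "c > 0" for c x
    using that D(4) by (auto simp: matrix_vector_mult_scaleR[symmetric])
  ultimately show ?thesis unfolding proper_cone_def using D(2) by blast
qed

lemma cone_sum_mat_image: "(*v) M ` cone_sum K L = cone_sum ((*v) M ` K) ((*v) M ` L)"
  unfolding cone_sum_def by (force simp: matrix_vector_right_distrib)

lemma inj_mat: "invertible M \<Longrightarrow> inj ((*v) (M :: real^'n^'n))"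
  by (metis injI invertible_obtain_inv)

lemma proj_adjacent_act:
  assumes adj: "proj_adjacent A B" and a: "a \<in> carrier PGL"
  shows "proj_adjacent (pgl_act a ` A) (pgl_act a ` B)"
proof -
  obtain M where M: "invertible M" "a = pgl M" using PGL_rep[OF a] .
  obtain N where N: "\<And>x. N *v (M *v x) = x" "\<And>x. M *v (N *v x) = x" using invertible_obtain_inv[OF M(1)] by metis
  obtain K L where k: "proper_cone K" "proper_cone L" "A = proj_pt ` K" "B = proj_pt ` L" "K \<inter> L \<noteq> {}"
    "strict_dual K \<inter> strict_dual L \<noteq> {}" using adj unfolding proj_adjacent_def by metis
  obtain g where g: "g \<in> strict_dual K" "g \<in> strict_dual L" using k(6) by blast
  have "g v* N \<in> strict_dual ((*v) M ` K)" "g v* N \<in> strict_dual ((*v) M ` L)"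
    unfolding strict_dual_mat_image[OF M(1)] vec_mat_cancel[OF N(1)] by (rule g)+
  moreover have "(*v) M ` K \<inter> (*v) M ` L \<noteq> {}" using k(5) by blast
  moreover have "pgl_act a ` A = proj_pt ` (*v) M ` K" "pgl_act a ` B = proj_pt ` (*v) M ` L"
    unfolding k M(2) by (rule pgl_act_cone[OF M(1) zero_notin_cone]; rule k)+
  moreover have "strict_dual ((*v) M ` K) \<inter> strict_dual ((*v) M ` L) \<noteq> {}" using calculation(1,2) by blast
  moreover have "proper_cone ((*v) M ` K)" "proper_cone ((*v) M ` L)"
    by (intro proper_cone_mat_image[OF M(1)] k)+
  ultimately show ?thesis unfolding proj_adjacent_def
    by (intro exI[of _ "(*v) M ` K"] exI[of _ "(*v) M ` L"] conjI)
qed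

lemma proj_occults_act:
  assumes occ: "proj_occults A B C" and a: "a \<in> carrier PGL"
  shows "proj_occults (pgl_act a ` A) (pgl_act a ` B) (pgl_act a ` C)"
proof -
  obtain M where M: "invertible M" "a = pgl M" using PGL_rep[OF a] .
  obtain K L P where k: "proper_cone K" "proper_cone L" "proper_cone P" "A = proj_pt ` K" "B = proj_pt ` L" "C = proj_pt ` P"
    "K \<inter> L \<noteq> {}" "L \<inter> P \<noteq> {}" "occults K L P" "\<not> K \<subseteq> L" "\<not> P \<subseteq> L" "A \<inter> C = {}"
    using occ unfolding proj_occults_def by metis
  have "occults ((*v) M ` K) ((*v) M ` L) ((*v) M ` P)"
    using k(9) unfolding occults_def subset_iff Un_iff strict_dual_mat_image[OF M(1)] pos_dual_mat_image[OF M(1)] by blast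
  moreover have "(*v) M ` K \<inter> (*v) M ` L \<noteq> {}" "(*v) M ` L \<inter> (*v) M ` P \<noteq> {}" using k(7,8) by blast+
  moreover have "\<not> (*v) M ` K \<subseteq> (*v) M ` L" "\<not> (*v) M ` P \<subseteq> (*v) M ` L"
    using k(10,11) inj_image_subset_iff[OF inj_mat[OF M(1)]] by blast+
  moreover have "pgl_act a ` A = proj_pt ` (*v) M ` K" "pgl_act a ` B = proj_pt ` (*v) M ` L" "pgl_act a ` C = proj_pt ` (*v) M ` P"
    unfolding k M(2) by (rule pgl_act_cone[OF M(1) zero_notin_cone]; rule k)+
  moreover have "pgl_act a ` A \<inter> pgl_act a ` C = {}" unfolding image_Int[OF inj_pgl_act[OF a], symmetric] k(12) by simp
  moreover have "proper_cone ((*v) M ` K)" "proper_cone ((*v) M ` L)" "proper_cone ((*v) M ` P)"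
    by (intro proper_cone_mat_image[OF M(1)] k)+
  ultimately show ?thesis unfolding proj_occults_def
    by (intro exI[of _ "(*v) M ` K"] exI[of _ "(*v) M ` L"] exI[of _ "(*v) M ` P"] conjI)
qed

section \<open>Chains of projective sets\<close>

text \<open>Adjacency is listed separately to cover chains with a single step, which contain no
  triple.\<close>

definition proj_chain :: "nat \<Rightarrow> (nat \<Rightarrow> 'a::euclidean_space proj set) \<Rightarrow> bool" where
  "proj_chain n A \<longleftrightarrow> (\<forall>i<n. proj_adjacent (A i) (A (Suc i))) \<and>
     (\<forall>i. Suc (Suc i) \<le> n \<longrightarrow> proj_occults (A i) (A (Suc i)) (A (Suc (Suc i))))"

text \<open>Requiring consecutive cones to meet propagates the sign of the first cone along the
  chain.\<close>

definition cone_lift :: "nat \<Rightarrow> (nat \<Rightarrow> 'a::euclidean_space proj set) \<Rightarrow> (nat \<Rightarrow> 'a set) \<Rightarrow> bool" where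
  "cone_lift n A K \<longleftrightarrow> (\<forall>i\<le>n. proper_cone (K i) \<and> A i = proj_pt ` K i) \<and> (\<forall>i<n. K i \<inter> K (Suc i) \<noteq> {})"

lemma cone_lift_exists:
  assumes "proj_chain n A" "proper_cone B" "A 0 = proj_pt ` B"
  shows "\<exists>K. K 0 = B \<and> cone_lift n A K"
  using assms(1)
proof (induction n)
  case 0
  then show ?case unfolding cone_lift_def using assms by (intro exI[of _ "\<lambda>_. B"]) auto
next
  case (Suc n)
  then have "proj_chain n A" unfolding proj_chain_def by auto
  then obtain K where K: "K 0 = B" "cone_lift n A K" using Suc.IH by blast
  have Kn: "proper_cone (K n)" "A n = proj_pt ` K n" using K unfolding cone_lift_def by auto
  have "proj_adjacent (A n) (A (Suc n))" using Suc.prems unfolding proj_chain_def by blast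
  then obtain P Q where PQ: "proper_cone P" "proper_cone Q" "A n = proj_pt ` P" "A (Suc n) = proj_pt ` Q" "P \<inter> Q \<noteq> {}"
    unfolding proj_adjacent_def by blast
  have "proj_pt ` Q \<inter> proj_pt ` K n \<noteq> {}" using PQ(3,5) Kn(2) by blast
  then obtain L where L: "proper_cone L" "proj_pt ` L = proj_pt ` Q" "L \<inter> K n \<noteq> {}"
    by (rule meeting_cone[OF PQ(2) Kn(1)])
  define K' where "K' = K(Suc n := L)"
  have "K' 0 = B" using K unfolding K'_def by simp
  moreover have "cone_lift (Suc n) A K'" unfolding cone_lift_def
  proof (intro conjI allI impI)
    fix i assume "i \<le> Suc n"
    then show "proper_cone (K' i)" "A i = proj_pt ` K' i"
      using K(2) L PQ(4) unfolding K'_def cone_lift_def by (auto simp: le_Suc_eq)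
  next
    fix i assume "i < Suc n"
    then show "K' i \<inter> K' (Suc i) \<noteq> {}"
      using K(2) L(3) unfolding K'_def cone_lift_def by (auto simp: less_Suc_eq Int_commute)
  qed
  ultimately show ?case by blast
qed

lemma cone_lift_occults:
  assumes "proj_chain n A" "cone_lift n A K" "Suc (Suc i) \<le> n"
  shows "occults (K i) (K (Suc i)) (K (Suc (Suc i)))" "\<not> K i \<subseteq> K (Suc i)" "\<not> K (Suc (Suc i)) \<subseteq> K (Suc i)"
proof -
  have o: "proj_occults (A i) (A (Suc i)) (A (Suc (Suc i)))" using assms unfolding proj_chain_def by blast
  have l: "proper_cone (K j)" "A j = proj_pt ` K j" if "j \<le> n" for j using assms that unfolding cone_lift_def by blast+
  have m: "K i \<inter> K (Suc i) \<noteq> {}" "K (Suc i) \<inter> K (Suc (Suc i)) \<noteq> {}" using assms(2,3) unfolding cone_lift_def by auto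
  have le: "i \<le> n" "Suc i \<le> n" using assms(3) by auto
  show "occults (K i) (K (Suc i)) (K (Suc (Suc i)))" "\<not> K i \<subseteq> K (Suc i)" "\<not> K (Suc (Suc i)) \<subseteq> K (Suc i)"
    using proj_occults_cones[OF _ l(1)[OF le(1)] l(1)[OF le(2)] l(1)[OF assms(3)] m] o
    unfolding l(2)[OF le(1)] l(2)[OF le(2)] l(2)[OF assms(3)] by blast+
qed

lemma cone_lift_occults_far:
  fixes A :: "nat \<Rightarrow> 'a::euclidean_space proj set"
  assumes dim: "DIM('a) \<ge> 3" and ch: "proj_chain n A" "cone_lift n A K" and i: "a < i" "i < b" "b \<le> n"
  shows "occults (K a) (K i) (K b)"
proof (rule occults_chain[OF dim _ _ i])
  show "proper_cone (K i)" if "i \<le> n" for i using ch(2) that unfolding cone_lift_def by blast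
  show "occults (K i) (K (i + 1)) (K (i + 2))" if "i + 2 \<le> n" for i
    using cone_lift_occults(1)[OF ch, of i] that by simp
qed

text \<open>For \<open>n > 2\<close>, the cone \<open>K 2\<close> is crossed by every segment from
  \<open>K 0\<close> to \<open>K n\<close>. If the end sets shared a point, the two ends of such a
  segment could be taken on one line through the origin, which would put that point into
  \<open>A 2\<close>; but \<open>A 0\<close> and \<open>A 2\<close> are disjoint by
  hypothesis.\<close>

theorem proj_chain_disjoint:
  fixes A :: "nat \<Rightarrow> 'a::euclidean_space proj set"
  assumes dim: "DIM('a) \<ge> 3" and ch: "proj_chain n A" and n: "n \<ge> 2"
  shows "A 0 \<inter> A n = {}"
proof (cases "n = 2")
  case True
  then have "proj_occults (A 0) (A (Suc 0)) (A (Suc (Suc 0)))" using ch unfolding proj_chain_def by simp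
  then show ?thesis unfolding proj_occults_def True numeral_2_eq_2 by blast
next
  case False
  have "proj_adjacent (A 0) (A (Suc 0))" using ch n unfolding proj_chain_def by auto
  then obtain B where B: "proper_cone B" "A 0 = proj_pt ` B" unfolding proj_adjacent_def by blast
  obtain K where K: "K 0 = B" "cone_lift n A K" using cone_lift_exists[OF ch B] by blast
  have l: "proper_cone (K j)" "A j = proj_pt ` K j" if "j \<le> n" for j using K(2) that unfolding cone_lift_def by blast+
  have K0: "proper_cone (K 0)" "A 0 = proj_pt ` K 0" and K2: "proper_cone (K 2)" "A 2 = proj_pt ` K 2"
    and Kn: "proper_cone (K n)" "A n = proj_pt ` K n" using l[of 0] l[of 2] l[of n] n by auto
  have o: "occults (K 0) (K 2) (K n)" using n False by (intro cone_lift_occults_far[OF dim ch K(2)]) auto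
  have "proj_occults (A 0) (A (Suc 0)) (A (Suc (Suc 0)))" using ch n unfolding proj_chain_def by auto
  then have d: "A 0 \<inter> A 2 = {}" unfolding proj_occults_def numeral_2_eq_2 by blast
  show ?thesis
  proof (rule equals0I)
    fix p assume p: "p \<in> A 0 \<inter> A n"
    then obtain x where x: "x \<in> K 0" "p = proj_pt x" using K0 by blast
    have x0: "x \<noteq> 0" using x(1) zero_notin_cone[OF K0(1)] by blast
    obtain s where s: "s *\<^sub>R x \<in> K n" "s \<noteq> 0"
    proof -
      have "x \<in> K n \<or> - x \<in> K n" using p x Kn proj_pt_in_cone_iff[OF Kn(1) x0] by simp
      then show ?thesis using that[of 1] that[of "-1"] by auto
    qed
    \<comment> \<open>Both vectors represent \<open>p\<close>, so the combination supplied by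
      \<open>meets_cone\<close> is again a multiple of \<open>x\<close>, nonzero since
      \<open>K 2\<close> omits the origin.\<close>
    have "f \<bullet> x > 0 \<or> f \<bullet> (s *\<^sub>R x) > 0" if f: "f \<in> pos_dual (K 2)" for f
      using o f pos_dual_pos[OF proper_coneD(1)[OF K0(1)] strict_dual_imp_pos_dual[OF K0(1)] x(1)]
        pos_dual_pos[OF proper_coneD(1)[OF Kn(1)] strict_dual_imp_pos_dual[OF Kn(1)] s(1)]
      unfolding occults_def by blast
    then obtain a b where ab: "a *\<^sub>R x + b *\<^sub>R (s *\<^sub>R x) \<in> K 2" by (rule meets_cone[OF K2(1)])
    define c where "c = a + b * s"
    have c: "c *\<^sub>R x \<in> K 2" using ab unfolding c_def by (simp add: scaleR_add_left)
    then have "c \<noteq> 0" using zero_notin_cone[OF K2(1)] by auto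
    then have "p = proj_pt (c *\<^sub>R x)" using x by (simp add: proj_pt_scaleR)
    then have "p \<in> A 2" using c K2(2) by blast
    then show False using p d by blast
  qed
qed

text \<open>All branches are lifted starting from the same cone \<open>B\<close>, which makes their
  signs compatible; occultation at \<open>B\<close> between last cones then follows from far
  occultation along concatenated branches.\<close>

theorem branches_common_form:
  fixes A :: "'j \<Rightarrow> nat \<Rightarrow> 'a::euclidean_space proj set"
  assumes dim: "DIM('a) \<ge> 3" and B: "proper_cone B"
    and A0: "\<And>j. j \<in> J \<Longrightarrow> A j 0 = proj_pt ` B"
    and len: "\<And>j. j \<in> J \<Longrightarrow> n j \<ge> 1"
    and ch: "\<And>j. j \<in> J \<Longrightarrow> proj_chain (n j) (A j)"
    and diff: "\<And>j j'. j \<in> J \<Longrightarrow> j' \<in> J \<Longrightarrow> A j 1 \<noteq> A j' 1 \<Longrightarrow> proj_occults (A j 1) (proj_pt ` B) (A j' 1)"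
    and j1: "j1 \<in> J" "n j1 = 1" and j2: "j2 \<in> J" "n j2 = 1" and neq: "A j1 1 \<noteq> A j2 1"
  obtains f \<epsilon> where "\<epsilon> > 0" "\<And>x. x \<in> B \<Longrightarrow> \<epsilon> * norm x \<le> f \<bullet> x"
    "\<And>j. j \<in> J \<Longrightarrow> \<exists>K. proper_cone K \<and> A j (n j) = proj_pt ` K \<and> (\<forall>x\<in>K. \<epsilon> * norm x \<le> f \<bullet> x)"
proof -
  have "\<forall>j\<in>J. \<exists>K. K 0 = B \<and> cone_lift (n j) (A j) K"
    using cone_lift_exists[OF ch B A0] by blast
  then obtain K where "\<forall>j\<in>J. K j 0 = B \<and> cone_lift (n j) (A j) (K j)" by (rule bchoice[THEN exE])
  then have K0: "\<And>j. j \<in> J \<Longrightarrow> K j 0 = B" and lift: "\<And>j. j \<in> J \<Longrightarrow> cone_lift (n j) (A j) (K j)" by blast+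
  have Kp: "proper_cone (K j i)" "A j i = proj_pt ` K j i" if "j \<in> J" "i \<le> n j" for i j
    using lift[OF that(1)] that(2) unfolding cone_lift_def by blast+
  have meet: "B \<inter> K j 1 \<noteq> {}" if "j \<in> J" for j
  proof -
    have "K j 0 \<inter> K j (Suc 0) \<noteq> {}" using lift[OF that] len[OF that] unfolding cone_lift_def by (metis Suc_le_lessD One_nat_def)
    then show ?thesis using K0[OF that] by simp
  qed
  have adj: "strict_dual (K j 1) \<inter> strict_dual B \<noteq> {}" if j: "j \<in> J" for j
  proof -
    have "proj_adjacent (A j 0) (A j (Suc 0))" using ch[OF j] len[OF j] unfolding proj_chain_def by auto
    then have "proj_adjacent (proj_pt ` B) (proj_pt ` K j 1)" using A0[OF j] Kp(2)[OF j len[OF j]] by simp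
    from proj_adjacent_cones[OF this B Kp(1)[OF j len[OF j]] meet[OF j]] show ?thesis by blast
  qed
  have br: "occults (K j 1) B (K j' 1) \<and> \<not> K j 1 \<subseteq> B" if j: "j \<in> J" "j' \<in> J" "K j 1 \<noteq> K j' 1" for j j'
  proof -
    \<comment> \<open>Different first cones have different projective images: each meets
      \<open>B\<close> and shares a strict form with it, so its sign is determined.\<close>
    have "A j 1 \<noteq> A j' 1"
    proof
      assume "A j 1 = A j' 1"
      then have e: "proj_pt ` K j 1 = proj_pt ` K j' 1" using Kp(2) len j by simp
      have "K j' 1 = K j 1"
        by (rule meeting_cone_unique[OF Kp(1)[OF j(1) len[OF j(1)]] Kp(1)[OF j(2) len[OF j(2)]] e _ _ B adj[OF j(1)]])
          (use meet[OF j(1)] meet[OF j(2)] in blast)+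
      then show False using j(3) by simp
    qed
    then have o: "proj_occults (proj_pt ` K j 1) (proj_pt ` B) (proj_pt ` K j' 1)"
      using diff[OF j(1,2)] Kp(2) len j by simp
    have m: "K j 1 \<inter> B \<noteq> {}" using meet[OF j(1)] by blast
    show ?thesis
      using proj_occults_cones[OF o Kp(1)[OF j(1) len[OF j(1)]] B Kp(1)[OF j(2) len[OF j(2)]] m meet[OF j(2)]] by blast
  qed
  have o: "occults (K j (n j)) B (K j' (n j'))" if j: "j \<in> J" "j' \<in> J" "K j 1 \<noteq> K j' 1" for j j'
  proof -
    \<comment> \<open>The chain runs backwards along branch \<open>j\<close> to \<open>B\<close> at
      index \<open>n j\<close>, then outwards along branch \<open>j'\<close>. Its triples are those
      of the two branches and the one centred at \<open>B\<close>.\<close>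
    define \<kappa> where "\<kappa> i = (if i \<le> n j then K j (n j - i) else K j' (i - n j))" for i
    have "occults (\<kappa> 0) (\<kappa> (n j)) (\<kappa> (n j + n j'))"
    proof (rule occults_chain[OF dim, of "n j + n j'"])
      show "proper_cone (\<kappa> i)" if "i \<le> n j + n j'" for i
        using Kp(1)[OF j(1)] Kp(1)[OF j(2)] that unfolding \<kappa>_def by auto
      show "occults (\<kappa> i) (\<kappa> (i + 1)) (\<kappa> (i + 2))" if i: "i + 2 \<le> n j + n j'" for i
      proof -
        consider "i + 2 \<le> n j" | "i + 1 = n j" | "i \<ge> n j" by linarith
        then show ?thesis
        proof cases
          case 1
          define k where "k = n j - (i + 2)"
          have "occults (K j k) (K j (Suc k)) (K j (Suc (Suc k)))"
            using 1 by (intro cone_lift_occults(1)[OF ch[OF j(1)] lift[OF j(1)]]) (auto simp: k_def)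
          moreover have "n j - i = Suc (Suc k)" "n j - (i + 1) = Suc k" using 1 by (auto simp: k_def)
          ultimately show ?thesis using 1 occults_sym unfolding \<kappa>_def k_def by auto
        next
          case 2
          then have "n j - i = 1" "i \<le> n j" "n j - (i + 1) = 0" "i + 2 - n j = 1" "\<not> i + 2 \<le> n j" by linarith+
          then have "\<kappa> i = K j 1" "\<kappa> (i + 1) = B" "\<kappa> (i + 2) = K j' 1"
            unfolding \<kappa>_def using K0[OF j(1)] 2 by simp_all
          then show ?thesis using br[OF j] by simp
        next
          case 3
          have "\<kappa> m = K j' (m - n j)" if "m \<ge> n j" for m
            using that K0[OF j(1)] K0[OF j(2)] unfolding \<kappa>_def by auto
          then have "\<kappa> i = K j' (i - n j)" "\<kappa> (i + 1) = K j' (Suc (i - n j))" "\<kappa> (i + 2) = K j' (Suc (Suc (i - n j)))"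
            using 3 by (simp_all add: Suc_diff_le)
          then show ?thesis using cone_lift_occults(1)[OF ch[OF j(2)] lift[OF j(2)], of "i - n j"] i 3 by simp
        qed
      qed
    qed (use len[OF j(1)] len[OF j(2)] in auto)
    moreover have "\<kappa> 0 = K j (n j)" "\<kappa> (n j) = B" "\<kappa> (n j + n j') = K j' (n j')"
      unfolding \<kappa>_def using K0[OF j(1)] len[OF j(2)] by auto
    ultimately show ?thesis by simp
  qed
  have neq': "K j1 1 \<noteq> K j2 1" using neq Kp(2)[OF j1(1), of 1] Kp(2)[OF j2(1), of 1] j1(2) j2(2) by auto
  obtain f \<epsilon> where f: "\<epsilon> > 0" "\<And>x. x \<in> B \<Longrightarrow> \<epsilon> * norm x \<le> f \<bullet> x"
    "\<And>j x. j \<in> J \<Longrightarrow> x \<in> K j (n j) \<Longrightarrow> \<epsilon> * norm x \<le> f \<bullet> x"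
  \<comment> \<open>Each branch contributes its last cone and is grouped by its first cone; the two
    one-step branches have equal first and last cones.\<close>
  proof (rule branches_common_dual_interior[OF dim B, where J = J and la = "\<lambda>j. K j (n j)" and br = "\<lambda>j. K j 1"])
    show "proper_cone (K j (n j))" "proper_cone (K j 1)" if "j \<in> J" for j using Kp(1)[OF that] len[OF that] by auto
    show "occults (K j (n j)) B (K j' (n j'))" if "j \<in> J" "j' \<in> J" "K j 1 \<noteq> K j' 1" for j j' using o that by blast
    show "K j (n j) = K j 1 \<or> occults B (K j 1) (K j (n j))" if j: "j \<in> J" for j
    proof (cases "n j = 1")
      case False
      then have "occults (K j 0) (K j 1) (K j (n j))" using len[OF j] by (intro cone_lift_occults_far[OF dim ch[OF j] lift[OF j]]) auto
      then show ?thesis using K0[OF j] by simp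
    qed simp
    show "K j1 (n j1) = K j1 1" "K j2 (n j2) = K j2 1" using j1 j2 by simp_all
    show "\<not> K j1 1 \<subseteq> B" using br[OF j1(1) j2(1) neq'] by blast
    show "\<not> K j2 1 \<subseteq> B" using br[OF j2(1) j1(1) neq'[symmetric]] by blast
  qed (use j1(1) j2(1) neq' in auto)
  show ?thesis
  proof (rule that[OF f(1,2)])
    fix j assume j: "j \<in> J"
    show "\<exists>K. proper_cone K \<and> A j (n j) = proj_pt ` K \<and> (\<forall>x\<in>K. \<epsilon> * norm x \<le> f \<bullet> x)"
      using Kp[OF j order_refl] f(3)[OF j] by blast
  qed
qed

section \<open>Paths in the group of a graph of groups\<close>

abbreviation (input) vertex_elt :: "('v, 'e, 'g, 'h) gog \<Rightarrow> 'v \<Rightarrow> 'g \<Rightarrow> ('v, 'e, 'g) letter list set" where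
  "vertex_elt G v r \<equiv> F_class G [Vtx v r]"

abbreviation (input) edge_elt :: "('v, 'e, 'g, 'h) gog \<Rightarrow> 'e \<Rightarrow> ('v, 'e, 'g) letter list set" where
  "edge_elt G e \<equiv> F_class G [Edg e]"

text \<open>Inductive form of membership in \<open>F_paths\<close>, suited to rule induction;
  \<open>F_paths_iff\<close> proves the equivalence.\<close>

inductive gpath :: "('v, 'e, 'g, 'h) gog \<Rightarrow> 'v \<Rightarrow> 'v \<Rightarrow> ('v, 'e, 'g) letter list set \<Rightarrow> bool" for G where
  nil: "v \<in> verts (base G) \<Longrightarrow> r \<in> carrier (vgrp G v) \<Longrightarrow> gpath G v v (vertex_elt G v r)"
| cons: "e \<in> arcs (base G) \<Longrightarrow> r \<in> carrier (vgrp G (tail (base G) e)) \<Longrightarrow> gpath G (head (base G) e) w x \<Longrightarrow>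
    gpath G (tail (base G) e) w (vertex_elt G (tail (base G) e) r \<otimes>\<^bsub>F_group G\<^esub> (edge_elt G e \<otimes>\<^bsub>F_group G\<^esub> x))"

text \<open>
  The list \<open>[(r\<^sub>0, e\<^sub>1), (r\<^sub>1, e\<^sub>2), \<dots>]\<close> encodes \<open>r\<^sub>0 e\<^sub>1 r\<^sub>1 e\<^sub>2 \<dots>\<close>, without the final vertex group element.
\<close>

fun syllables_elt :: "('v, 'e, 'g, 'h) gog \<Rightarrow> ('g \<times> 'e) list \<Rightarrow> ('v, 'e, 'g) letter list set" where
  "syllables_elt G [] = \<one>\<^bsub>F_group G\<^esub>"
| "syllables_elt G ((r, e) # ss) =
    vertex_elt G (tail (base G) e) r \<otimes>\<^bsub>F_group G\<^esub> (edge_elt G e \<otimes>\<^bsub>F_group G\<^esub> syllables_elt G ss)"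

fun syllables :: "('v, 'e, 'g, 'h) gog \<Rightarrow> 'v \<Rightarrow> ('g \<times> 'e) list \<Rightarrow> 'v \<Rightarrow> bool" where
  "syllables G v [] w \<longleftrightarrow> v = w \<and> v \<in> verts (base G)"
| "syllables G v ((r, e) # ss) w \<longleftrightarrow> e \<in> arcs (base G) \<and> v = tail (base G) e \<and> r \<in> carrier (vgrp G v) \<and>
    syllables G (head (base G) e) ss w"

text \<open>The excluded pairs are exactly the backtracks that the edge relation collapses to a
  vertex element. The first vertex element is unconstrained, so it may be changed freely.\<close>

fun reduced :: "('v, 'e, 'g, 'h) gog \<Rightarrow> ('g \<times> 'e) list \<Rightarrow> bool" where
  "reduced G ((r, e) # (r', e') # ss) \<longleftrightarrow>
    \<not> (e' = erev G e \<and> r' \<in> emb G e' ` carrier (egrp G (uedge G e'))) \<and> reduced G ((r', e') # ss)"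
| "reduced G _ \<longleftrightarrow> True"

lemma reduced_first: "reduced G ((r, e) # ss) \<longleftrightarrow> reduced G ((r', e) # ss)"
  by (cases ss) auto

lemma reduced_tl: "reduced G (s # ss) \<Longrightarrow> reduced G ss"
  by (cases s; cases ss) auto

section \<open>Vertex and edge elements, and the groupoid of paths\<close>

context graph_of_groups begin

lemma F_class_relator: assumes "F_relator G u w" shows "F_class G u = F_class G w"
proof -
  have "F_step G u w" using F_step.intros[OF assms, of "[]" "[]"] by (simp add: gwords_def)
  then have "(u, w) \<in> F_cong G" unfolding F_cong_def using F_step_gwords by auto
  then show ?thesis unfolding F_class_def by (rule equiv_class_eq[OF equiv_F_cong])
qed

lemma gwords_simps: "[] \<in> gwords G" "l # w \<in> gwords G \<longleftrightarrow> l \<in> letters G \<and> w \<in> gwords G"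
  by (auto simp: gwords_def)

lemma vtx_letter: "v \<in> verts (base G) \<Longrightarrow> r \<in> carrier (vgrp G v) \<Longrightarrow> Vtx v r \<in> letters G"
  and edg_letter: "e \<in> arcs (base G) \<Longrightarrow> Edg e \<in> letters G"
  and edginv_letter: "e \<in> arcs (base G) \<Longrightarrow> EdgInv e \<in> letters G"
  unfolding letters_def by auto

abbreviation F_mult (infixl "\<odot>" 70) where
  "x \<odot> y \<equiv> x \<otimes>\<^bsub>F_group G\<^esub> y"

abbreviation (input) F_inv ("inv\<^sub>F _" [81] 80) where
  "inv\<^sub>F x \<equiv> inv\<^bsub>F_group G\<^esub> x"

abbreviation (input) "FG \<equiv> carrier (F_group G)"
abbreviation (input) "Vs \<equiv> verts (base G)"
abbreviation (input) "Es \<equiv> arcs (base G)"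
abbreviation (input) "org \<equiv> tail (base G)"
abbreviation (input) "ter \<equiv> head (base G)"
abbreviation (input) "vtx \<equiv> vertex_elt G"
abbreviation (input) "edg \<equiv> edge_elt G"
abbreviation (input) "syl \<equiv> syllables_elt G"

sublocale F: group "F_group G" by (rule group_F)

lemma F_class_closed: "w \<in> gwords G \<Longrightarrow> F_class G w \<in> FG"
  unfolding carrier_F by blast

lemma F_class_Nil: "F_class G [] = \<one>\<^bsub>F_group G\<^esub>"
  by (simp add: F_group_def)

lemma F_class_Cons:
  "l \<in> letters G \<Longrightarrow> w \<in> gwords G \<Longrightarrow> F_class G (l # w) = F_class G [l] \<odot> F_class G w"
  using F_mult_class[of "[l]" w] by (simp add: gwords_simps)

lemma F_class_Cons2: "l \<in> letters G \<Longrightarrow> l' \<in> letters G \<Longrightarrow> w \<in> gwords G \<Longrightarrow>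
    F_class G (l # l' # w) = F_class G [l] \<odot> F_class G (l' # w)"
  by (rule F_class_Cons) (simp_all add: gwords_simps)

lemma F_class_syllable:
  assumes "v \<in> Vs" "r \<in> carrier (vgrp G v)" "e \<in> Es" "w \<in> gwords G"
  shows "F_class G (Vtx v r # Edg e # w) = vtx v r \<odot> (edg e \<odot> F_class G w)"
  using F_class_Cons2[of "Vtx v r" "Edg e" w] F_class_Cons[of "Edg e" w] assms by (simp add: vtx_letter edg_letter)

lemma vertex_elt_closed [simp]:
  "v \<in> Vs \<Longrightarrow> r \<in> carrier (vgrp G v) \<Longrightarrow> vtx v r \<in> FG"
  by (simp add: F_class_closed gwords_simps vtx_letter)

lemma edge_elt_closed [simp]: "e \<in> Es \<Longrightarrow> edg e \<in> FG"
  by (simp add: F_class_closed gwords_simps edg_letter)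

lemma vertex_elt_mult:
  assumes "v \<in> Vs" "r \<in> carrier (vgrp G v)" "s \<in> carrier (vgrp G v)"
  shows "vtx v r \<odot> vtx v s = vtx v (r \<otimes>\<^bsub>vgrp G v\<^esub> s)"
  using F_class_Cons[of "Vtx v r" "[Vtx v s]"] F_class_relator[OF F_relator.vmult[OF assms]] assms
  by (simp add: gwords_simps vtx_letter)

lemma vertex_elt_one: "v \<in> Vs \<Longrightarrow> vtx v \<one>\<^bsub>vgrp G v\<^esub> = \<one>\<^bsub>F_group G\<^esub>"
  using F_class_relator[OF F_relator.vone] F_class_Nil by metis

lemma vertex_elt_inv:
  assumes v: "v \<in> Vs" and r: "r \<in> carrier (vgrp G v)"
  shows "inv\<^sub>F (vtx v r) = vtx v (inv\<^bsub>vgrp G v\<^esub> r)"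
proof -
  interpret V: group "vgrp G v" using vgrp_group[OF v] .
  show ?thesis
    using vertex_elt_mult[OF v V.inv_closed[OF r] r] vertex_elt_one[OF v] v r by (intro F.inv_equality) auto
qed

lemma edge_elt_erev: assumes "e \<in> Es" shows "edg (erev G e) = inv\<^sub>F (edg e)"
proof -
  have "edg (erev G e) = F_class G [EdgInv e]"
    using F_class_relator[OF F_relator.erev[of "erev G e" G]] assms by simp
  moreover have "F_class G [EdgInv e] \<odot> edg e = \<one>\<^bsub>F_group G\<^esub>"
    using F_class_Cons[of "EdgInv e" "[Edg e]"] F_class_relator[OF F_relator.einv_left[OF assms]] F_class_Nil assms
    by (simp add: gwords_simps edg_letter edginv_letter)
  ultimately show ?thesis using F.inv_equality assms arev_in_arcs by (metis edge_elt_closed)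
qed

lemma emb_closed:
  assumes "e \<in> Es" "\<gamma> \<in> carrier (egrp G (uedge G e))"
  shows "emb G e \<gamma> \<in> carrier (vgrp G (org e))" "emb G (erev G e) \<gamma> \<in> carrier (vgrp G (ter e))"
proof -
  have u: "uedge G (erev G e) = uedge G e" by (auto simp: uedge_def)
  show "emb G e \<gamma> \<in> carrier (vgrp G (org e))" using emb_hom[OF assms(1)] assms(2) by (auto simp: hom_def)
  show "emb G (erev G e) \<gamma> \<in> carrier (vgrp G (ter e))"
    using emb_hom[of "erev G e"] assms u by (auto simp: hom_def)
qed

lemma uedge_erev: "uedge G (erev G e) = uedge G e"
  by (auto simp: uedge_def)

lemma head_tail_verts [simp]: "e \<in> Es \<Longrightarrow> org e \<in> Vs"
  "e \<in> Es \<Longrightarrow> ter e \<in> Vs"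
  by (auto intro: wellformed)

lemma edge_conj:
  assumes e: "e \<in> Es" and \<gamma>: "\<gamma> \<in> carrier (egrp G (uedge G e))"
  shows "vtx (org e) (emb G e \<gamma>) \<odot> edg e =
    edg e \<odot> vtx (ter e) (emb G (erev G e) \<gamma>)"
proof -
  note c = emb_closed[OF e \<gamma>]
  have "F_class G [EdgInv e] = edg (erev G e)"
    using F_class_relator[OF F_relator.erev[of "erev G e" G]] e by simp
  then have i: "F_class G [EdgInv e] = inv\<^sub>F (edg e)" using edge_elt_erev[OF e] by simp
  have "vtx (org e) (emb G e \<gamma>) =
      edg e \<odot> (vtx (ter e) (emb G (erev G e) \<gamma>) \<odot> inv\<^sub>F (edg e))"
    using F_class_relator[OF F_relator.econj[OF e \<gamma>]] i e c
    by (simp add: F_class_Cons2 gwords_simps vtx_letter edg_letter edginv_letter)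
  then show ?thesis using e c by (simp add: F.m_assoc)
qed

lemma gpath_closed: "gpath G u w x \<Longrightarrow> x \<in> FG"
  by (induction rule: gpath.induct) auto

lemma gpath_verts: assumes "gpath G u w x" shows "u \<in> Vs" "w \<in> Vs"
  using assms by (induction rule: gpath.induct) auto

lemma path_word_gwords:
  "pre_digraph.awalk (base G) u c v \<Longrightarrow>
    list_all2 (\<lambda>r w. r \<in> carrier (vgrp G w)) \<mu> (pre_digraph.awalk_verts (base G) u c) \<Longrightarrow>
    path_word G u c \<mu> \<in> gwords G \<and> gpath G u v (F_class G (path_word G u c \<mu>))"
proof (induction c arbitrary: u \<mu>)
  case Nil
  then obtain r where "\<mu> = [r]" "r \<in> carrier (vgrp G u)" by (cases \<mu>) (auto simp: list_all2_Cons2)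
  then show ?case using Nil gpath.nil by (auto simp: awalk_Nil_iff gwords_simps vtx_letter)
next
  case (Cons e c)
  then have e: "e \<in> Es" "u = org e" "pre_digraph.awalk (base G) (ter e) c v"
    by (auto simp: awalk_Cons_iff)
  from Cons.prems(2) obtain r \<mu>' where \<mu>: "\<mu> = r # \<mu>'" "r \<in> carrier (vgrp G u)"
    "list_all2 (\<lambda>r w. r \<in> carrier (vgrp G w)) \<mu>' (pre_digraph.awalk_verts (base G) (ter e) c)"
    using e by (auto simp: list_all2_Cons2)
  note IH = Cons.IH[OF e(3) \<mu>(3)]
  have "F_class G (path_word G u (e # c) \<mu>) =
      vtx u r \<odot> (edg e \<odot> F_class G (path_word G (ter e) c \<mu>'))"
    using IH e \<mu> by (simp add: F_class_syllable)
  moreover have "path_word G u (e # c) \<mu> \<in> gwords G"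
    using IH e \<mu> by (simp add: gwords_simps vtx_letter edg_letter)
  ultimately show ?case using gpath.cons[of e G r v] IH e \<mu> by metis
qed

lemma F_paths_iff: "x \<in> F_paths G u v \<longleftrightarrow> gpath G u v x"
proof
  assume "x \<in> F_paths G u v"
  then show "gpath G u v x" unfolding F_paths_def using path_word_gwords by blast
next
  assume "gpath G u v x"
  then have "\<exists>c \<mu>. x = F_class G (path_word G u c \<mu>) \<and> pre_digraph.awalk (base G) u c v \<and>
     list_all2 (\<lambda>r w. r \<in> carrier (vgrp G w)) \<mu> (pre_digraph.awalk_verts (base G) u c)"
  proof (induction rule: gpath.induct)
    case (nil v r)
    then show ?case by (intro exI[of _ "[]"] exI[of _ "[r]"]) (auto simp: awalk_Nil_iff)
  next
    case (cons e r w x)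
    then obtain c \<mu> where c: "x = F_class G (path_word G (ter e) c \<mu>)" "pre_digraph.awalk (base G) (ter e) c w"
       "list_all2 (\<lambda>r w. r \<in> carrier (vgrp G w)) \<mu> (pre_digraph.awalk_verts (base G) (ter e) c)" by blast
    have "path_word G (ter e) c \<mu> \<in> gwords G" using path_word_gwords[OF c(2,3)] by blast
    then show ?case using cons(1,2) c
      by (intro exI[of _ "e # c"] exI[of _ "r # \<mu>"])
        (simp add: awalk_Cons_iff F_class_syllable)
  qed
  then show "x \<in> F_paths G u v" unfolding F_paths_def by blast
qed

lemma gpath_vertex_left:
  assumes "gpath G u w x" "r \<in> carrier (vgrp G u)" shows "gpath G u w (vtx u r \<odot> x)"
  using assms
proof (cases rule: gpath.cases)
  case (nil s)
  interpret V: group "vgrp G u" using vgrp_group nil by simp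
  show ?thesis using nil assms(2) gpath.nil[of u G "r \<otimes>\<^bsub>vgrp G u\<^esub> s"] vertex_elt_mult[of u r s] by simp
next
  case (cons e s y)
  interpret V: group "vgrp G u" using vgrp_group cons by simp
  have "s \<in> carrier (vgrp G u)" using cons by simp
  then have c: "r \<otimes>\<^bsub>vgrp G u\<^esub> s \<in> carrier (vgrp G u)" by (rule V.m_closed[OF assms(2)])
  have u: "u \<in> Vs" using cons by simp
  have y: "y \<in> FG" using gpath_closed cons by blast
  have "vtx u r \<odot> x = vtx u (r \<otimes>\<^bsub>vgrp G u\<^esub> s) \<odot> (edg e \<odot> y)"
    using vertex_elt_mult[of u r s] assms(2) cons y u F.m_assoc[of "vtx u r" "vtx u s" "edg e \<odot> y"]
    by simp
  then show ?thesis using gpath.cons[of e G "r \<otimes>\<^bsub>vgrp G u\<^esub> s" w y] cons c by simp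
qed

lemma gpath_mult: "gpath G u v x \<Longrightarrow> gpath G v w y \<Longrightarrow> gpath G u w (x \<odot> y)"
proof (induction rule: gpath.induct)
  case (nil v r) then show ?case by (intro gpath_vertex_left)
next
  case (cons e r v x)
  then show ?case using gpath.cons[of e G r w "x \<odot> y"] gpath_closed[of v w y] gpath_closed[OF cons(3)]
    by (simp add: F.m_assoc)
qed

lemma vgrp_one_closed: "v \<in> Vs \<Longrightarrow> \<one>\<^bsub>vgrp G v\<^esub> \<in> carrier (vgrp G v)"
  using vgrp_group group.is_monoid monoid.one_closed by blast

lemma gpath_one: "v \<in> Vs \<Longrightarrow> gpath G v v \<one>\<^bsub>F_group G\<^esub>"
  using gpath.nil[OF _ vgrp_one_closed] vertex_elt_one by metis

lemma gpath_edge: assumes e: "e \<in> Es" shows "gpath G (org e) (ter e) (edg e)"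
  using gpath.cons[OF e vgrp_one_closed gpath_one] e vertex_elt_one by simp

lemma gpath_inv: "gpath G u w x \<Longrightarrow> gpath G w u (inv\<^sub>F x)"
proof (induction rule: gpath.induct)
  case (nil v r)
  interpret V: group "vgrp G v" using vgrp_group nil by simp
  show ?case using nil by (simp add: vertex_elt_inv gpath.nil)
next
  case (cons e r w x)
  interpret V: group "vgrp G (org e)" using vgrp_group cons by simp
  have x: "x \<in> FG" using gpath_closed cons by blast
  have "gpath G w (org e) (inv\<^sub>F x \<odot> edg (erev G e))"
    using gpath_mult[OF cons.IH] gpath_edge[of "erev G e"] cons(1) by simp
  from gpath_mult[OF this gpath.nil[of "org e" G "inv\<^bsub>vgrp G (org e)\<^esub> r"]]
  show ?case using cons(1,2) x by (simp add: F.inv_mult_group edge_elt_erev vertex_elt_inv)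
qed

lemma base_awalk: assumes "u \<in> Vs" "v \<in> Vs" shows "\<exists>c. awalk u c v"
proof -
  have "symmetric (base G)" unfolding symmetric_conv
  proof
    fix e assume e: "e \<in> Es"
    then show "\<exists>e2\<in>Es. org e = ter e2 \<and> ter e = org e2"
      by (intro bexI[of _ "erev G e"]) simp_all
  qed
  moreover have "u \<rightarrow>\<^sup>*\<^bsub>mk_symmetric (base G)\<^esub> v"
    using connected_base assms unfolding Digraph_Component.connected_def strongly_connected_def by simp
  ultimately show ?thesis using reachable_mk_symmetric_eq reachable_awalk by blast
qed

lemma gpath_exists: assumes "u \<in> Vs" "v \<in> Vs" shows "\<exists>x. gpath G u v x"
proof -
  obtain c where "awalk u c v" using base_awalk[OF assms] by blast
  then show ?thesis
  proof (induction c arbitrary: u)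
    case Nil
    then show ?case using gpath_one by (auto simp: awalk_Nil_iff)
  next
    case (Cons e c)
    then show ?case using gpath_mult[OF gpath_edge[of e]] by (auto simp: awalk_Cons_iff) blast
  qed
qed

lemma syllables_elt_closed: "syllables G u ss w \<Longrightarrow> syl ss \<in> FG"
  by (induction ss arbitrary: u) auto

lemma gpath_syllables: "syllables G u ss w \<Longrightarrow> gpath G u w (syl ss)"
proof (induction ss arbitrary: u)
  case Nil then show ?case using gpath_one by auto
next
  case (Cons s ss) then show ?case by (cases s) (auto intro: gpath.cons)
qed

text \<open>By \<open>edge_conj\<close> the edge group element slides back across \<open>e\<close>
  and becomes \<open>emb G e \<gamma>\<close>, after which the edge cancels with its
  reverse.\<close>

lemma cancel_backtrack:
  assumes e: "e \<in> Es" and \<gamma>: "\<gamma> \<in> carrier (egrp G (uedge G e))" and r: "r \<in> carrier (vgrp G (org e))"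
    and x: "x \<in> FG"
  shows "vtx (org e) r \<odot> (edg e \<odot>
     (vtx (ter e) (emb G (erev G e) \<gamma>) \<odot> (edg (erev G e) \<odot> x))) =
     vtx (org e) (r \<otimes>\<^bsub>vgrp G (org e)\<^esub> emb G e \<gamma>) \<odot> x"
proof -
  note c = emb_closed[OF e \<gamma>]
  let ?r = "vtx (org e) r" and ?m = "vtx (org e) (emb G e \<gamma>)"
    and ?h = "vtx (ter e) (emb G (erev G e) \<gamma>)" and ?e = "edg e"
  have cl: "?r \<in> FG" "?m \<in> FG" "?h \<in> FG" "?e \<in> FG"
    using e c r by auto
  have "?e \<odot> (?h \<odot> (edg (erev G e) \<odot> x)) =
      (?e \<odot> ?h) \<odot> (inv\<^sub>F ?e \<odot> x)"
    using cl x by (simp add: F.m_assoc edge_elt_erev[OF e])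
  also have "\<dots> = (?m \<odot> ?e) \<odot> (inv\<^sub>F ?e \<odot> x)" by (simp add: edge_conj[OF e \<gamma>])
  also have "\<dots> = ?m \<odot> x"
    using cl x F.m_assoc[of ?e "inv\<^sub>F ?e" x, symmetric] by (simp add: F.m_assoc)
  finally show ?thesis using cl x vertex_elt_mult[OF _ r c(1)] e by (simp add: F.m_assoc[symmetric])
qed

text \<open>Prefixing a syllable to a reduced word creates at most one backtrack, at the front.
  Cancelling it leaves the vertex element \<open>q\<close>, and multiplying the remaining word by
  \<open>q\<close> preserves reducedness.\<close>

lemma gpath_reduced:
  "gpath G u w x \<Longrightarrow> \<exists>ss r. syllables G u ss w \<and> reduced G ss \<and> r \<in> carrier (vgrp G w) \<and>
     x = syl ss \<odot> vtx w r"
proof (induction rule: gpath.induct)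
  case (nil v r)
  then show ?case by (intro exI[of _ "[]"] exI[of _ r]) auto
next
  case (cons e r w x)
  then obtain ss s where ss: "syllables G (ter e) ss w" "reduced G ss" "s \<in> carrier (vgrp G w)"
    "x = syl ss \<odot> vtx w s" by blast
  let ?v = "org e"
  interpret V: group "vgrp G ?v" using vgrp_group cons by simp
  have w: "w \<in> Vs" using gpath_verts cons by blast
  have cl: "syl ss \<in> FG" "vtx w s \<in> FG"
    using syllables_elt_closed[OF ss(1)] ss(3) w by auto
  show ?case
  proof (cases "reduced G ((r, e) # ss)")
    case True
    then show ?thesis using cons ss cl
      by (intro exI[of _ "(r, e) # ss"] exI[of _ s]) (auto simp: F.m_assoc)
  next
    case False
    then obtain r1 e1 t where t: "ss = (r1, e1) # t" by (cases ss) auto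
    then have "e1 = erev G e" "r1 \<in> emb G e1 ` carrier (egrp G (uedge G e1))" using False ss(2) by auto
    then obtain \<gamma> where \<gamma>: "e1 = erev G e" "\<gamma> \<in> carrier (egrp G (uedge G e))" "r1 = emb G (erev G e) \<gamma>"
      using uedge_erev by auto
    define q where "q = r \<otimes>\<^bsub>vgrp G ?v\<^esub> emb G e \<gamma>"
    have qc: "q \<in> carrier (vgrp G ?v)" unfolding q_def using cons(2) emb_closed(1)[OF cons(1) \<gamma>(2)] by simp
    have st: "syllables G ?v t w" "reduced G t" using ss(1,2) t \<gamma> cons(1) reduced_tl by auto
    have tc: "syl t \<in> FG" using syllables_elt_closed[OF st(1)] .
    have x: "x = vtx (ter e) (emb G (erev G e) \<gamma>) \<odot>
        (edg (erev G e) \<odot> (syl t \<odot> vtx w s))"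
      using ss(4) t \<gamma> cons(1) tc cl(2) emb_closed(2)[OF cons(1) \<gamma>(2)] by (simp add: F.m_assoc)
    have eq: "vtx ?v r \<odot> (edg e \<odot> x) =
        vtx ?v q \<odot> (syl t \<odot> vtx w s)"
      unfolding x q_def using tc cl by (intro cancel_backtrack cons \<gamma>) auto
    show ?thesis
    \<comment> \<open>The element \<open>q\<close> merges with the final vertex element if no edge
      remains, otherwise with the first vertex element of \<open>t\<close>.\<close>
    proof (cases t)
      case Nil
      then have "w = ?v" using st by simp
      then show ?thesis using eq Nil qc ss(3) w vertex_elt_mult[of ?v q s]
        by (intro exI[of _ "[]"] exI[of _ "q \<otimes>\<^bsub>vgrp G ?v\<^esub> s"]) auto
    next
      case (Cons a t')
      obtain r2 e2 where a: "a = (r2, e2)" by (cases a)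
      have 2: "e2 \<in> Es" "org e2 = ?v" "r2 \<in> carrier (vgrp G ?v)" "syllables G (ter e2) t' w"
        using st Cons a by auto
      have t'c: "syl t' \<in> FG" using syllables_elt_closed[OF 2(4)] .
      have "vtx ?v q \<odot> (syl t \<odot> vtx w s) =
        (vtx ?v q \<odot> vtx ?v r2) \<odot>
          ((edg e2 \<odot> syl t') \<odot> vtx w s)"
        using Cons a 2 t'c cl(2) qc cons(1) by (simp add: F.m_assoc)
      also have "vtx ?v q \<odot> vtx ?v r2 = vtx ?v (q \<otimes>\<^bsub>vgrp G ?v\<^esub> r2)"
        using qc 2 cons(1) by (intro vertex_elt_mult) auto
      finally have "vtx ?v q \<odot> (syl t \<odot> vtx w s) =
          syl ((q \<otimes>\<^bsub>vgrp G ?v\<^esub> r2, e2) # t') \<odot> vtx w s"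
        using 2 t'c cl(2) qc cons(1) by (simp add: F.m_assoc)
      moreover have "reduced G ((q \<otimes>\<^bsub>vgrp G ?v\<^esub> r2, e2) # t')" using st(2) Cons a reduced_first by metis
      ultimately show ?thesis using eq 2 qc ss(3)
        by (intro exI[of _ "(q \<otimes>\<^bsub>vgrp G ?v\<^esub> r2, e2) # t'"] exI[of _ s]) auto
    qed
  qed
qed

text \<open>Seen from the vertex between the two syllables, a reduced path arrives through
  \<open>erev G e\<close> and leaves through \<open>e'\<close>. Reducedness thus supplies the
  occultation hypothesis at every interior vertex.\<close>

lemma reduced_pair_distinct:
  assumes "syllables G u ((r, e) # (r', e') # ss) w" "reduced G ((r, e) # (r', e') # ss)"
  shows "distinct_branches G (erev G e) e' r'"
  using assms uedge_erev unfolding distinct_branches_def by auto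

text \<open>A closed path with one edge is a loop; its two orientations are different edges with the
  same origin, since reversal has no fixed points.\<close>

lemma closed_reduced_distinct:
  assumes "syllables G u ss u" "reduced G ss" "ss \<noteq> []"
  shows "\<exists>e e' \<gamma>. distinct_branches G e e' \<gamma>"
proof -
  obtain r e t where t: "ss = (r, e) # t" using assms(3) by (cases ss) auto
  show ?thesis
  proof (cases t)
    case Nil
    then have e: "e \<in> Es" "org e = ter e" using assms(1) t by auto
    then have "distinct_branches G e (erev G e) \<one>\<^bsub>vgrp G (org e)\<^esub>"
      using arev_neq[OF e(1)] vgrp_one_closed[of "org e"] unfolding distinct_branches_def by auto
    then show ?thesis by blast
  next
    case (Cons a t')
    then show ?thesis using reduced_pair_distinct assms(1,2) t by (cases a) blast
  qed
qed

text \<open>If neither end of \<open>e\<close> had a second branch, \<open>e\<close> would be the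
  only edge at its endpoints and both embeddings would be onto. By connectedness these endpoints are
  then all vertices that paths can reach, contradicting the given pair.\<close>

lemma distinct_branch_at_edge:
  assumes ex: "distinct_branches G a b c" and e: "e \<in> Es"
  shows "(\<exists>e' \<gamma>. distinct_branches G e e' \<gamma>) \<or> (\<exists>e' \<gamma>. distinct_branches G (erev G e) e' \<gamma>)"
proof (rule ccontr)
  assume no: "\<not> ?thesis"
  have only: "e' = d \<and> emb G d ` carrier (egrp G (uedge G d)) = carrier (vgrp G (org d))"
    if d: "d = e \<or> d = erev G e" and e': "e' \<in> Es" "org e' = org d" for d e'
  proof -
    have da: "d \<in> Es" using d e by auto
    have n: "\<not> distinct_branches G d e'' \<gamma>" for e'' \<gamma> using no d by blast
    have "e' = d"
    proof (rule ccontr)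
      assume "e' \<noteq> d"
      then have "distinct_branches G d e' \<one>\<^bsub>vgrp G (org d)\<^esub>"
        using da e' vgrp_one_closed[of "org d"] unfolding distinct_branches_def by simp
      then show False using n by blast
    qed
    moreover have "\<gamma> \<in> emb G d ` carrier (egrp G (uedge G d))" if \<gamma>: "\<gamma> \<in> carrier (vgrp G (org d))" for \<gamma>
    proof (rule ccontr)
      assume "\<gamma> \<notin> emb G d ` carrier (egrp G (uedge G d))"
      then have "distinct_branches G d d \<gamma>" using da \<gamma> unfolding distinct_branches_def by simp
      then show False using n by blast
    qed
    moreover have "emb G d ` carrier (egrp G (uedge G d)) \<subseteq> carrier (vgrp G (org d))"
      using emb_closed(1)[OF da] by blast
    ultimately show ?thesis by blast
  qed
  define S where "S = {org e, ter e}"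
  have step: "x \<in> Es \<Longrightarrow> org x \<in> S \<Longrightarrow> x = e \<or> x = erev G e" for x
    using only[of e x] only[of "erev G e" x] e unfolding S_def by auto
  have reach: "awalk u p v \<Longrightarrow> u \<in> S \<Longrightarrow> v \<in> S" for u p v
  proof (induction p arbitrary: u)
    case Nil then show ?case by (simp add: awalk_Nil_iff)
  next
    case (Cons x p)
    then have x: "x \<in> Es" "org x = u" "awalk (ter x) p v" by (auto simp: awalk_Cons_iff)
    then have "x = e \<or> x = erev G e" using step Cons.prems by simp
    then have "ter x \<in> S" using e unfolding S_def by auto
    then show ?case using Cons.IH x by blast
  qed
  have ab: "a \<in> Es" "b \<in> Es" "org a = org b" "c \<in> carrier (vgrp G (org a))"
    "a \<noteq> b \<or> a = b \<and> c \<notin> emb G a ` carrier (egrp G (uedge G a))" using ex unfolding distinct_branches_def by auto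
  obtain p where "awalk (org e) p (org a)" using base_awalk e ab(1) by (meson head_tail_verts)
  then have "org a \<in> S" using reach S_def by blast
  then have "a = e \<or> a = erev G e" using step ab(1) by blast
  from only[OF this ab(2)] ab show False by auto
qed

end

section \<open>Discreteness and faithfulness\<close>

lemma properly_convex_act:
  assumes "properly_convex A" "A \<noteq> {}" "a \<in> carrier PGL" shows "properly_convex (pgl_act a ` A)"
proof -
  obtain K where K: "proper_cone K" "A = proj_pt ` K" using properly_convex_cone[OF assms(1,2)] .
  obtain M where M: "invertible M" "a = pgl M" using PGL_rep[OF assms(3)] .
  show ?thesis unfolding M(2) K(2) pgl_act_cone[OF M(1) zero_notin_cone[OF K(1)]]
    by (intro properly_convex_proj_cone proper_cone_mat_image M K)
qed

lemma proj_chain_Suc: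
  assumes "proj_adjacent (A 0) (A 1)" "proj_chain n (\<lambda>i. A (Suc i))" "n \<ge> 1 \<Longrightarrow> proj_occults (A 0) (A 1) (A 2)"
  shows "proj_chain (Suc n) A"
  unfolding proj_chain_def
proof (intro conjI allI impI)
  fix i assume "i < Suc n"
  then show "proj_adjacent (A i) (A (Suc i))" using assms(1,2) unfolding proj_chain_def by (cases i) auto
next
  fix i assume "Suc (Suc i) \<le> Suc n"
  then show "proj_occults (A i) (A (Suc i)) (A (Suc (Suc i)))"
    using assms(2,3) unfolding proj_chain_def by (cases i) (auto simp: numeral_2_eq_2)
qed

section \<open>Open subsets of the projective linear group\<close>

lemma coset_eqI:
  assumes "M \<in> pgl N" "invertible N"
  shows "invertible M" "pgl M = pgl N"
proof -
  interpret normal scalar_matrices GL by (rule normal_scalar_matrices)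
  have N: "N \<in> carrier GL" using assms(2) by (simp add: carrier_GL)
  show "pgl M = pgl N"
    using repr_independence[OF assms(1) N is_subgroup] by simp
  show "invertible M" using r_coset_subset_G[OF subset N] assms(1) by (auto simp: carrier_GL)
qed

lemma coset_self: "invertible M \<Longrightarrow> M \<in> pgl M"
  unfolding rcoset_scalar by (auto intro: exI[of _ 1])

text \<open>The union of the selected cosets is the part of \<open>T\<close> in the general linear
  group, because a coset is represented by each of its matrices.\<close>

lemma openin_PGL_I:
  assumes T: "open T" and PT: "\<And>M. invertible M \<Longrightarrow> P (pgl M) \<longleftrightarrow> M \<in> T"
  shows "openin PGL_topology {a \<in> carrier PGL. P a}"
proof -
  have "\<Union> {a \<in> carrier PGL. P a} = carrier GL \<inter> T"
  proof (intro Set.set_eqI iffI)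
    fix M assume "M \<in> \<Union> {a \<in> carrier PGL. P a}"
    then obtain a where a: "a \<in> carrier PGL" "P a" "M \<in> a" by blast
    obtain N where N: "invertible N" "a = pgl N" using PGL_rep[OF a(1)] .
    have "invertible M" "pgl M = a" using coset_eqI[of M N] a(3) N by auto
    then show "M \<in> carrier GL \<inter> T" using PT a(2) by (auto simp: carrier_GL)
  next
    fix M assume "M \<in> carrier GL \<inter> T"
    then have "invertible M" "P (pgl M)" using PT by (auto simp: carrier_GL)
    then show "M \<in> \<Union> {a \<in> carrier PGL. P a}" using coset_in_PGL coset_self by blast
  qed
  then show ?thesis unfolding openin_PGL_topology using T by (auto simp: openin_open_Int)
qed

lemma openin_PGL_translate:
  fixes U :: "(real^'n^'n) set set"
  assumes U: "openin PGL_topology U" and a: "a \<in> carrier PGL"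
  shows "openin PGL_topology {b \<in> carrier PGL. a \<otimes>\<^bsub>PGL\<^esub> b \<in> U}"
proof -
  obtain N where N: "invertible N" "a = pgl N" using PGL_rep[OF a] .
  have Uc: "U \<subseteq> carrier PGL" and "openin (top_of_set (carrier GL)) (\<Union>U)" using U unfolding openin_PGL_topology by auto
  then obtain T where T: "open T" "\<Union>U = carrier GL \<inter> T" by (auto simp: openin_open)
  have "linear (\<lambda>M :: real^'n^'n. N ** M)"
  proof (rule linearI)
    show "N ** (c *\<^sub>R M) = c *\<^sub>R (N ** M)" for c and M :: "real^'n^'n"
      by (metis matrix_mul_assoc scalar_mult)
  qed (rule matrix_add_ldistrib)
  then have "continuous_on UNIV (\<lambda>M :: real^'n^'n. N ** M)"
    by (intro linear_continuous_on) (simp add: linear_conv_bounded_linear)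
  then have oT: "open {M. N ** M \<in> T}" using T(1) open_vimage[of T "\<lambda>M. N ** M"] by (simp add: vimage_def)
  show ?thesis
  proof (rule openin_PGL_I[OF oT])
    fix M :: "real^'n^'n" assume M: "invertible M"
    have NM: "invertible (N ** M)" using invertible_mult[OF N(1) M] .
    have "pgl (N ** M) \<in> U \<longleftrightarrow> N ** M \<in> \<Union>U"
    proof
      assume "N ** M \<in> \<Union>U"
      then obtain c where c: "c \<in> U" "N ** M \<in> c" by blast
      obtain L where L: "invertible L" "c = pgl L" using PGL_rep c(1) Uc by blast
      then show "pgl (N ** M) \<in> U" using coset_eqI(2)[of "N ** M" L] c by auto
    qed (use coset_self[OF NM] in blast)
    also have "\<dots> \<longleftrightarrow> N ** M \<in> T" using T(2) NM by (auto simp: carrier_GL)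
    finally show "a \<otimes>\<^bsub>PGL\<^esub> (pgl M) \<in> U \<longleftrightarrow> M \<in> {M. N ** M \<in> T}"
      unfolding N(2) PGL_mult_cosets[OF N(1) M] by simp
  qed
qed

lemma continuous_on_mat_vec:
  fixes h :: "real^'n^'m \<Rightarrow> real^'n"
  assumes "continuous_on S h" shows "continuous_on S (\<lambda>M. M *v h M)"
  unfolding matrix_vector_mult_def
  by (intro continuous_on_vec_lambda continuous_on_sum continuous_on_mult continuous_on_component
      continuous_on_id continuous_on_id' assms)

text \<open>Both \<open>M *v x\<close> and \<open>M *v (M *v x)\<close> depend continuously on
  \<open>M\<close>, and the lift of an open projective set is open.\<close>

lemma openin_PGL_orbit:
  fixes p :: "(real^'n) proj"
  assumes A: "open A"
  shows "openin PGL_topology {a \<in> carrier PGL. pgl_act a p \<in> A \<and> pgl_act a (pgl_act a p) \<in> A}"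
proof -
  obtain x where x: "x \<noteq> 0" "p = proj_pt x" by (rule proj_cases)
  define X where "X = {x. x \<noteq> 0 \<and> proj_pt x \<in> A}"
  have oX: "open X" using A unfolding X_def open_proj_iff .
  have c: "continuous_on UNIV (\<lambda>M :: real^'n^'n. M *v x)" by (intro continuous_on_mat_vec continuous_on_const)
  have "open ((\<lambda>M :: real^'n^'n. M *v x) -` X)" "open ((\<lambda>M :: real^'n^'n. M *v (M *v x)) -` X)"
    by (intro open_vimage oX c continuous_on_mat_vec)+
  then have oT: "open ((\<lambda>M :: real^'n^'n. M *v x) -` X \<inter> (\<lambda>M. M *v (M *v x)) -` X)" by (rule open_Int)
  show ?thesis
  proof (rule openin_PGL_I[OF oT])
    fix M :: "real^'n^'n" assume M: "invertible M"
    have nz: "M *v y \<noteq> 0" if "y \<noteq> 0" for y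
      using M that matrix_left_invertible_ker[of M] unfolding invertible_def by blast
    have "pgl_act (pgl M) p = proj_pt (M *v x)"
      "pgl_act (pgl M) (proj_pt (M *v x)) = proj_pt (M *v (M *v x))"
      unfolding x(2) by (intro pgl_act_proj_pt M x nz)+
    then show "(pgl_act (pgl M) p \<in> A \<and>
        pgl_act (pgl M) (pgl_act (pgl M) p) \<in> A) \<longleftrightarrow>
        M \<in> (\<lambda>M. M *v x) -` X \<inter> (\<lambda>M. M *v (M *v x)) -` X"
      unfolding X_def using nz x(1) by simp
  qed
qed

fun end_vertex :: "('v, 'e, 'g, 'h) gog \<Rightarrow> 'v \<Rightarrow> ('g \<times> 'e) list \<Rightarrow> 'v" where
  "end_vertex G v [] = v"
| "end_vertex G v ((r, e) # ss) = end_vertex G (head (base G) e) ss"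

lemma syllables_end: "syllables G u ss w \<Longrightarrow> end_vertex G u ss = w"
  by (induction ss arbitrary: u) auto

lemma (in graph_of_groups) syllables_take:
  "syllables G u ss w \<Longrightarrow> syllables G u (take i ss) (end_vertex G u (take i ss))"
proof (induction ss arbitrary: u i)
  case Nil then show ?case by auto
next
  case (Cons s ss)
  then show ?case by (cases s; cases i) auto
qed

locale occulting_gog = graph_of_groups G for G :: "('v, 'e, 'g, 'h) gog" +
  fixes \<rho> :: "'v \<Rightarrow> 'g \<Rightarrow> (real^'n^'n) set"
    and g :: "'e \<Rightarrow> (real^'n^'n) set"
    and R :: "('v, 'e, 'g) letter list set \<Rightarrow> (real^'n^'n) set"
    and \<Omega> :: "'v \<Rightarrow> (real^'n) proj set"
  assumes dimension: "CARD('n) \<ge> 3"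
    and R_hom: "R \<in> hom (F_group G) PGL"
    and R_vertex: "\<And>v x. v \<in> Vs \<Longrightarrow> x \<in> carrier (vgrp G v) \<Longrightarrow> R (vtx v x) = \<rho> v x"
    and R_edge: "\<And>e. e \<in> Es \<Longrightarrow> R (edg e) = g e"
    and domain_convex: "\<And>v. v \<in> Vs \<Longrightarrow> properly_convex (\<Omega> v)"
    and domain_invariant: "\<And>v x. v \<in> Vs \<Longrightarrow> x \<in> carrier (vgrp G v) \<Longrightarrow> pgl_act (\<rho> v x) ` \<Omega> v = \<Omega> v"
    and occultation: "\<And>e e' \<gamma>. distinct_branches G e e' \<gamma> \<Longrightarrow>
           occultation_position
             (pgl_act (g e) ` \<Omega> (ter e))
             (\<Omega> (org e))
             (pgl_act (\<rho> (org e) \<gamma> \<otimes>\<^bsub>PGL\<^esub> g e') ` \<Omega> (ter e'))"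
begin

lemma dim: "DIM(real^'n) \<ge> 3"
  using dimension by simp

sublocale R: group_hom "F_group G" PGL R
  using group_F group_PGL R_hom by (auto simp: group_hom_def group_hom_axioms_def)

text \<open>The domain attached to the tree vertex represented by \<open>x\<close>; by
  \<open>vdom_vertex_right\<close> it depends only on the coset of \<open>x\<close> modulo the
  vertex group at \<open>v\<close>.\<close>

definition vdom :: "('v, 'e, 'g) letter list set \<Rightarrow> 'v \<Rightarrow> (real^'n) proj set" where
  "vdom x v = pgl_act (R x) ` \<Omega> v"

lemma vdom_mult: "x \<in> FG \<Longrightarrow> y \<in> FG \<Longrightarrow>
    vdom (x \<odot> y) v = pgl_act (R x) ` vdom y v"
  unfolding vdom_def by (simp add: pgl_act_image_mult)

lemma vdom_one: "vdom \<one>\<^bsub>F_group G\<^esub> v = \<Omega> v"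
  unfolding vdom_def by (simp add: pgl_act_one)

lemma vdom_vertex_right:
  assumes "x \<in> FG" "v \<in> Vs" "r \<in> carrier (vgrp G v)"
  shows "vdom (x \<odot> vtx v r) v = vdom x v"
  using assms domain_invariant[OF assms(2,3)] by (simp add: vdom_mult) (simp add: vdom_def R_vertex)

section \<open>Domains along paths of the universal covering tree\<close>

lemma occults_base:
  assumes d: "distinct_branches G e e' \<gamma>"
  shows "proj_occults (vdom (edg e) (ter e)) (\<Omega> (org e))
     (vdom (vtx (org e) \<gamma> \<odot> edg e') (ter e'))"
proof -
  have e: "e \<in> Es" "e' \<in> Es" "\<gamma> \<in> carrier (vgrp G (org e))"
    using d unfolding distinct_branches_def by auto
  let ?v = "org e"
  have eq: "pgl_act (g e) ` \<Omega> (ter e) = vdom (edg e) (ter e)"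
    "pgl_act (\<rho> ?v \<gamma> \<otimes>\<^bsub>PGL\<^esub> g e') ` \<Omega> (ter e') =
      vdom (vtx ?v \<gamma> \<odot> edg e') (ter e')"
    unfolding vdom_def using e by (simp_all add: R_vertex R_edge)
  have o: "occultation_position (vdom (edg e) (ter e)) (\<Omega> ?v)
     (vdom (vtx ?v \<gamma> \<odot> edg e') (ter e'))"
    using occultation[OF d] unfolding eq .
  have pc: "properly_convex (vdom y v)" if "vdom y v \<noteq> {}" "y \<in> FG" "v \<in> Vs" for y v
    using that domain_convex unfolding vdom_def by (intro properly_convex_act) auto
  show ?thesis
    using o e unfolding occultation_position_def
    by (intro occultation_position_occults[OF o] pc domain_convex) auto
qed

lemma occults_at:
  assumes d: "distinct_branches G e e' \<gamma>" and y: "y \<in> FG"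
  shows "proj_occults (vdom (y \<odot> edg e) (ter e)) (vdom y (org e))
     (vdom (y \<odot> (vtx (org e) \<gamma> \<odot> edg e')) (ter e'))"
proof -
  have e: "e \<in> Es" "e' \<in> Es" "\<gamma> \<in> carrier (vgrp G (org e))"
    using d unfolding distinct_branches_def by auto
  have "vdom y (org e) = pgl_act (R y) ` \<Omega> (org e)" by (simp add: vdom_def)
  then show ?thesis
    using proj_occults_act[OF occults_base[OF d], of "R y"] y e by (simp add: vdom_mult)
qed

definition vdom_seq :: "('v, 'e, 'g) letter list set \<Rightarrow> 'v \<Rightarrow> ('g \<times> 'e) list \<Rightarrow> nat \<Rightarrow> (real^'n) proj set" where
  "vdom_seq x u ss i = vdom (x \<odot> syl (take i ss)) (end_vertex G u (take i ss))"

lemma vdom_seq_0: "x \<in> FG \<Longrightarrow> vdom_seq x u ss 0 = vdom x u"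
  unfolding vdom_seq_def by simp

lemma vdom_seq_Suc:
  assumes "x \<in> FG" "syllables G u ((r, e) # ss) w"
  shows "vdom_seq x u ((r, e) # ss) (Suc i) =
    vdom_seq (x \<odot> (vtx u r \<odot> edg e)) (ter e) ss i"
proof -
  have "syl (take i ss) \<in> FG"
    using syllables_elt_closed[OF syllables_take[of "ter e" ss w i]] assms(2) by simp
  then show ?thesis unfolding vdom_seq_def using assms by (auto simp: F.m_assoc)
qed

lemma vdom_seq_last:
  "syllables G u ss w \<Longrightarrow> vdom_seq x u ss (length ss) = vdom (x \<odot> syl ss) w"
  unfolding vdom_seq_def using syllables_end by force

text \<open>Adjacency comes from an occulting triple centred at one end of the edge. If the second
  branch is at the far end, the triple there is translated by \<open>edg e\<close>.\<close>

lemma edge_adjacent: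
  assumes ex: "distinct_branches G a b c" and e: "e \<in> Es"
  shows "proj_adjacent (\<Omega> (org e)) (vdom (edg e) (ter e))"
  using distinct_branch_at_edge[OF ex e]
proof (elim disjE exE)
  fix e' \<gamma> assume "distinct_branches G e e' \<gamma>"
  from proj_occults_adjacent(1)[OF occults_base[OF this]] show ?thesis by (rule proj_adjacent_sym)
next
  fix e' \<gamma> assume "distinct_branches G (erev G e) e' \<gamma>"
  from proj_occults_adjacent(1)[OF occults_at[OF this edge_elt_closed[OF e]]]
  have "proj_adjacent (vdom (edg e \<odot> edg (erev G e)) (org e)) (vdom (edg e) (ter e))"
    using e by simp
  then show ?thesis using e by (simp add: edge_elt_erev vdom_one)
qed

lemma adjacent_step:
  assumes ex: "distinct_branches G a b c" and e: "e \<in> Es" and x: "x \<in> FG"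
  shows "proj_adjacent (vdom x (org e)) (vdom (x \<odot> edg e) (ter e))"
proof -
  have "vdom x (org e) = pgl_act (R x) ` \<Omega> (org e)" by (simp add: vdom_def)
  then show ?thesis using proj_adjacent_act[OF edge_adjacent[OF ex e], of "R x"] x e by (simp add: vdom_mult)
qed

text \<open>Each pair of consecutive syllables of a reduced word gives distinct branches at the
  vertex between them, hence an occulting triple; translation by the prefix places it in the
  tree.\<close>

lemma chain_dom_seq:
  assumes ex: "distinct_branches G a b c"
  shows "syllables G u ss w \<Longrightarrow> reduced G ss \<Longrightarrow> x \<in> FG \<Longrightarrow> proj_chain (length ss) (vdom_seq x u ss)"
proof (induction ss arbitrary: x u)
  case Nil then show ?case unfolding proj_chain_def by simp
next
  case (Cons s ss)
  obtain r e where s: "s = (r, e)" by (cases s)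
  have e: "e \<in> Es" "u = org e" "r \<in> carrier (vgrp G u)" "syllables G (ter e) ss w"
    using Cons.prems(1) s by auto
  define y where "y = x \<odot> (vtx u r \<odot> edg e)"
  have cl: "vtx u r \<in> FG" "edg e \<in> FG" using e by auto
  have y: "y \<in> FG" unfolding y_def using Cons.prems(3) cl by simp
  have sq: "vdom_seq x u (s # ss) (Suc i) = vdom_seq y (ter e) ss i" for i
    unfolding y_def s using Cons.prems(1,3) s by (intro vdom_seq_Suc) auto
  have D0: "vdom_seq x u (s # ss) 0 = vdom (x \<odot> vtx u r) u"
    using vdom_seq_0[OF Cons.prems(3)] vdom_vertex_right[OF Cons.prems(3) _ e(3)] e by simp
  have D1: "vdom_seq x u (s # ss) 1 = vdom y (ter e)" using sq[of 0] vdom_seq_0[OF y] by simp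
  have yx: "y = (x \<odot> vtx u r) \<odot> edg e"
    unfolding y_def using Cons.prems(3) cl by (simp add: F.m_assoc)
  show ?case unfolding length_Cons
  proof (rule proj_chain_Suc)
    show "proj_adjacent (vdom_seq x u (s # ss) 0) (vdom_seq x u (s # ss) 1)"
      unfolding D0 D1 unfolding yx using adjacent_step[OF ex e(1), of "x \<odot> vtx u r"] Cons.prems(3) cl e by simp
    show "proj_chain (length ss) (\<lambda>i. vdom_seq x u (s # ss) (Suc i))"
      unfolding sq using Cons.prems(2) reduced_tl by (intro Cons.IH e y) blast
  next
    assume "1 \<le> length ss"
    then obtain r' e' t where t: "ss = (r', e') # t" by (cases ss) auto
    have d: "distinct_branches G (erev G e) e' r'"
      using Cons.prems(1,2) unfolding s t by (rule reduced_pair_distinct)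
    have e': "e' \<in> Es" "ter e = org e'" "r' \<in> carrier (vgrp G (ter e))"
      using e(4) t by auto
    have cl': "vtx (ter e) r' \<in> FG" "edg e' \<in> FG"
      using e' e by auto
    have "vdom_seq x u (s # ss) 2 = vdom_seq y (ter e) ss (Suc 0)" using sq[of 1] by (simp add: numeral_2_eq_2)
    also have "\<dots> = vdom (y \<odot> (vtx (ter e) r' \<odot> edg e')) (ter e')"
    proof -
      have sy: "syllables G (ter e) ((r', e') # t) w" using e(4) unfolding t .
      have "y \<odot> (vtx (ter e) r' \<odot> edg e') \<in> FG"
        using y cl' by simp
      then show ?thesis unfolding t vdom_seq_Suc[OF y sy] by (rule vdom_seq_0)
    qed
    finally have D2: "vdom_seq x u (s # ss) 2 =
        vdom (y \<odot> (vtx (ter e) r' \<odot> edg e')) (ter e')" .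
    \<comment> \<open>Going back over the edge just crossed leads from the second vertex of the
      chain to the first.\<close>
    have "y \<odot> edg (erev G e) = x \<odot> vtx u r"
      unfolding yx using Cons.prems(3) cl by (simp add: edge_elt_erev[OF e(1)] F.m_assoc)
    then show "proj_occults (vdom_seq x u (s # ss) 0) (vdom_seq x u (s # ss) 1) (vdom_seq x u (s # ss) 2)"
      unfolding D0 D1 D2 using occults_at[OF d y] e by simp
  qed
qed

lemma reduced_disjoint:
  assumes "syllables G u ss w" "reduced G ss" "length ss \<ge> 2"
  shows "\<Omega> u \<inter> vdom (syl ss) w = {}"
proof -
  obtain r e r' e' t where t: "ss = (r, e) # (r', e') # t" using assms(3) by (cases ss; cases "tl ss") auto
  have d: "distinct_branches G (erev G e) e' r'" using reduced_pair_distinct assms(1,2) t by blast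
  have "vdom_seq \<one>\<^bsub>F_group G\<^esub> u ss 0 \<inter> vdom_seq \<one>\<^bsub>F_group G\<^esub> u ss (length ss) = {}"
    using assms by (intro proj_chain_disjoint[OF dim] chain_dom_seq[OF d]) auto
  then show ?thesis using syllables_elt_closed[OF assms(1)] by (simp add: vdom_seq_0 vdom_one vdom_seq_last[OF assms(1)])
qed

text \<open>
  The domains at the ends of a reduced path of length at least \<open>2\<close> are disjoint, but those at the ends
  of a single edge are not. A loop edge is excluded by its square, which has length \<open>2\<close>; therefore the
  neighbourhood asks both \<open>a p\<close> and \<open>a\<^sup>2 p\<close> to stay in the domain of \<open>p\<close>.
\<close>

lemma isolating_neighbourhood:
  assumes v0: "v0 \<in> Vs" and df: "discrete_faithful (vgrp G v0) (\<rho> v0)"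
  obtains U where "openin PGL_topology U" "\<one>\<^bsub>PGL\<^esub> \<in> U"
    "\<And>x. gpath G v0 v0 x \<Longrightarrow> R x \<in> U \<Longrightarrow> x = \<one>\<^bsub>F_group G\<^esub>"
proof -
  interpret V: group "vgrp G v0" using vgrp_group[OF v0] .
  have \<rho>: "\<rho> v0 \<in> hom (vgrp G v0) PGL" "inj_on (\<rho> v0) (carrier (vgrp G v0))"
    "subtopology PGL_topology (\<rho> v0 ` carrier (vgrp G v0)) = discrete_topology (\<rho> v0 ` carrier (vgrp G v0))"
    using df unfolding discrete_faithful_def by auto
  have one: "\<rho> v0 \<one>\<^bsub>vgrp G v0\<^esub> = \<one>\<^bsub>PGL\<^esub>" by (rule hom_one[OF \<rho>(1) V.is_group group_PGL])
  \<comment> \<open>Discreteness of the vertex representation isolates the identity among closed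
    paths without edges.\<close>
  have "openin (subtopology PGL_topology (\<rho> v0 ` carrier (vgrp G v0))) {\<one>\<^bsub>PGL\<^esub>}"
    unfolding \<rho>(3) using one by (auto intro: image_eqI[of _ _ "\<one>\<^bsub>vgrp G v0\<^esub>"])
  then obtain U1 where U1: "openin PGL_topology U1" "{\<one>\<^bsub>PGL\<^esub>} = U1 \<inter> \<rho> v0 ` carrier (vgrp G v0)"
    unfolding openin_subtopology by blast
  have vertex_case: "vtx v0 r = \<one>\<^bsub>F_group G\<^esub>" if r: "r \<in> carrier (vgrp G v0)" and U: "R (vtx v0 r) \<in> U1" for r
  proof -
    have "\<rho> v0 r \<in> U1 \<inter> \<rho> v0 ` carrier (vgrp G v0)" using U r by (simp add: R_vertex[OF v0 r])
    then have "\<rho> v0 r = \<rho> v0 \<one>\<^bsub>vgrp G v0\<^esub>" using U1(2) one by auto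
    then have "r = \<one>\<^bsub>vgrp G v0\<^esub>" using inj_onD[OF \<rho>(2)] r by simp
    then show ?thesis using vertex_elt_one[OF v0] by simp
  qed
  show ?thesis
  \<comment> \<open>Without a nonempty reduced closed path, every closed path is a vertex element.
    Otherwise such a path supplies the distinct branches that the chain argument requires.\<close>
  proof (cases "\<forall>ss. syllables G v0 ss v0 \<longrightarrow> reduced G ss \<longrightarrow> ss = []")
    case True
    have "x = \<one>\<^bsub>F_group G\<^esub>" if x: "gpath G v0 v0 x" "R x \<in> U1" for x
    proof -
      obtain ss r where "syllables G v0 ss v0" "reduced G ss" "r \<in> carrier (vgrp G v0)"
        "x = syl ss \<odot> vtx v0 r" using gpath_reduced[OF x(1)] by blast
      moreover from this have "ss = []" using True by blast
      ultimately show ?thesis using vertex_case x(2) v0 by simp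
    qed
    then show ?thesis using that[OF U1(1)] U1(2) by blast
  next
    case False
    then obtain s0 where s0: "syllables G v0 s0 v0" "reduced G s0" "s0 \<noteq> []" by blast
    obtain a b c where ex: "distinct_branches G a b c" using closed_reduced_distinct[OF s0] by blast
    obtain r0 e0 t0 where t0: "s0 = (r0, e0) # t0" using s0(3) by (cases s0) auto
    then have "e0 \<in> Es" "org e0 = v0" using s0 by auto
    \<comment> \<open>A properly convex set may be empty by definition; adjacency provides the test
      point \<open>p\<close>.\<close>
    then have "proj_adjacent (\<Omega> v0) (vdom (edg e0) (ter e0))" using edge_adjacent[OF ex] by blast
    then have "\<Omega> v0 \<noteq> {}" unfolding proj_adjacent_def by blast
    then obtain p where p: "p \<in> \<Omega> v0" by blast
    define U2 where "U2 = {a \<in> carrier PGL. pgl_act a p \<in> \<Omega> v0 \<and> pgl_act a (pgl_act a p) \<in> \<Omega> v0}"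
    have "open (\<Omega> v0)" using domain_convex[OF v0] unfolding properly_convex_def by blast
    then have oU2: "openin PGL_topology U2" unfolding U2_def by (rule openin_PGL_orbit)
    have "\<one>\<^bsub>PGL\<^esub> \<in> U2" unfolding U2_def using p by (simp add: pgl_act_one)
    then have 1: "\<one>\<^bsub>PGL\<^esub> \<in> U1 \<inter> U2" using U1(2) by blast
    have "x = \<one>\<^bsub>F_group G\<^esub>" if x: "gpath G v0 v0 x" "R x \<in> U1 \<inter> U2" for x
    proof -
      obtain ss r where ss: "syllables G v0 ss v0" "reduced G ss" "r \<in> carrier (vgrp G v0)"
        "x = syl ss \<odot> vtx v0 r" using gpath_reduced[OF x(1)] by blast
      have xc: "x \<in> FG" using gpath_closed[OF x(1)] .
      have sc: "syl ss \<in> FG" using syllables_elt_closed[OF ss(1)] .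
      have px: "pgl_act (R x) p \<in> \<Omega> v0" "pgl_act (R x) (pgl_act (R x) p) \<in> \<Omega> v0" using x(2) unfolding U2_def by auto
      consider "ss = []" | "length ss = 1" | "length ss \<ge> 2" by (cases ss; cases "tl ss") auto
      then show ?thesis
      proof cases
        case 1
        then show ?thesis using ss vertex_case x(2) v0 by simp
      next
        case 3
        have "vdom x v0 = vdom (syl ss) v0" unfolding ss(4) using sc v0 ss(3) by (rule vdom_vertex_right)
        then have "pgl_act (R x) p \<in> vdom (syl ss) v0" using p unfolding vdom_def by blast
        then show ?thesis using reduced_disjoint[OF ss(1,2) 3] px(1) by blast
      next
        case 2
        then obtain s e where s: "ss = [(s, e)]" by (cases ss) auto
        have e: "e \<in> Es" "org e = v0" "ter e = v0" "s \<in> carrier (vgrp G v0)" using ss(1) s by auto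
        have rs: "r \<otimes>\<^bsub>vgrp G v0\<^esub> s \<in> carrier (vgrp G v0)" using ss(3) e by simp
        \<comment> \<open>Syllables of the square of \<open>x = s e r\<close>, with the inner
          \<open>r\<close> and \<open>s\<close> merged. The word is reduced whatever this product
          is, since \<open>erev G e\<close> differs from \<open>e\<close>.\<close>
        let ?t = "[(s, e), (r \<otimes>\<^bsub>vgrp G v0\<^esub> s, e)]"
        have t: "syllables G v0 ?t v0" "reduced G ?t" using e rs v0 arev_neq[OF e(1)] by auto
        have cl: "vtx v0 s \<in> FG" "vtx v0 r \<in> FG" "edg e \<in> FG"
          using e v0 ss(3) by auto
        have "x \<odot> x = vtx v0 s \<odot> (edg e \<odot>
           ((vtx v0 r \<odot> vtx v0 s) \<odot> (edg e \<odot> vtx v0 r)))"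
          unfolding ss(4) s using cl e by (simp add: F.m_assoc)
        also have "\<dots> = syl ?t \<odot> vtx v0 r"
          unfolding vertex_elt_mult[OF v0 ss(3) e(4)] using cl e v0 rs by (simp add: F.m_assoc)
        finally have xx: "x \<odot> x = syl ?t \<odot> vtx v0 r" .
        have "vdom (x \<odot> x) v0 = vdom (syl ?t) v0"
          unfolding xx by (rule vdom_vertex_right[OF syllables_elt_closed[OF t(1)] v0 ss(3)])
        moreover have "pgl_act (R x) (pgl_act (R x) p) \<in> vdom (x \<odot> x) v0"
          using p xc by (simp add: vdom_mult) (simp add: vdom_def)
        ultimately show ?thesis using reduced_disjoint[OF t] px(2) by auto
      qed
    qed
    then show ?thesis using that[OF openin_Int[OF U1(1) oU2] 1] by blast
  qed
qed

text \<open>Applying the isolating neighbourhood of the identity to \<open>inv x\<close> times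
  \<open>y\<close> gives injectivity; its translate by \<open>R x\<close> isolates
  \<open>R x\<close> in the image.\<close>

theorem pi1_discrete_faithful:
  assumes v0: "v0 \<in> Vs" and df: "discrete_faithful (vgrp G v0) (\<rho> v0)"
  shows "discrete_faithful (pi1 G v0) R"
proof -
  obtain U where U: "openin PGL_topology U" "\<one>\<^bsub>PGL\<^esub> \<in> U"
    "\<And>x. gpath G v0 v0 x \<Longrightarrow> R x \<in> U \<Longrightarrow> x = \<one>\<^bsub>F_group G\<^esub>" using isolating_neighbourhood[OF assms] by blast
  have car: "x \<in> carrier (pi1 G v0) \<longleftrightarrow> gpath G v0 v0 x" for x by (simp add: pi1_def F_paths_iff)
  have hom: "R \<in> hom (pi1 G v0) PGL"
    unfolding hom_def using car gpath_closed by (auto simp: pi1_def F_paths_iff)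
  have key: "y = x" if x: "gpath G v0 v0 x" and y: "gpath G v0 v0 y" and u: "inv\<^bsub>PGL\<^esub> (R x) \<otimes>\<^bsub>PGL\<^esub> R y \<in> U" for x y
  proof -
    have c: "x \<in> FG" "y \<in> FG" using gpath_closed x y by auto
    have "R (inv\<^sub>F x \<odot> y) \<in> U" using u c by simp
    then have "inv\<^sub>F x \<odot> y = \<one>\<^bsub>F_group G\<^esub>" using U(3) gpath_mult[OF gpath_inv[OF x] y] by blast
    then show ?thesis using c by (metis F.inv_closed F.inv_equality F.inv_inv F.l_inv F.inv_comm)
  qed
  have inj: "inj_on R (carrier (pi1 G v0))"
  proof (rule inj_onI)
    fix x y assume xy: "x \<in> carrier (pi1 G v0)" "y \<in> carrier (pi1 G v0)" "R x = R y"
    then have p: "gpath G v0 v0 x" "gpath G v0 v0 y" using car by auto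
    have "inv\<^bsub>PGL\<^esub> (R x) \<otimes>\<^bsub>PGL\<^esub> R y \<in> U" using xy(3) U(2) gpath_closed[OF p(2)] by simp
    then show "x = y" using key[OF p] by simp
  qed
  let ?S = "R ` carrier (pi1 G v0)"
  have ts: "topspace PGL_topology = (carrier PGL :: (real^'n^'n) set set)"
  proof -
    have "openin PGL_topology (topspace (PGL_topology :: (real^'n^'n) set topology))" by simp
    then have "topspace PGL_topology \<subseteq> (carrier PGL :: (real^'n^'n) set set)" unfolding openin_PGL_topology by blast
    moreover have "openin PGL_topology {a \<in> (carrier PGL :: (real^'n^'n) set set). True}"
      by (rule openin_PGL_I[of UNIV]) auto
    then have "carrier PGL \<subseteq> topspace (PGL_topology :: (real^'n^'n) set topology)" using openin_subset by force
    ultimately show ?thesis by blast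
  qed
  have "discrete_topology ?S = subtopology PGL_topology ?S"
    unfolding discrete_topology_unique
  proof
    show "topspace (subtopology PGL_topology ?S) = ?S"
      using ts hom by (auto simp: hom_def)
    show "\<forall>a\<in>?S. openin (subtopology PGL_topology ?S) {a}"
    proof
      fix a assume "a \<in> ?S"
      then obtain x where x: "gpath G v0 v0 x" "a = R x" using car by blast
      have xc: "x \<in> FG" using gpath_closed[OF x(1)] .
      define Ux where "Ux = {b \<in> carrier PGL. inv\<^bsub>PGL\<^esub> (R x) \<otimes>\<^bsub>PGL\<^esub> b \<in> U}"
      have o: "openin PGL_topology Ux" unfolding Ux_def using xc by (intro openin_PGL_translate[OF U(1)]) simp
      have "Ux \<inter> ?S = {a}"
      proof
        show "Ux \<inter> ?S \<subseteq> {a}" using key[OF x(1)] x(2) car unfolding Ux_def by blast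
        have "R x \<in> Ux" unfolding Ux_def using xc U(2) by simp
        then show "{a} \<subseteq> Ux \<inter> ?S" using x car by blast
      qed
      then show "openin (subtopology PGL_topology ?S) {a}" unfolding openin_subtopology using o by metis
    qed
  qed
  then show ?thesis unfolding discrete_faithful_def using hom inj by simp
qed

end

section \<open>The union of the edge hulls\<close>

lemma (in graph_of_groups) syllables_snoc:
  assumes "syllables G u (t @ [(r, e)]) w"
  shows "e \<in> Es \<and> org e = end_vertex G u t \<and> r \<in> carrier (vgrp G (org e)) \<and>
    end_vertex G u (t @ [(r, e)]) = ter e \<and>
    syl (t @ [(r, e)]) =
      syl t \<odot> (vtx (org e) r \<odot> edg e)"
  using assms
proof (induction t arbitrary: u)
  case Nil then show ?case by auto
next
  case (Cons s t)
  obtain r' e' where s: "s = (r', e')" by (cases s)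
  have p: "e' \<in> Es" "u = org e'" "r' \<in> carrier (vgrp G (org e'))"
    "syllables G (ter e') (t @ [(r, e)]) w" using Cons.prems s by auto
  note IH = Cons.IH[OF p(4)]
  define X where "X = vtx (org e) r \<odot> edg e"
  have X: "X \<in> FG" using IH unfolding X_def by (intro F.m_closed vertex_elt_closed edge_elt_closed head_tail_verts) blast+
  have "syl t \<in> FG"
    using syllables_elt_closed[OF syllables_take[OF p(4), of "length t"]] by simp
  then have "syl ((s # t) @ [(r, e)]) = syl (s # t) \<odot> X"
    using IH X p(1,3) unfolding s X_def[symmetric] by (simp add: F.m_assoc)
  then show ?case using IH unfolding s X_def by (elim conjE) simp
qed

context occulting_gog begin

text \<open>
  The edge of the universal covering tree from \<open>x\<close> to \<open>x e\<close>.
\<close>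

definition is_edge :: "'v \<Rightarrow> ('v, 'e, 'g) letter list set \<Rightarrow> 'e \<Rightarrow> bool" where
  "is_edge v0 x e \<longleftrightarrow> e \<in> Es \<and> gpath G v0 (org e) x"

lemma gpath_edge_right: "is_edge v0 x e \<Longrightarrow> gpath G v0 (ter e) (x \<odot> edg e)"
  unfolding is_edge_def using gpath_mult gpath_edge by blast

text \<open>An element of the edge group slides across \<open>e\<close> and is absorbed by the
  invariance of the domain at the far end.\<close>

lemma branch_dom_eq:
  assumes e: "e \<in> Es" and x: "x \<in> FG" and \<gamma>: "\<gamma> \<in> carrier (egrp G (uedge G e))"
  shows "vdom (x \<odot> (vtx (org e) (emb G e \<gamma>) \<odot> edg e)) (ter e) =
    vdom (x \<odot> edg e) (ter e)"
proof -
  note c = emb_closed[OF e \<gamma>]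
  have "x \<odot> (vtx (org e) (emb G e \<gamma>) \<odot> edg e) =
      (x \<odot> edg e) \<odot> vtx (ter e) (emb G (erev G e) \<gamma>)"
    unfolding edge_conj[OF e \<gamma>] using x e c by (simp add: F.m_assoc)
  then show ?thesis using vdom_vertex_right[of "x \<odot> edg e" "ter e"] x e c by simp
qed

text \<open>Moving the base representative from \<open>y\<close> to \<open>y r\<close> turns the two
  branches into \<open>(e, 1)\<close> and \<open>(e', \<delta>)\<close> with
  \<open>\<delta> = inv r * r'\<close>. If this were not a distinct pair,
  \<open>branch_dom_eq\<close> would identify the two domains.\<close>

lemma branches_occult:
  assumes y: "y \<in> FG" and e: "e \<in> Es" "e' \<in> Es" "org e = v" "org e' = v"
    and r: "r \<in> carrier (vgrp G v)" "r' \<in> carrier (vgrp G v)"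
    and neq: "vdom (y \<odot> (vtx v r \<odot> edg e)) (ter e) \<noteq>
      vdom (y \<odot> (vtx v r' \<odot> edg e')) (ter e')" (is "?A \<noteq> ?C")
  shows "proj_occults (vdom (y \<odot> (vtx v r \<odot> edg e)) (ter e)) (vdom y v)
      (vdom (y \<odot> (vtx v r' \<odot> edg e')) (ter e'))"
proof -
  have v: "v \<in> Vs" using e by auto
  interpret V: group "vgrp G v" using vgrp_group[OF v] .
  define z where "z = y \<odot> vtx v r"
  define \<delta> where "\<delta> = inv\<^bsub>vgrp G v\<^esub> r \<otimes>\<^bsub>vgrp G v\<^esub> r'"
  have \<delta>: "\<delta> \<in> carrier (vgrp G v)" unfolding \<delta>_def using r by simp
  have z: "z \<in> FG" unfolding z_def using y v r by simp
  have A: "?A = vdom (z \<odot> edg e) (ter e)" unfolding z_def using y v r e by (simp add: F.m_assoc)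
  have "r \<otimes>\<^bsub>vgrp G v\<^esub> \<delta> = r'" unfolding \<delta>_def using r by (simp add: V.m_assoc[symmetric])
  then have rr: "vtx v r \<odot> vtx v \<delta> = vtx v r'" using vertex_elt_mult[OF v r(1) \<delta>] by simp
  have "z \<odot> (vtx v \<delta> \<odot> edg e') =
      y \<odot> ((vtx v r \<odot> vtx v \<delta>) \<odot> edg e')"
    unfolding z_def using y v r \<delta> e by (simp add: F.m_assoc)
  then have C: "?C = vdom (z \<odot> (vtx v \<delta> \<odot> edg e')) (ter e')" unfolding rr by simp
  have "distinct_branches G e e' \<delta>"
  proof (rule ccontr)
    assume "\<not> ?thesis"
    then have ee: "e = e'" "\<delta> \<in> emb G e ` carrier (egrp G (uedge G e))"
      unfolding distinct_branches_def using e \<delta> by auto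
    then obtain \<gamma> where "\<gamma> \<in> carrier (egrp G (uedge G e))" "\<delta> = emb G e \<gamma>" by blast
    then have "?C = vdom (z \<odot> edg e) (ter e)" using branch_dom_eq[OF e(1) z] C ee(1) e(3) by simp
    then show False using neq A by simp
  qed
  from occults_at[OF this z] show ?thesis unfolding A C
    using vdom_vertex_right[OF y v r(1)] e(3) unfolding z_def by simp
qed

text \<open>The tree is viewed from a vertex with two different branches. Every other vertex is the
  end of a nonempty reduced path from there, so the branch theorem gives one form and one constant
  for all domains.\<close>

lemma common_form:
  assumes ex: "distinct_branches G a b c" and v0: "v0 \<in> Vs"
  obtains f \<epsilon> where "\<epsilon> > 0"
    "\<And>x w. gpath G v0 w x \<Longrightarrow> \<exists>K. proper_cone K \<and> vdom x w = proj_pt ` K \<and> (\<forall>k\<in>K. \<epsilon> * norm k \<le> f \<bullet> k)"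
proof -
  let ?v = "org a"
  have ab: "a \<in> Es" "b \<in> Es" "org b = ?v" "c \<in> carrier (vgrp G ?v)"
    using ex unfolding distinct_branches_def by auto
  have v: "?v \<in> Vs" using ab by simp
  interpret V: group "vgrp G ?v" using vgrp_group[OF v] .
  obtain y where y: "gpath G v0 ?v y" using gpath_exists[OF v0 v] by blast
  have yc: "y \<in> FG" using gpath_closed[OF y] .
  have occ: "proj_occults (vdom (y \<odot> edg a) (ter a)) (vdom y ?v)
      (vdom (y \<odot> (vtx ?v c \<odot> edg b)) (ter b))"
    using occults_at[OF ex yc] .
  then obtain B where B: "proper_cone B" "vdom y ?v = proj_pt ` B" unfolding proj_occults_def by blast
  define J where "J = {ss. (\<exists>w. syllables G ?v ss w) \<and> reduced G ss \<and> ss \<noteq> []}"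
  \<comment> \<open>The given distinct pair as one-edge paths; their domains are disjoint and
    nonempty, hence different.\<close>
  let ?j1 = "[(\<one>\<^bsub>vgrp G ?v\<^esub>, a)]" and ?j2 = "[(c, b)]"
  have first: "vdom_seq y ?v ((r, e) # ss) 1 =
      vdom (y \<odot> (vtx ?v r \<odot> edg e)) (ter e)"
    if s: "syllables G ?v ((r, e) # ss) w" for r e ss w
  proof -
    have "e \<in> Es" "r \<in> carrier (vgrp G ?v)" using s by auto
    then have "y \<odot> (vtx ?v r \<odot> edg e) \<in> FG"
      using yc v by simp
    then show ?thesis using vdom_seq_Suc[OF yc s, of 0] by (simp add: vdom_seq_0)
  qed
  have s1: "syllables G ?v ?j1 (ter a)" and s2: "syllables G ?v ?j2 (ter b)" using ab by auto
  obtain f \<epsilon> where f: "\<epsilon> > 0" "\<And>x. x \<in> B \<Longrightarrow> \<epsilon> * norm x \<le> f \<bullet> x"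
    "\<And>ss. ss \<in> J \<Longrightarrow> \<exists>K. proper_cone K \<and> vdom_seq y ?v ss (length ss) = proj_pt ` K \<and> (\<forall>x\<in>K. \<epsilon> * norm x \<le> f \<bullet> x)"
  proof (rule branches_common_form[OF dim B(1), where J = J and A = "vdom_seq y ?v" and n = length])
    show "vdom_seq y ?v j 0 = proj_pt ` B" for j using B(2) vdom_seq_0[OF yc] by simp
    show "1 \<le> length j" if "j \<in> J" for j using that unfolding J_def by (cases j) auto
    show "proj_chain (length j) (vdom_seq y ?v j)" if "j \<in> J" for j
      using that chain_dom_seq[OF ex _ _ yc] unfolding J_def by blast
    show "proj_occults (vdom_seq y ?v j 1) (proj_pt ` B) (vdom_seq y ?v j' 1)"
      if jj: "j \<in> J" "j' \<in> J" "vdom_seq y ?v j 1 \<noteq> vdom_seq y ?v j' 1" for j j'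
    proof -
      obtain r e t w where j: "j = (r, e) # t" "syllables G ?v ((r, e) # t) w" using jj(1) unfolding J_def by (cases j) auto
      obtain r' e' t' w' where j': "j' = (r', e') # t'" "syllables G ?v ((r', e') # t') w'" using jj(2) unfolding J_def by (cases j') auto
      have "proj_occults (vdom (y \<odot> (vtx ?v r \<odot> edg e)) (ter e)) (vdom y ?v)
          (vdom (y \<odot> (vtx ?v r' \<odot> edg e')) (ter e'))"
        using j(2) j'(2) jj(3) unfolding j(1) j'(1) first[OF j(2)] first[OF j'(2)]
        by (intro branches_occult[OF yc]) auto
      then show ?thesis unfolding j(1) j'(1) first[OF j(2)] first[OF j'(2)] B(2) .
    qed
    show "?j1 \<in> J" unfolding J_def by (intro CollectI conjI exI[of _ "ter a"] s1) simp_all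
    show "?j2 \<in> J" unfolding J_def by (intro CollectI conjI exI[of _ "ter b"] s2) simp_all
    show "vdom_seq y ?v ?j1 1 \<noteq> vdom_seq y ?v ?j2 1"
    proof -
      have "vdom (y \<odot> edg a) (ter a) \<noteq> {}" using occ unfolding proj_occults_def by blast
      moreover have "vdom (y \<odot> edg a) (ter a) \<inter>
        vdom (y \<odot> (vtx ?v c \<odot> edg b)) (ter b) = {}"
        using occ unfolding proj_occults_def by blast
      moreover have "vtx ?v \<one>\<^bsub>vgrp G ?v\<^esub> \<odot> edg a = edg a" using vertex_elt_one[OF v] ab by simp
      ultimately show ?thesis unfolding first[OF s1] first[OF s2] by auto
    qed
  qed auto
  show ?thesis
  proof (rule that[OF f(1)])
    fix x w assume x: "gpath G v0 w x"
    have xc: "x \<in> FG" using gpath_closed[OF x] .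
    obtain ss r where ss: "syllables G ?v ss w" "reduced G ss" "r \<in> carrier (vgrp G w)"
      "inv\<^sub>F y \<odot> x = syl ss \<odot> vtx w r"
      using gpath_reduced[OF gpath_mult[OF gpath_inv[OF y] x]] by blast
    have w: "w \<in> Vs" using gpath_verts[OF x] by simp
    have sc: "syl ss \<in> FG" using syllables_elt_closed[OF ss(1)] .
    \<comment> \<open>A path based at \<open>v0\<close> is rewritten as one leaving from the chosen
      vertex \<open>y\<close>.\<close>
    have "x = y \<odot> (inv\<^sub>F y \<odot> x)" using xc yc by (simp add: F.m_assoc[symmetric])
    then have "x = (y \<odot> syl ss) \<odot> vtx w r"
      unfolding ss(4) using yc sc w ss(3) by (simp add: F.m_assoc)
    then have "vdom x w = vdom (y \<odot> syl ss) w"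
      using vdom_vertex_right[OF _ w ss(3)] yc sc by simp
    then have d: "vdom x w = vdom_seq y ?v ss (length ss)" using vdom_seq_last[OF ss(1)] by simp
    show "\<exists>K. proper_cone K \<and> vdom x w = proj_pt ` K \<and> (\<forall>k\<in>K. \<epsilon> * norm k \<le> f \<bullet> k)"
    proof (cases "ss = []")
      case True
      then show ?thesis using d B f(2) vdom_seq_0[OF yc] by (intro exI[of _ B]) auto
    next
      case False
      then have "ss \<in> J" using ss unfolding J_def by blast
      then show ?thesis using f(3) d by simp
    qed
  qed
qed

lemma edge_hull_cones:
  assumes ex: "distinct_branches G a b c" and e: "e \<in> Es"
  obtains K L where "proper_cone K" "proper_cone L" "\<Omega> (org e) = proj_pt ` K"
    "vdom (edg e) (ter e) = proj_pt ` L" "K \<inter> L \<noteq> {}"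
    "edge_hull G g \<Omega> e = proj_pt ` cone_sum K L" "proper_cone (cone_sum K L)"
    "proj_hull_well_defined (\<Omega> (org e) \<union> pgl_act (g e) ` \<Omega> (ter e))"
proof -
  obtain K L where KL: "proper_cone K" "proper_cone L" "\<Omega> (org e) = proj_pt ` K"
    "vdom (edg e) (ter e) = proj_pt ` L" "K \<inter> L \<noteq> {}" "strict_dual K \<inter> strict_dual L \<noteq> {}"
    using edge_adjacent[OF ex e] unfolding proj_adjacent_def by blast
  obtain f where f: "f \<in> strict_dual K" "f \<in> strict_dual L" using KL(6) by blast
  have u: "\<Omega> (org e) \<union> pgl_act (g e) ` \<Omega> (ter e) = proj_pt ` K \<union> proj_pt ` L"
    using KL(3,4) R_edge[OF e] unfolding vdom_def by simp
  show ?thesis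
    by (rule that[OF KL(1-5)])
      (use proj_hull_cones[OF KL(1,2,5) f] proper_cone_sum[OF KL(1,2) f] u in \<open>auto simp: edge_hull_def\<close>)
qed

text \<open>The reduced path from \<open>x1\<close> to \<open>x2\<close> is used as it stands if it
  starts by crossing the given edge; otherwise it is started one step earlier, at the other end of
  that edge. In both cases the first two domains are those of the edge, in one of the two
  orders.\<close>

lemma chain_through_edge:
  assumes e1: "is_edge v0 x1 e1" and x2: "gpath G v0 w2 x2"
  obtains x u ss where "gpath G v0 u x" "syllables G u ss w2" "reduced G ss" "ss \<noteq> []"
    "vdom_seq x u ss (length ss) = vdom x2 w2"
    "vdom_seq x u ss 0 = vdom x1 (org e1) \<and> vdom_seq x u ss 1 = vdom (x1 \<odot> edg e1) (ter e1) \<or>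
     vdom_seq x u ss 1 = vdom x1 (org e1) \<and> vdom_seq x u ss 0 = vdom (x1 \<odot> edg e1) (ter e1)"
proof -
  have e: "e1 \<in> Es" and x1: "gpath G v0 (org e1) x1" using e1 unfolding is_edge_def by auto
  have c: "x1 \<in> FG" "x2 \<in> FG" "edg e1 \<in> FG"
    using gpath_closed x1 x2 e by auto
  let ?v = "org e1" and ?h = "ter e1"
  have hv: "?v \<in> Vs" "?h \<in> Vs" using e by auto
  obtain ss r where ss: "syllables G ?v ss w2" "reduced G ss" "r \<in> carrier (vgrp G w2)"
    "inv\<^sub>F x1 \<odot> x2 = syl ss \<odot> vtx w2 r"
    using gpath_reduced[OF gpath_mult[OF gpath_inv[OF x1] x2]] by blast
  have w: "w2 \<in> Vs" using gpath_verts[OF x2] by simp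
  have sc: "syl ss \<in> FG" using syllables_elt_closed[OF ss(1)] .
  have "x2 = x1 \<odot> (inv\<^sub>F x1 \<odot> x2)" using c by (simp add: F.m_assoc[symmetric])
  then have "x2 = (x1 \<odot> syl ss) \<odot> vtx w2 r"
    unfolding ss(4) using c sc w ss(3) by (simp add: F.m_assoc)
  then have d2: "vdom x2 w2 = vdom (x1 \<odot> syl ss) w2"
    using vdom_vertex_right[OF _ w ss(3)] c sc by simp
  show ?thesis
  proof (cases "\<exists>\<gamma> t. \<gamma> \<in> carrier (egrp G (uedge G e1)) \<and> ss = (emb G e1 \<gamma>, e1) # t")
    case True
    then obtain \<gamma> t where t: "\<gamma> \<in> carrier (egrp G (uedge G e1))" "ss = (emb G e1 \<gamma>, e1) # t" by blast
    have y: "x1 \<odot> (vtx ?v (emb G e1 \<gamma>) \<odot> edg e1) \<in> FG"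
      using c emb_closed(1)[OF e t(1)] hv by simp
    have "vdom_seq x1 ?v ss 1 = vdom (x1 \<odot> edg e1) ?h"
      using vdom_seq_Suc[OF c(1), of ?v "emb G e1 \<gamma>" e1 t w2 0] ss(1) t(2) vdom_seq_0[OF y] branch_dom_eq[OF e c(1) t(1)] by simp
    then show ?thesis using that[OF x1 ss(1,2)] t(2) vdom_seq_last[OF ss(1)] d2 vdom_seq_0[OF c(1)] by simp
  next
    case False
    \<comment> \<open>The prefixed step crosses the edge backwards; a backtrack with the next
      syllable would mean that \<open>ss\<close> crosses the same tree edge, the case just
      excluded.\<close>
    let ?t = "(\<one>\<^bsub>vgrp G ?h\<^esub>, erev G e1) # ss" and ?x = "x1 \<odot> edg e1"
    have x: "gpath G v0 ?h ?x" using gpath_edge_right[OF e1] .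
    have t: "syllables G ?h ?t w2" using e ss(1) vgrp_one_closed[OF hv(2)] by simp
    have red: "reduced G ?t"
    proof (cases ss)
      case (Cons s q)
      obtain r' e' where s: "s = (r', e')" by (cases s)
      have "\<not> (e' = e1 \<and> r' \<in> emb G e1 ` carrier (egrp G (uedge G e1)))" using False Cons s by blast
      then show ?thesis using ss(2) Cons s by auto
    qed simp
    have xx: "?x \<odot> (vtx ?h \<one>\<^bsub>vgrp G ?h\<^esub> \<odot> edg (erev G e1)) = x1"
      using c vertex_elt_one[OF hv(2)] edge_elt_erev[OF e] by (simp add: F.m_assoc)
    have xc: "?x \<in> FG" using c by simp
    have "vdom_seq ?x ?h ?t 1 = vdom x1 ?v"
      using vdom_seq_Suc[OF xc t, of 0] e unfolding xx by (simp add: vdom_seq_0[OF c(1)])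
    moreover have "vdom_seq ?x ?h ?t 0 = vdom ?x ?h" by (rule vdom_seq_0[OF xc])
    moreover have "vdom_seq ?x ?h ?t (length ?t) = vdom x2 w2"
    proof -
      have "?x \<odot> syl ?t =
          (?x \<odot> (vtx ?h \<one>\<^bsub>vgrp G ?h\<^esub> \<odot> edg (erev G e1))) \<odot> syl ss"
        using c sc e vgrp_one_closed[OF hv(2)] hv by (simp add: F.m_assoc)
      then show ?thesis unfolding vdom_seq_last[OF t] d2 xx by simp
    qed
    ultimately show ?thesis using that[OF x t red] by simp
  qed
qed

lemma vdom_seq_step:
  assumes x: "gpath G v0 u x" and ss: "syllables G u ss w" and i: "i < length ss"
  obtains y e where "is_edge v0 y e" "vdom_seq x u ss i = vdom y (org e)"
    "vdom_seq x u ss (Suc i) = vdom (y \<odot> edg e) (ter e)"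
proof -
  obtain r e where re: "ss ! i = (r, e)" by (cases "ss ! i")
  let ?t = "take i ss"
  let ?y = "x \<odot> syl ?t"
  have tS: "take (Suc i) ss = ?t @ [(r, e)]" using i re by (simp add: take_Suc_conv_app_nth)
  have sy: "syllables G u (?t @ [(r, e)]) (end_vertex G u (take (Suc i) ss))"
    using syllables_take[OF ss, of "Suc i"] tS by simp
  have e: "e \<in> Es" and te: "end_vertex G u ?t = org e" and r: "r \<in> carrier (vgrp G (org e))"
    and he: "end_vertex G u (?t @ [(r, e)]) = ter e"
    and se: "syl (?t @ [(r, e)]) =
      syl ?t \<odot> (vtx (org e) r \<odot> edg e)"
    using syllables_snoc[OF sy] by auto
  let ?r = "vtx (org e) r"
  have v: "org e \<in> Vs" using e by simp
  have tc: "syl ?t \<in> FG" using syllables_elt_closed[OF syllables_take[OF ss]] .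
  have xc: "x \<in> FG" using gpath_closed[OF x] .
  have y: "gpath G v0 (org e) ?y" using gpath_mult[OF x gpath_syllables[OF syllables_take[OF ss, of i]]] te by simp
  show ?thesis
  proof (rule that[of "?y \<odot> ?r" e])
    show "is_edge v0 (?y \<odot> ?r) e" unfolding is_edge_def using gpath_mult[OF y gpath.nil[OF v r]] e by blast
    show "vdom_seq x u ss i = vdom (?y \<odot> ?r) (org e)"
      unfolding vdom_seq_def te by (rule vdom_vertex_right[OF gpath_closed[OF y] v r, symmetric])
    have "x \<odot> syl (take (Suc i) ss) = (?y \<odot> ?r) \<odot> edg e"
      unfolding tS se using xc tc e v r by (simp add: F.m_assoc)
    then show "vdom_seq x u ss (Suc i) = vdom ((?y \<odot> ?r) \<odot> edg e) (ter e)"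
      unfolding vdom_seq_def using he tS by simp
  qed
qed

text \<open>
  A form positive on suitable lifts of all domains selects these lifts consistently over the whole
  tree: \<open>cone A\<close> is the lift of \<open>A\<close> on its positive side.
\<close>

theorem total_domain_properly_convex:
  assumes ex: "distinct_branches G a b c" and v0: "v0 \<in> Vs"
  shows "properly_convex (total_domain G v0 R g \<Omega>)"
proof (rule common_form[OF ex v0])
  fix f \<epsilon> assume \<epsilon>: "\<epsilon> > 0"
    and fK: "\<And>x w. gpath G v0 w x \<Longrightarrow> \<exists>K. proper_cone K \<and> vdom x w = proj_pt ` K \<and> (\<forall>k\<in>K. \<epsilon> * norm k \<le> f \<bullet> k)"
  define cone where "cone A = {k. 0 < f \<bullet> k \<and> proj_pt k \<in> A}" for A
  have pos: "f \<bullet> k > 0" if "proper_cone K" "\<forall>k\<in>K. \<epsilon> * norm k \<le> f \<bullet> k" "k \<in> K" for K k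
  proof -
    have "k \<noteq> 0" using zero_notin_cone[OF that(1)] that(3) by blast
    then show ?thesis using that(2,3) \<epsilon> by (meson less_le_trans mult_pos_pos zero_less_norm_iff)
  qed
  have coneK: "cone (proj_pt ` K) = K" if K: "proper_cone K" "\<forall>k\<in>K. \<epsilon> * norm k \<le> f \<bullet> k" for K
  proof (intro Set.set_eqI iffI)
    fix k assume "k \<in> cone (proj_pt ` K)"
    then have k: "f \<bullet> k > 0" "proj_pt k \<in> proj_pt ` K" unfolding cone_def by auto
    then have "k \<noteq> 0" by auto
    then have "k \<in> K \<or> - k \<in> K" using proj_pt_in_cone_iff[OF K(1)] k by blast
    moreover have "- k \<notin> K" using pos[OF K, of "- k"] k by auto
    ultimately show "k \<in> K" by blast
  next
    fix k assume "k \<in> K"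
    then show "k \<in> cone (proj_pt ` K)" unfolding cone_def using pos[OF K] by blast
  qed
  have cone: "proper_cone (cone (vdom x w))" "vdom x w = proj_pt ` cone (vdom x w)"
    "\<forall>k\<in>cone (vdom x w). \<epsilon> * norm k \<le> f \<bullet> k" if x: "gpath G v0 w x" for x w
  proof -
    obtain K where K: "proper_cone K" "vdom x w = proj_pt ` K" "\<forall>k\<in>K. \<epsilon> * norm k \<le> f \<bullet> k" using fK[OF x] by blast
    then show "proper_cone (cone (vdom x w))" "vdom x w = proj_pt ` cone (vdom x w)"
      "\<forall>k\<in>cone (vdom x w). \<epsilon> * norm k \<le> f \<bullet> k" using coneK[OF K(1,3)] by auto
  qed
  have cone_meet: "cone A \<inter> cone B \<noteq> {}"
    if A: "A = proj_pt ` cone A" "proper_cone (cone A)" and AB: "A \<inter> B \<noteq> {}" for A B :: "(real^'n) proj set"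
  proof -
    obtain p where p: "p \<in> A" "p \<in> B" using AB by blast
    then obtain k where k: "k \<in> cone A" "p = proj_pt k" using A(1) by blast
    then have "k \<in> cone B" using p unfolding cone_def by auto
    then show ?thesis using k by blast
  qed
  \<comment> \<open>Union of the lifts of all translated edge hulls; closure under addition is what
    makes the total domain convex.\<close>
  define W where "W = \<Union> {cone_sum (cone (vdom x (org e))) (cone (vdom (x \<odot> edg e) (ter e)))
     | x e. is_edge v0 x e}"
  have edge_cones: "proper_cone (cone (vdom x (org e)))"
    "proper_cone (cone (vdom (x \<odot> edg e) (ter e)))"
    "cone (vdom x (org e)) \<inter> cone (vdom (x \<odot> edg e) (ter e)) \<noteq> {}"
    if xe: "is_edge v0 x e" for x e
  proof -
    have e: "e \<in> Es" and x: "gpath G v0 (org e) x" using xe unfolding is_edge_def by auto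
    show 1: "proper_cone (cone (vdom x (org e)))" using cone(1)[OF x] .
    show "proper_cone (cone (vdom (x \<odot> edg e) (ter e)))" using cone(1)[OF gpath_edge_right[OF xe]] .
    have "proj_adjacent (vdom x (org e)) (vdom (x \<odot> edg e) (ter e))"
      by (rule adjacent_step[OF ex e gpath_closed[OF x]])
    then have "vdom x (org e) \<inter> vdom (x \<odot> edg e) (ter e) \<noteq> {}"
      unfolding proj_adjacent_def by blast
    then show "cone (vdom x (org e)) \<inter> cone (vdom (x \<odot> edg e) (ter e)) \<noteq> {}"
      using cone_meet[OF cone(2)[OF x] 1] by blast
  qed
  have hull: "pgl_act (R x) ` edge_hull G g \<Omega> e =
      proj_pt ` cone_sum (cone (vdom x (org e))) (cone (vdom (x \<odot> edg e) (ter e)))"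
    if xe: "is_edge v0 x e" for x e
  proof -
    have e: "e \<in> Es" and x: "gpath G v0 (org e) x" using xe unfolding is_edge_def by auto
    have xc: "x \<in> FG" using gpath_closed[OF x] .
    let ?P = "cone (vdom x (org e))" and ?Q = "cone (vdom (x \<odot> edg e) (ter e))"
    obtain K L where KL: "proper_cone K" "proper_cone L" "\<Omega> (org e) = proj_pt ` K"
      "vdom (edg e) (ter e) = proj_pt ` L" "K \<inter> L \<noteq> {}"
      "edge_hull G g \<Omega> e = proj_pt ` cone_sum K L" "proper_cone (cone_sum K L)"
      by (rule edge_hull_cones[OF ex e])
    obtain M where M: "invertible M" "R x = pgl M" using PGL_rep[of "R x"] xc by auto
    have K': "proper_cone ((*v) M ` K)" "proper_cone ((*v) M ` L)" using proper_cone_mat_image[OF M(1)] KL by auto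
    have P: "proj_pt ` ?P = proj_pt ` (*v) M ` K"
      using cone(2)[OF x] pgl_act_cone[OF M(1) zero_notin_cone[OF KL(1)]] KL(3) M(2) unfolding vdom_def by simp
    have Q: "proj_pt ` ?Q = proj_pt ` (*v) M ` L"
      using cone(2)[OF gpath_edge_right[OF xe]] pgl_act_cone[OF M(1) zero_notin_cone[OF KL(2)]] KL(4) M(2)
        vdom_mult[OF xc edge_elt_closed[OF e]] by simp
    have H: "pgl_act (R x) ` edge_hull G g \<Omega> e = proj_pt ` cone_sum ((*v) M ` K) ((*v) M ` L)"
      unfolding KL(6) M(2) pgl_act_cone[OF M(1) zero_notin_cone[OF KL(7)]] cone_sum_mat_image ..
    have sK: "(*v) M ` K = ?P \<or> (*v) M ` K = uminus ` ?P" by (rule cone_lift_unique[OF edge_cones(1)[OF xe] K'(1) P])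
    have sL: "(*v) M ` L = ?Q \<or> (*v) M ` L = uminus ` ?Q" by (rule cone_lift_unique[OF edge_cones(2)[OF xe] K'(2) Q])
    obtain z where z: "z \<in> (*v) M ` K" "z \<in> (*v) M ` L" using KL(5) by blast
    have pp: "f \<bullet> k > 0" if "k \<in> cone A" for k A using that unfolding cone_def by simp
    \<comment> \<open>Mixed signs are impossible, as the common point \<open>z\<close> would get
      both signs under \<open>f\<close>; the third alternative records this contradiction.\<close>
    consider "(*v) M ` K = ?P" "(*v) M ` L = ?Q" | "(*v) M ` K = uminus ` ?P" "(*v) M ` L = uminus ` ?Q"
      | "f \<bullet> z > 0" "f \<bullet> z < 0"
    proof -
      have n: "f \<bullet> z < 0" if "z \<in> uminus ` cone A" for A using that pp by force
      show ?thesis using that sK sL z pp n by metis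
    qed
    then show ?thesis
    proof cases
      case 2 then show ?thesis unfolding H by (simp only: cone_sum_uminus proj_pt_uminus_image)
    qed (use H in simp_all)
  qed
  have tot: "total_domain G v0 R g \<Omega> = proj_pt ` W"
  proof -
    have "total_domain G v0 R g \<Omega> = \<Union> {pgl_act (R x) ` edge_hull G g \<Omega> e | x e. is_edge v0 x e}"
      unfolding total_domain_def is_edge_def F_paths_iff[symmetric] using head_tail_verts(1) by blast
    also have "{pgl_act (R x) ` edge_hull G g \<Omega> e | x e. is_edge v0 x e} =
        {proj_pt ` cone_sum (cone (vdom x (org e))) (cone (vdom (x \<odot> edg e) (ter e))) | x e. is_edge v0 x e}"
      by (intro Collect_cong ex_cong1 rev_conj_cong refl) (simp only: hull)
    also have "\<Union> \<dots> = proj_pt ` W" unfolding W_def by blast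
    finally show ?thesis .
  qed
  have WI: "cone_sum (cone (vdom x (org e))) (cone (vdom (x \<odot> edg e) (ter e))) \<subseteq> W"
    if "is_edge v0 x e" for x e using that unfolding W_def by blast
  \<comment> \<open>A reduced path leads from the edge carrying \<open>p\<close> to the vertex
    carrying \<open>q\<close>. The union of hulls along its chain contains both points, is closed
    under addition and lies in \<open>W\<close>.\<close>
  have add_cone: "p + q \<in> W" if p: "p \<in> W" and x2: "gpath G v0 w2 x2" and q: "q \<in> cone (vdom x2 w2)" for p q x2 w2
  proof -
    obtain x1 e1 where e1: "is_edge v0 x1 e1"
      "p \<in> cone_sum (cone (vdom x1 (org e1))) (cone (vdom (x1 \<odot> edg e1) (ter e1)))"
      using p unfolding W_def by blast
    obtain x u ss where ss: "gpath G v0 u x" "syllables G u ss w2" "reduced G ss" "ss \<noteq> []"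
      "vdom_seq x u ss (length ss) = vdom x2 w2"
      and first: "vdom_seq x u ss 0 = vdom x1 (org e1) \<and> vdom_seq x u ss 1 = vdom (x1 \<odot> edg e1) (ter e1) \<or>
       vdom_seq x u ss 1 = vdom x1 (org e1) \<and> vdom_seq x u ss 0 = vdom (x1 \<odot> edg e1) (ter e1)"
      by (rule chain_through_edge[OF e1(1) x2])
    define K where "K i = cone (vdom_seq x u ss i)" for i
    have xc: "x \<in> FG" using gpath_closed[OF ss(1)] .
    have ch: "proj_chain (length ss) (vdom_seq x u ss)" by (rule chain_dom_seq[OF ex ss(2,3) xc])
    have gp: "gpath G v0 (end_vertex G u (take i ss)) (x \<odot> syl (take i ss))" for i
      using gpath_mult[OF ss(1) gpath_syllables[OF syllables_take[OF ss(2)]]] .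
    have Kc: "proper_cone (K i)" "vdom_seq x u ss i = proj_pt ` K i" for i
      using cone(1,2)[OF gp[of i]] unfolding K_def vdom_seq_def by auto
    have meet: "K i \<inter> K (i + 1) \<noteq> {}" if i: "i < length ss" for i
    proof -
      have "proj_adjacent (vdom_seq x u ss i) (vdom_seq x u ss (Suc i))" using ch i unfolding proj_chain_def by blast
      then have "vdom_seq x u ss i \<inter> vdom_seq x u ss (Suc i) \<noteq> {}" unfolding proj_adjacent_def by blast
      then show ?thesis using cone_meet[of "vdom_seq x u ss i"] Kc[of i] unfolding K_def by simp
    qed
    have lift: "cone_lift (length ss) (vdom_seq x u ss) K" unfolding cone_lift_def using Kc meet by simp
    let ?V = "\<Union>i<length ss. cone_sum (K i) (K (i + 1))"
    have VW: "?V \<subseteq> W"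
    proof
      fix z assume "z \<in> ?V"
      then obtain i where i: "i < length ss" "z \<in> cone_sum (K i) (K (i + 1))" by blast
      obtain y e where ye: "is_edge v0 y e" "vdom_seq x u ss i = vdom y (org e)"
        "vdom_seq x u ss (Suc i) = vdom (y \<odot> edg e) (ter e)"
        by (rule vdom_seq_step[OF ss(1,2) i(1)])
      show "z \<in> W" using WI[OF ye(1)] i(2) ye(2,3) unfolding K_def by auto
    qed
    have len: "0 < length ss" using ss(4) by simp
    \<comment> \<open>The chain may traverse the first edge in either direction, which does not
      affect the commutative sum.\<close>
    have "p \<in> cone_sum (K 0) (K 1)"
      using first e1(2) unfolding K_def cone_sum_def by (auto simp: add.commute) (metis add.commute)+
    then have pV: "p \<in> ?V" using len by force
    have "K (length ss) \<subseteq> cone_sum (K (length ss - 1)) (K (length ss - 1 + 1))"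
      using subset_cone_sum(2)[OF Kc(1) Kc(1), of "length ss - 1" "length ss"] meet[of "length ss - 1"] len by simp
    moreover have "q \<in> K (length ss)" unfolding K_def ss(5) using q .
    ultimately have "q \<in> cone_sum (K (length ss - 1)) (K (length ss - 1 + 1))" by blast
    then have qV: "q \<in> ?V" using len by (intro UN_I[of "length ss - 1"]) auto
    have "p + q \<in> ?V"
    proof (rule chain_hull_add[OF dim _ _ _ pV qV])
      show "proper_cone (K i)" for i by (rule Kc)
      show "K i \<inter> K (i + 1) \<noteq> {}" if "i < length ss" for i using meet[OF that] .
      show "occults (K i) (K (i + 1)) (K (i + 2))" if "i + 2 \<le> length ss" for i
        using cone_lift_occults(1)[OF ch lift, of i] that by simp
    qed
    then show ?thesis using VW by blast
  qed
  \<comment> \<open>The second summand is a sum of two vectors from vertex cones, and these are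
    added one after the other.\<close>
  have W_add: "p + q \<in> W" if p: "p \<in> W" and q: "q \<in> W" for p q
  proof -
    obtain x e where e: "is_edge v0 x e"
      "q \<in> cone_sum (cone (vdom x (org e))) (cone (vdom (x \<odot> edg e) (ter e)))"
      using q unfolding W_def by blast
    then obtain c d where cd: "c \<in> cone (vdom x (org e))" "d \<in> cone (vdom (x \<odot> edg e) (ter e))" "q = c + d"
      unfolding cone_sum_def by blast
    have "p + c \<in> W" using add_cone[OF p _ cd(1)] e(1) unfolding is_edge_def by blast
    from add_cone[OF this gpath_edge_right[OF e(1)] cd(2)] show ?thesis unfolding cd(3) by (simp add: add.assoc)
  qed
  have W_props: "open W" "\<forall>c>0. \<forall>w\<in>W. c *\<^sub>R w \<in> W" "f \<in> strict_dual W"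
  proof -
    let ?S = "\<lambda>x e. cone_sum (cone (vdom x (org e))) (cone (vdom (x \<odot> edg e) (ter e)))"
    have est: "\<epsilon> * norm w \<le> f \<bullet> w" if xe: "is_edge v0 x e" and w: "w \<in> ?S x e" for x e w
    proof -
      obtain k l where kl: "k \<in> cone (vdom x (org e))" "l \<in> cone (vdom (x \<odot> edg e) (ter e))" "w = k + l"
        using w unfolding cone_sum_def by blast
      have "\<epsilon> * norm w \<le> \<epsilon> * (norm k + norm l)" unfolding kl(3) using \<epsilon> by (intro mult_left_mono norm_triangle_ineq) auto
      also have "\<dots> = \<epsilon> * norm k + \<epsilon> * norm l" by (simp add: distrib_left)
      also have "\<dots> \<le> f \<bullet> k + f \<bullet> l"
      proof (rule add_mono)
        show "\<epsilon> * norm k \<le> f \<bullet> k" using cone(3)[of "org e" x] xe kl(1) unfolding is_edge_def by blast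
        show "\<epsilon> * norm l \<le> f \<bullet> l" using cone(3)[OF gpath_edge_right[OF xe]] kl(2) by blast
      qed
      finally show ?thesis unfolding kl(3) by (simp add: inner_add_right)
    qed
    then have "\<forall>w\<in>W. \<epsilon> * norm w \<le> f \<bullet> w" unfolding W_def by blast
    then show "f \<in> strict_dual W" unfolding strict_dual_def using \<epsilon> by blast
    have "proper_cone (?S x e)" if xe: "is_edge v0 x e" for x e
    proof (rule proper_cone_sum(1)[OF edge_cones(1,2)[OF xe]])
      show "f \<in> strict_dual (cone (vdom x (org e)))"
        using cone(3)[of "org e" x] xe \<epsilon> unfolding is_edge_def strict_dual_def by blast
      show "f \<in> strict_dual (cone (vdom (x \<odot> edg e) (ter e)))"
        using cone(3)[OF gpath_edge_right[OF xe]] \<epsilon> unfolding strict_dual_def by blast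
    qed
    then show "open W" "\<forall>c>0. \<forall>w\<in>W. c *\<^sub>R w \<in> W"
      unfolding W_def by (auto intro!: open_Union dest: proper_coneD(1)) (blast dest: proper_coneD(4))
  qed
  have "W \<noteq> {}"
  proof -
    have av: "a \<in> Es" using ex unfolding distinct_branches_def by simp
    obtain x where "gpath G v0 (org a) x" using gpath_exists[OF v0] av by (meson head_tail_verts)
    then have xe: "is_edge v0 x a" using av unfolding is_edge_def by simp
    show ?thesis using WI[OF xe] edge_cones[OF xe] subset_cone_sum(1)[OF edge_cones[OF xe]] by blast
  qed
  then have "proper_cone W" unfolding proper_cone_def using W_props W_add by blast
  then show ?thesis unfolding tot by (rule properly_convex_proj_cone)
qed

text \<open>Left multiplication by a closed path permutes the paths from \<open>v0\<close>; the
  inverse path gives the reverse inclusion.\<close>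

theorem total_domain_invariant:
  assumes x: "gpath G v0 v0 x"
  shows "pgl_act (R x) ` total_domain G v0 R g \<Omega> = total_domain G v0 R g \<Omega>"
proof -
  have sub: "pgl_act (R x) ` total_domain G v0 R g \<Omega> \<subseteq> total_domain G v0 R g \<Omega>" if x: "gpath G v0 v0 x" for x
  proof
    fix p assume "p \<in> pgl_act (R x) ` total_domain G v0 R g \<Omega>"
    then obtain p' where p': "p' \<in> total_domain G v0 R g \<Omega>" "p = pgl_act (R x) p'" by blast
    then obtain e y q where e: "e \<in> Es" "y \<in> F_paths G v0 (org e)" "q \<in> edge_hull G g \<Omega> e"
      "p' = pgl_act (R y) q" unfolding total_domain_def by blast
    then have e: "e \<in> Es" "gpath G v0 (org e) y" "q \<in> edge_hull G g \<Omega> e"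
      "p = pgl_act (R x) (pgl_act (R y) q)" using p' by (simp_all add: F_paths_iff)
    have "x \<in> FG" "y \<in> FG" using gpath_closed x e(2) by auto
    then have "p = pgl_act (R (x \<odot> y)) q" using e(4) by (simp add: pgl_act_mult)
    moreover have "x \<odot> y \<in> F_paths G v0 (org e)" unfolding F_paths_iff by (rule gpath_mult[OF x e(2)])
    ultimately show "p \<in> total_domain G v0 R g \<Omega>"
      unfolding total_domain_def using e(1,3) head_tail_verts(1)[OF e(1)] by blast
  qed
  have xc: "x \<in> FG" using gpath_closed[OF x] .
  have "total_domain G v0 R g \<Omega> = pgl_act (R x) ` pgl_act (R (inv\<^sub>F x)) ` total_domain G v0 R g \<Omega>"
    using xc by (simp add: pgl_act_image_mult[symmetric] pgl_act_one)
  also have "\<dots> \<subseteq> pgl_act (R x) ` total_domain G v0 R g \<Omega>" by (intro image_mono sub gpath_inv x)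
  finally show ?thesis using sub[OF x] by blast
qed

end

text \<open>The convexity claims are stated under the existence of distinct branches: otherwise the
  occultation hypothesis is vacuous and does not constrain how the domains at the two ends of the
  single tree edge lie. Discreteness and faithfulness then come from the vertex group at the base,
  where every closed path reduces to a vertex element.\<close>

theorem theorem3p4:
  fixes G :: "('v, 'e, 'g, 'h) gog"
    and v\<^sub>0 :: 'v
    and \<rho> :: "'v \<Rightarrow> 'g \<Rightarrow> (real^'n^'n) set"
    and g :: "'e \<Rightarrow> (real^'n^'n) set"
    and R :: "('v, 'e, 'g) letter list set \<Rightarrow> (real^'n^'n) set"
    and \<Omega> :: "'v \<Rightarrow> (real^'n) proj set"
  assumes "graph_of_groups G"
    and "v\<^sub>0 \<in> verts (base G)"
    and "arcs (base G) \<noteq> {}"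
    and "CARD('n) \<ge> 3"
    and "\<And>v. v \<in> verts (base G) \<Longrightarrow> discrete_faithful (vgrp G v) (\<rho> v)"
    and "\<And>e. e \<in> arcs (base G) \<Longrightarrow> g e \<in> carrier PGL"
    and "\<And>e. e \<in> arcs (base G) \<Longrightarrow> g e = inv\<^bsub>PGL\<^esub> (g (erev G e))"
    and "\<And>e \<gamma>. e \<in> arcs (base G) \<Longrightarrow> \<gamma> \<in> carrier (egrp G (uedge G e)) \<Longrightarrow>
           \<rho> (tail (base G) e) (emb G e \<gamma>) =
             g e \<otimes>\<^bsub>PGL\<^esub> \<rho> (head (base G) e) (emb G (erev G e) \<gamma>) \<otimes>\<^bsub>PGL\<^esub> inv\<^bsub>PGL\<^esub> (g e)"
    and "R \<in> hom (F_group G) PGL"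
    and "\<And>v x. v \<in> verts (base G) \<Longrightarrow> x \<in> carrier (vgrp G v) \<Longrightarrow> R (F_class G [Vtx v x]) = \<rho> v x"
    and "\<And>e. e \<in> arcs (base G) \<Longrightarrow> R (F_class G [Edg e]) = g e"
    and "\<And>v. v \<in> verts (base G) \<Longrightarrow> properly_convex (\<Omega> v)"
    and "\<And>v x. v \<in> verts (base G) \<Longrightarrow> x \<in> carrier (vgrp G v) \<Longrightarrow> pgl_act (\<rho> v x) ` \<Omega> v = \<Omega> v"
    and "\<And>e e' \<gamma>. distinct_branches G e e' \<gamma> \<Longrightarrow>
           occultation_position
             (pgl_act (g e) ` \<Omega> (head (base G) e))
             (\<Omega> (tail (base G) e))
             (pgl_act (\<rho> (tail (base G) e) \<gamma> \<otimes>\<^bsub>PGL\<^esub> g e') ` \<Omega> (head (base G) e'))"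
  shows "discrete_faithful (pi1 G v\<^sub>0) R \<and>
    ((\<exists>e e' \<gamma>. distinct_branches G e e' \<gamma>) \<longrightarrow>
       (\<forall>e\<in>arcs (base G).
          proj_hull_well_defined (\<Omega> (tail (base G) e) \<union> pgl_act (g e) ` \<Omega> (head (base G) e)) \<and>
          properly_convex (edge_hull G g \<Omega> e)) \<and>
       (\<forall>x\<in>carrier (pi1 G v\<^sub>0).
          pgl_act (R x) ` total_domain G v\<^sub>0 R g \<Omega> = total_domain G v\<^sub>0 R g \<Omega>) \<and>
       open (total_domain G v\<^sub>0 R g \<Omega>) \<and>
       properly_convex (total_domain G v\<^sub>0 R g \<Omega>))"
proof -
  interpret occulting_gog G \<rho> g R \<Omega>
    by (intro occulting_gog.intro occulting_gog_axioms.intro) (fact assms)+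
  have hull: "proj_hull_well_defined (\<Omega> (tail (base G) e) \<union> pgl_act (g e) ` \<Omega> (head (base G) e)) \<and>
      properly_convex (edge_hull G g \<Omega> e)"
    if ex: "distinct_branches G a b c" and e: "e \<in> arcs (base G)" for a b c e
    by (rule edge_hull_cones[OF ex e]) (simp add: properly_convex_proj_cone)
  have total: "properly_convex (total_domain G v\<^sub>0 R g \<Omega>)" if "distinct_branches G a b c" for a b c
    by (rule total_domain_properly_convex[OF that assms(2)])
  have inv: "pgl_act (R x) ` total_domain G v\<^sub>0 R g \<Omega> = total_domain G v\<^sub>0 R g \<Omega>" if "x \<in> carrier (pi1 G v\<^sub>0)" for x
    using that by (intro total_domain_invariant) (simp add: pi1_def F_paths_iff)
  have op: "open (total_domain G v\<^sub>0 R g \<Omega>)" if "distinct_branches G a b c" for a b c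
    using total[OF that] unfolding properly_convex_def by blast
  show ?thesis
  proof (intro conjI impI ballI)
    show "discrete_faithful (pi1 G v\<^sub>0) R" by (rule pi1_discrete_faithful[OF assms(2) assms(5)[OF assms(2)]])
  qed (use hull total inv op in blast)+
qed

end
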